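(* Let $b,\mu>0$, $k\ge 3$, and let $\alpha_1,\ldots,\alpha_k\in\mathbb{C}$ satisfy $\operatorname{Re}(\alpha_j)>-\frac{1}{2b}$ for each $j$. Suppose that $w:=(Q-\sum_{j=1}^k\alpha_j)/b$ is a positive integer, where $Q=b-\frac1b$. Let $x_1,\ldots,x_k$ be distinct points on $S^2$, none of which is the north pole $e_3=(0,0,1)$, and let $z_1,\ldots,z_k\in\mathbb{C}$ be their stereographic projections. Then \begin{align*} &C(\alpha_1,\ldots,\alpha_k;z_1,\ldots,z_k;b;\mu)=\tilde C(\alpha_1,\ldots,\alpha_k;x_1,\ldots,x_k;b;\mu)\\ &=\frac{e^{-i\pi w}\mu^{w}}{w!}\,(4/e)^{1-1/b^2}\prod_{1\le j<j'\le k}|z_j-z_{j'}|^{4\alpha_j\alpha_{j'}}\\ &\qquad\cdot\int_{\mathbb{C}^w}\biggl(\prod_{j=1}^k\prod_{l=1}^{w}|z_j-t_l|^{4b\alpha_j}\biggr)\biggl(\prod_{1\le l<l'\le w}|t_l-t_{l'}|^{4b^2}\biggr)\,d^2t_1\cdots d^2t_w, \end{align*} where $d^2t$ denotes Lebesgue measure on $\mathbb{C}$.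
   Context: Notation. $S^2\subset\mathbb{R}^3$ is the unit sphere with area measure $a$; $e_3=(0,0,1)$; $\sigma:S^2\setminus\{e_3\}\to\mathbb{C}$, $\sigma(x,y,z)=\frac{x+iy}{1-z}$, is stereographic projection; $g(z)=\frac{4}{(1+|z|^2)^2}$ for $z\in\mathbb{C}$. For $b>0$: $Q=b-\frac1b$, $\chi=\ln 4-1$, $\Delta_\alpha=\alpha(Q-\alpha)$. $\{Y_{lm}\}_{l\ge0,-l\le m\le l}$ are the real spherical harmonics, an orthonormal basis of real $L^2(S^2,a)$ with $\Delta_{S^2}Y_{lm}=-l(l+1)Y_{lm}$. Wrong sign Gaussian expectation. If $h:\mathbb{R}^N\to\mathbb{C}$ extends to a holomorphic function $\tilde h$ on an open set $\Omega\subseteq\mathbb{C}^N$ containing $(\mathbb{R}\cup i\mathbb{R})^N$ and $\mathbb{E}|\tilde h(iW_1,\ldots,iW_N)|<\infty$ for i.i.d. standard Gaussians $W_1,\ldots,W_N$, then for a vector $X=(X_1,\ldots,X_N)$ of "independent $N(0,-1)$ variables" one defines $\mathbb{E}(h(X)):=\mathbb{E}(\tilde h(iW_1,\ldots,iW_N))$. Regularized correlation function. For $\epsilon>0$, $\lambda\in(0,1)$, $L\ge1$, let $(X_{lm})_{0\le l\le L,-l\le m\le l}$ be i.i.d. $N(0,-1)$ variables (so that, with $N=(L+1)^2$, the expectation of a function $h$ of these variables is the wrong sign Gaussian expectation $\mathbb{E}(h(X)):=\mathbb{E}(\tilde h(iW_1,\ldots,iW_N))$, where $\tilde h$ is the holomorphic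 extension of $h$ and $W_1,\ldots,W_N$ are i.i.d. standard Gaussians), and put $$G_{\lambda,L}(x,y)=\sum_{l=1}^L\sum_{m=-l}^l\lambda^l\frac{2\pi}{l(l+1)}Y_{lm}(x)Y_{lm}(y),\quad X_{\lambda,L}(x)=\sum_{l=1}^L\sum_{m=-l}^l\lambda^{l/2}\sqrt{\tfrac{2\pi}{l(l+1)}}\,X_{lm}Y_{lm}(x),\quad D=\frac{X_{00}}{\sqrt{8\pi\epsilon}},$$ $$\tilde V_{X_{\lambda,L}}(\alpha,x)=e^{\chi\alpha(b-\alpha)}g(\sigma(x))^{-\Delta_\alpha}e^{2\alpha X_{\lambda,L}(x)+2\alpha^2G_{\lambda,L}(x,x)}.$$ With $w=(Q-\sum_j\alpha_j)/b$, define $$\tilde C_{\epsilon,\lambda,L}(\alpha_1,\ldots,\alpha_k;x_1,\ldots,x_k;b;\mu)=\mathbb{E}\Bigl[\prod_{j=1}^k\tilde V_{X_{\lambda,L}}(\alpha_j,x_j)\exp\Bigl(-2bwD-\mu e^{2bD}\int_{S^2}e^{2bX_{\lambda,L}(x)+2b^2G_{\lambda,L}(x,x)}da(x)\Bigr)\Bigr].$$ Correlation functions. $\tilde C(\alpha_1,\ldots,\alpha_k;x_1,\ldots,x_k;b;\mu):=\lim_{\lambda\uparrow1}\lim_{L\to\infty}\lim_{\epsilon\to0}\tilde C_{\epsilon,\lambda,L}(\alpha_1,\ldots,\alpha_k;x_1,\ldots,x_k;b;\mu)$, and for $z_j=\sigma(x_j)$, $C(\alpha_1,\ldots,\alpha_k;z_1,\ldots,z_k;b;\mu):=\tilde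 C(\alpha_1,\ldots,\alpha_k;x_1,\ldots,x_k;b;\mu)$. *)

theory Defs
  imports "HOL-Probability.Probability"
begin

definition north_pole :: "real^3" where
  "north_pole = vector [0, 0, 1]"

text \<open>The area element \<open>sin \<theta> d\<theta> d\<phi>\<close> in spherical coordinates, as a Borel measure on \<open>\<real>\<^sup>3\<close>
  carried by the unit sphere (total mass \<open>4\<pi>\<close>).\<close>

definition sphere_area :: "(real^3) measure" where
  "sphere_area =
     distr (density lborel
              (\<lambda>(\<theta>, \<phi>). ennreal (indicator ({0..pi} \<times> {0..2*pi}) (\<theta>, \<phi>) * sin \<theta>)))
       borel
       (\<lambda>(\<theta>::real, \<phi>::real). vector [sin \<theta> * cos \<phi>, sin \<theta> * sin \<phi>, cos \<theta>])"

definition stereo :: "real^3 \<Rightarrow> complex" where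
  "stereo x = (complex_of_real (x$1) + \<i> * complex_of_real (x$2)) / complex_of_real (1 - x$3)"

definition sphere_metric :: "complex \<Rightarrow> real" where
  "sphere_metric z = 4 / (1 + (cmod z)^2)^2"

text \<open>Rodrigues' formula.\<close>

definition legendre_poly :: "nat \<Rightarrow> real poly" where
  "legendre_poly l = smult (1 / (2^l * fact l)) ((pderiv ^^ l) ([:-1, 0, 1:] ^ l))"

text \<open>
  In spherical coordinates \<open>x = (sin \<theta> cos \<phi>, sin \<theta> sin \<phi>, cos \<theta>)\<close> and with \<open>n = \<bar>m\<bar>\<close>, the
  associated Legendre function is \<open>sin\<^sup>n \<theta>\<close> times the \<open>n\<close>-th derivative of the Legendre
  polynomial at \<open>cos \<theta>\<close>, and \<open>sin\<^sup>n \<theta> cos (n \<phi>)\<close>, \<open>sin\<^sup>n \<theta> sin (n \<phi>)\<close> are the real and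
  imaginary parts of \<open>(x\<^sub>1 + \<i> x\<^sub>2)\<^sup>n\<close>.  So this is the usual
  \<open>sqrt ((2l+1)/(4\<pi>) \<cdot> (l-n)!/(l+n)!) P\<^sub>l\<^sup>n (cos \<theta>)\<close> times \<open>1\<close>, \<open>sqrt 2 cos (n \<phi>)\<close> or
  \<open>sqrt 2 sin (n \<phi>)\<close>, without the Condon--Shortley sign.  It is meant for
  \<open>\<bar>m\<bar> \<le> l\<close> and \<open>x\<close> on the unit sphere.
\<close>

definition sph_harm :: "nat \<Rightarrow> int \<Rightarrow> real^3 \<Rightarrow> real" where
  "sph_harm l m x =
     (let n = nat \<bar>m\<bar>;
          u = (complex_of_real (x$1) + \<i> * complex_of_real (x$2)) ^ n
      in sqrt ((2 * real l + 1) / (4 * pi) * (fact (l - n) / fact (l + n)))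
         * poly ((pderiv ^^ n) (legendre_poly l)) (x$3)
         * (if m = 0 then 1 else if m > 0 then sqrt 2 * Re u else sqrt 2 * Im u))"

text \<open>Points of \<open>\<complex>\<^sup>I\<close>, for a finite index set \<open>I\<close>, are the functions in
  \<open>I \<rightarrow>\<^sub>E UNIV\<close>.  Holomorphy is complex (Frechet) differentiability at every point.\<close>

definition holomorphic_several :: "'i set \<Rightarrow> (('i \<Rightarrow> complex) \<Rightarrow> complex) \<Rightarrow> ('i \<Rightarrow> complex) set \<Rightarrow> bool" where
  "holomorphic_several I H \<Omega> \<longleftrightarrow>
     (\<forall>z\<in>\<Omega>. \<exists>c. \<forall>e>0. \<exists>d>0. \<forall>u\<in>\<Omega>. (\<forall>i\<in>I. cmod (u i - z i) < d) \<longrightarrow>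
        cmod (H u - H z - (\<Sum>i\<in>I. c i * (u i - z i))) \<le> e * (\<Sum>i\<in>I. cmod (u i - z i)))"

definition holomorphic_extension ::
    "'i set \<Rightarrow> (('i \<Rightarrow> real) \<Rightarrow> complex) \<Rightarrow> (('i \<Rightarrow> complex) \<Rightarrow> complex) \<Rightarrow> ('i \<Rightarrow> complex) set \<Rightarrow> bool" where
  "holomorphic_extension I h H \<Omega> \<longleftrightarrow>
     openin (product_topology (\<lambda>_. euclidean) I) \<Omega> \<and>
     (I \<rightarrow>\<^sub>E (range complex_of_real \<union> range (\<lambda>y. \<i> * complex_of_real y))) \<subseteq> \<Omega> \<and>
     holomorphic_several I H \<Omega> \<and>
     (\<forall>x \<in> I \<rightarrow>\<^sub>E UNIV. H (\<lambda>i\<in>I. complex_of_real (x i)) = h x)"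

definition std_gaussian :: "'i set \<Rightarrow> ('i \<Rightarrow> real) measure" where
  "std_gaussian I = PiM I (\<lambda>_. density lborel std_normal_density)"

definition has_wrong_sign_expectation :: "'i set \<Rightarrow> (('i \<Rightarrow> real) \<Rightarrow> complex) \<Rightarrow> complex \<Rightarrow> bool" where
  "has_wrong_sign_expectation I h c \<longleftrightarrow>
     (\<exists>H \<Omega>. holomorphic_extension I h H \<Omega> \<and>
        integrable (std_gaussian I) (\<lambda>W. H (\<lambda>i\<in>I. \<i> * complex_of_real (W i))) \<and>
        c = (LINT W|std_gaussian I. H (\<lambda>i\<in>I. \<i> * complex_of_real (W i))))"

text \<open>The value does not depend on the extension, since a holomorphic function on \<open>\<Omega>\<close> is
  determined on \<open>(\<real> \<union> \<i>\<real>)\<^sup>I\<close> by its values on \<open>\<real>\<^sup>I\<close>.\<close>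

definition wrong_sign_expectation :: "'i set \<Rightarrow> (('i \<Rightarrow> real) \<Rightarrow> complex) \<Rightarrow> complex" where
  "wrong_sign_expectation I h = (THE c. has_wrong_sign_expectation I h c)"

definition Q_const :: "real \<Rightarrow> real" where
  "Q_const b = b - 1 / b"

definition chi_const :: real where
  "chi_const = ln 4 - 1"

definition conf_weight :: "real \<Rightarrow> complex \<Rightarrow> complex" where
  "conf_weight b \<alpha> = \<alpha> * (complex_of_real (Q_const b) - \<alpha>)"

definition w_param :: "nat \<Rightarrow> (nat \<Rightarrow> complex) \<Rightarrow> real \<Rightarrow> complex" where
  "w_param k \<alpha> b = (complex_of_real (Q_const b) - (\<Sum>j=1..k. \<alpha> j)) / complex_of_real b"

definition mode_set :: "nat \<Rightarrow> (nat \<times> int) set" where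
  "mode_set L = {(l, m). l \<le> L \<and> \<bar>m\<bar> \<le> int l}"

definition reg_green :: "real \<Rightarrow> nat \<Rightarrow> real^3 \<Rightarrow> real^3 \<Rightarrow> real" where
  "reg_green lam L x y =
     (\<Sum>l=1..L. \<Sum>m=-int l..int l.
        lam ^ l * (2 * pi / (real l * (real l + 1))) * sph_harm l m x * sph_harm l m y)"

definition reg_field :: "real \<Rightarrow> nat \<Rightarrow> (nat \<times> int \<Rightarrow> real) \<Rightarrow> real^3 \<Rightarrow> real" where
  "reg_field lam L X x =
     (\<Sum>l=1..L. \<Sum>m=-int l..int l.
        lam powr (real l / 2) * sqrt (2 * pi / (real l * (real l + 1))) * X (l, m) * sph_harm l m x)"

definition zero_mode :: "real \<Rightarrow> (nat \<times> int \<Rightarrow> real) \<Rightarrow> real" where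
  "zero_mode \<epsilon> X = X (0, 0) / sqrt (8 * pi * \<epsilon>)"

definition reg_vertex ::
    "real \<Rightarrow> nat \<Rightarrow> real \<Rightarrow> (nat \<times> int \<Rightarrow> real) \<Rightarrow> complex \<Rightarrow> real^3 \<Rightarrow> complex" where
  "reg_vertex lam L b X \<alpha> x =
     exp (complex_of_real chi_const * \<alpha> * (complex_of_real b - \<alpha>))
     * complex_of_real (sphere_metric (stereo x)) powr (- conf_weight b \<alpha>)
     * exp (2 * \<alpha> * complex_of_real (reg_field lam L X x)
            + 2 * \<alpha>^2 * complex_of_real (reg_green lam L x x))"

definition reg_area :: "real \<Rightarrow> nat \<Rightarrow> real \<Rightarrow> (nat \<times> int \<Rightarrow> real) \<Rightarrow> real" where
  "reg_area lam L b X =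
     (LINT x|sphere_area. exp (2 * b * reg_field lam L X x + 2 * b^2 * reg_green lam L x x))"

definition reg_integrand ::
    "real \<Rightarrow> real \<Rightarrow> nat \<Rightarrow> nat \<Rightarrow> (nat \<Rightarrow> complex) \<Rightarrow> (nat \<Rightarrow> real^3) \<Rightarrow> real \<Rightarrow> real
      \<Rightarrow> (nat \<times> int \<Rightarrow> real) \<Rightarrow> complex" where
  "reg_integrand \<epsilon> lam L k \<alpha> x b \<mu> X =
     (\<Prod>j=1..k. reg_vertex lam L b X (\<alpha> j) (x j))
     * exp (- 2 * complex_of_real b * w_param k \<alpha> b * complex_of_real (zero_mode \<epsilon> X)
            - complex_of_real (\<mu> * exp (2 * b * zero_mode \<epsilon> X) * reg_area lam L b X))"

definition reg_correlation ::
    "real \<Rightarrow> real \<Rightarrow> nat \<Rightarrow> nat \<Rightarrow> (nat \<Rightarrow> complex) \<Rightarrow> (nat \<Rightarrow> real^3) \<Rightarrow> real \<Rightarrow> real \<Rightarrow> complex" where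
  "reg_correlation \<epsilon> lam L k \<alpha> x b \<mu> =
     wrong_sign_expectation (mode_set L) (reg_integrand \<epsilon> lam L k \<alpha> x b \<mu>)"

definition correlation_lam_L ::
    "real \<Rightarrow> nat \<Rightarrow> nat \<Rightarrow> (nat \<Rightarrow> complex) \<Rightarrow> (nat \<Rightarrow> real^3) \<Rightarrow> real \<Rightarrow> real \<Rightarrow> complex" where
  "correlation_lam_L lam L k \<alpha> x b \<mu> =
     Lim (at_right 0) (\<lambda>\<epsilon>. reg_correlation \<epsilon> lam L k \<alpha> x b \<mu>)"

definition correlation_lam ::
    "real \<Rightarrow> nat \<Rightarrow> (nat \<Rightarrow> complex) \<Rightarrow> (nat \<Rightarrow> real^3) \<Rightarrow> real \<Rightarrow> real \<Rightarrow> complex" where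
  "correlation_lam lam k \<alpha> x b \<mu> = lim (\<lambda>L. correlation_lam_L lam L k \<alpha> x b \<mu>)"

definition correlation_sphere ::
    "nat \<Rightarrow> (nat \<Rightarrow> complex) \<Rightarrow> (nat \<Rightarrow> real^3) \<Rightarrow> real \<Rightarrow> real \<Rightarrow> complex" where
  "correlation_sphere k \<alpha> x b \<mu> = Lim (at_left 1) (\<lambda>lam. correlation_lam lam k \<alpha> x b \<mu>)"

text \<open>\<open>Lim\<close>, \<open>lim\<close> and \<open>THE\<close> return arbitrary values when there is nothing to denote; the
  following says that every expectation and every limit above exists.\<close>

definition correlation_well_defined ::
    "nat \<Rightarrow> (nat \<Rightarrow> complex) \<Rightarrow> (nat \<Rightarrow> real^3) \<Rightarrow> real \<Rightarrow> real \<Rightarrow> bool" where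
  "correlation_well_defined k \<alpha> x b \<mu> \<longleftrightarrow>
     (\<forall>lam\<in>{0<..<1}. \<forall>L\<ge>1. \<forall>\<epsilon>>0.
        \<exists>!c. has_wrong_sign_expectation (mode_set L) (reg_integrand \<epsilon> lam L k \<alpha> x b \<mu>) c) \<and>
     (\<forall>lam\<in>{0<..<1}. \<forall>L\<ge>1.
        \<exists>c. ((\<lambda>\<epsilon>. reg_correlation \<epsilon> lam L k \<alpha> x b \<mu>) \<longlongrightarrow> c) (at_right 0)) \<and>
     (\<forall>lam\<in>{0<..<1}. convergent (\<lambda>L. correlation_lam_L lam L k \<alpha> x b \<mu>)) \<and>
     (\<exists>c. ((\<lambda>lam. correlation_lam lam k \<alpha> x b \<mu>) \<longlongrightarrow> c) (at_left 1))"

definition correlation_plane ::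
    "nat \<Rightarrow> (nat \<Rightarrow> complex) \<Rightarrow> (nat \<Rightarrow> complex) \<Rightarrow> real \<Rightarrow> real \<Rightarrow> complex" where
  "correlation_plane k \<alpha> z b \<mu> =
     correlation_sphere k \<alpha> (\<lambda>j. inv_into (sphere 0 1 - {north_pole}) stereo (z j)) b \<mu>"

definition coulomb_integrand ::
    "nat \<Rightarrow> nat \<Rightarrow> (nat \<Rightarrow> complex) \<Rightarrow> (nat \<Rightarrow> complex) \<Rightarrow> real \<Rightarrow> (nat \<Rightarrow> complex) \<Rightarrow> complex" where
  "coulomb_integrand w k \<alpha> z b t =
     (\<Prod>j=1..k. \<Prod>l=1..w.
        complex_of_real (cmod (z j - t l)) powr (4 * complex_of_real b * \<alpha> j))
     * (\<Prod>l=1..w. \<Prod>l'\<in>{l<..w}. complex_of_real (cmod (t l - t l') powr (4 * b^2)))"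

end

theory Submission
  imports Defs "HOL-Complex_Analysis.Conformal_Mappings"
begin

text \<open>
  Expand the outer exponential of \<open>- \<mu> e\<^sup>2\<^sup>b\<^sup>D \<integral> e\<^sup>2\<^sup>b\<^sup>X da\<close> in powers of \<open>\<mu>\<close>.  The \<open>n\<close>-th power of the
  area integral is an integral over \<open>n\<close> points \<open>y\<^sub>1, \<dots>, y\<^sub>n\<close> of the sphere, and once these points are
  fixed the variables \<open>X\<^sub>l\<^sub>m\<close> occur only linearly inside an exponential.  Since
  \<open>exp (\<Sum> c\<^sub>i X\<^sub>i)\<close> has expectation \<open>exp (- \<Sum> c\<^sub>i\<^sup>2 / 2)\<close> for variables of variance \<open>-1\<close>, each term is
  explicit.  The expansion converges because the substitution \<open>X = \<i>W\<close> gives the inner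
  exponentials modulus one: the series is dominated by the exponential series of
  \<open>\<bar>\<mu>\<bar>\<close> times the total mass, and Fubini's theorem applies.  This is \<open>wrong_sign_expectation_exp_exp\<close>.

  In the \<open>n\<close>-th term the zero mode \<open>D\<close> has coefficient \<open>2 b (n - w)\<close> and contributes the factor
  \<open>exp (- b\<^sup>2 (n - w)\<^sup>2 / (4 \<pi> \<epsilon>))\<close>.  As \<open>\<epsilon> \<rightarrow> 0\<close>, only the term \<open>n = w\<close> survives, with its
  prefactor \<open>(- \<mu>)\<^sup>w / w!\<close>; this is \<open>reg_correlation_tendsto\<close>.  In the other modes one completes the
  square: the normal ordering terms \<open>2 \<alpha>\<^sup>2 G\<close> and \<open>2 b\<^sup>2 G\<close> cancel the self-energies exactly, and the Boltzmann weight of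
  charges \<open>\<alpha>\<^sub>j\<close> at \<open>x\<^sub>j\<close> and charges \<open>b\<close> at \<open>y\<^sub>l\<close> with pair interaction \<open>G\<^sub>\<lambda>\<^sub>,\<^sub>L\<close> remains
  (\<open>complete_square_exponent\<close>).

  The addition theorem \<open>sph_harm_addition\<close> turns \<open>G\<^sub>\<lambda>\<^sub>,\<^sub>L (x, y)\<close> into a Legendre series in \<open>x \<bullet> y\<close>, and the
  generating function of the Legendre polynomials sums it for \<open>L \<rightarrow> \<infinity>\<close> and \<open>\<lambda> < 1\<close>.  As \<open>\<lambda> \<rightarrow> 1\<close>
  the sum tends to \<open>(ln 2 - ln (1 - x \<bullet> y) - 1) / 2\<close>, which in stereographic coordinates is
  \<open>- ln \<bar>u - v\<bar> - (ln g(u) + ln g(v)) / 4 + \<chi> / 2\<close>.  Both limits pass under the integral by dominated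
  convergence.  In the second one, \<open>Re \<alpha>\<^sub>j > - 1/(2b)\<close> says that the singularity
  \<open>\<bar>z\<^sub>j - t\<bar>\<close> to the power \<open>4 b Re \<alpha>\<^sub>j\<close> is integrable on the plane; the \<open>x\<^sub>j\<close> are distinct, so that
  a point \<open>t\<close> can be close to only one of them, and the charges \<open>b\<close> repel each other, so that the
  factor from their mutual interaction is bounded.

  Finally, the condition \<open>\<Sum> \<alpha>\<^sub>j + b w = Q\<close> makes all powers of the conformal factor \<open>g\<close> cancel: those
  from the interaction, from the area measure and from the vertex operators.  The constants \<open>\<chi>\<close> add up
  to \<open>\<chi> (1 - 1/b\<^sup>2)\<close>, and \<open>e\<^sup>\<chi> = 4/e\<close> (\<open>coulomb_exponent_log_kernel\<close>).
\<close>

section \<open>Wrong sign Gaussian expectations\<close>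

text \<open>With \<open>c = p + \<i> q\<close>, the factor \<open>e\<^sup>-\<^sup>q\<^sup>W\<close> turns the Gaussian density into a multiple of a
  translate, and the characteristic function of the standard normal distribution evaluates
  the rest.  Complex \<open>c\<close> are needed because the charges \<open>\<alpha>\<^sub>j\<close> are complex.\<close>

lemma std_normal_exp_linear:
  fixes c :: complex
  shows "integrable std_normal_distribution (\<lambda>W. exp (\<i> * c * complex_of_real W))" (is ?I)
    and "(LINT W|std_normal_distribution. exp (\<i> * c * complex_of_real W)) = exp (- c\<^sup>2 / 2)" (is ?E)
proof -
  define p where "p = Re c"
  define q where "q = Im c"
  have c: "c = complex_of_real p + \<i> * complex_of_real q" by (simp add: p_def q_def complex_eq_iff)
  interpret prob_space std_normal_distribution by (rule prob_space_normal_density) simp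
  let ?G = "\<lambda>y. std_normal_density y *\<^sub>R iexp (p * y)"
  have "integrable std_normal_distribution (\<lambda>y. iexp (p * y))"
    by (rule integrable_const_bound[where B = 1]) auto
  then have intG: "integrable lborel ?G"
    by (subst (asm) integrable_density) (auto simp: normal_density_nonneg)
  have "(LINT y|std_normal_distribution. iexp (p * y)) = complex_of_real (exp (- (p\<^sup>2) / 2))"
    using char_std_normal_distribution by (simp add: char_def fun_eq_iff)
  then have valG: "(LINT y|lborel. ?G y) = complex_of_real (exp (- (p\<^sup>2) / 2))"
    by (subst (asm) integral_density) (auto simp: normal_density_nonneg)
  \<comment> \<open>the constant left over when the square in \<open>y + q\<close> is completed\<close>
  let ?k = "complex_of_real (exp (q\<^sup>2 / 2)) * iexp (- p * q)"
  have eq: "std_normal_density y *\<^sub>R exp (\<i> * c * complex_of_real y) = ?k * ?G (q + 1 * y)" for y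
  proof -
    have "std_normal_density y *\<^sub>R exp (\<i> * c * complex_of_real y)
        = complex_of_real (1 / sqrt (2 * pi)) * exp (complex_of_real (- y\<^sup>2 / 2) + \<i> * c * complex_of_real y)"
      by (simp add: std_normal_density_def scaleR_conv_of_real mult_exp_exp exp_of_real[symmetric])
    also have "complex_of_real (- y\<^sup>2 / 2) + \<i> * c * complex_of_real y
        = complex_of_real (q\<^sup>2 / 2) + \<i> * complex_of_real (- p * q)
          + complex_of_real (- (q + 1 * y)\<^sup>2 / 2) + \<i> * complex_of_real (p * (q + 1 * y))"
      by (simp add: c field_simps power2_eq_square)
    finally show ?thesis
      by (simp add: std_normal_density_def scaleR_conv_of_real exp_add exp_of_real[symmetric] del: of_real_add of_real_mult of_real_minus)
  qed
  have "integrable lborel (\<lambda>y. ?G (q + 1 * y))"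
    by (rule lborel_integrable_real_affine[OF intG]) simp
  then have int: "integrable lborel (\<lambda>y. std_normal_density y *\<^sub>R exp (\<i> * c * complex_of_real y))"
    unfolding eq by (rule integrable_mult_right)
  have "(LINT y|lborel. ?G y) = (LINT y|lborel. ?G (q + 1 * y))"
    using lborel_integral_real_affine[of 1 ?G q] by simp
  then have "(LINT y|lborel. std_normal_density y *\<^sub>R exp (\<i> * c * complex_of_real y))
      = ?k * complex_of_real (exp (- (p\<^sup>2) / 2))"
    unfolding eq integral_mult_right_zero using valG by simp
  also have "\<dots> = exp (complex_of_real (q\<^sup>2 / 2) + \<i> * complex_of_real (- p * q) + complex_of_real (- (p\<^sup>2) / 2))"
    by (simp add: mult_exp_exp exp_of_real[symmetric])
  also have "complex_of_real (q\<^sup>2 / 2) + \<i> * complex_of_real (- p * q) + complex_of_real (- (p\<^sup>2) / 2) = - c\<^sup>2/2"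
    by (simp add: c field_simps power2_eq_square)
  finally show ?E by (subst integral_density) (auto simp: normal_density_nonneg)
  show ?I using int by (subst integrable_density) (auto simp: normal_density_nonneg)
qed

lemma prob_space_std_gaussian: "prob_space (std_gaussian I)"
  unfolding std_gaussian_def by (intro prob_space_PiM prob_space_normal_density) simp

lemma std_gaussian_exp_linear:
  assumes "finite I"
  shows "integrable (std_gaussian I) (\<lambda>W. exp (\<i> * (\<Sum>i\<in>I. c i * complex_of_real (W i))))"
    and "(LINT W|std_gaussian I. exp (\<i> * (\<Sum>i\<in>I. c i * complex_of_real (W i))))
          = exp (- (\<Sum>i\<in>I. (c i)\<^sup>2) / 2)"
proof -
  interpret product_sigma_finite "\<lambda>_::'a. std_normal_distribution"
    by (intro product_sigma_finite.intro prob_space_imp_sigma_finite prob_space_normal_density) simp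
  have eq: "exp (\<i> * (\<Sum>i\<in>I. c i * complex_of_real (W i))) = (\<Prod>i\<in>I. exp (\<i> * c i * complex_of_real (W i)))" for W
    using assms by (simp add: sum_distrib_left exp_sum mult.assoc)
  show "integrable (std_gaussian I) (\<lambda>W. exp (\<i> * (\<Sum>i\<in>I. c i * complex_of_real (W i))))"
    unfolding eq std_gaussian_def
    using product_integrable_prod[OF assms, of "\<lambda>i y. exp (\<i> * c i * complex_of_real y)"] std_normal_exp_linear(1) by simp
  have "(LINT W|std_gaussian I. exp (\<i> * (\<Sum>i\<in>I. c i * complex_of_real (W i)))) = (\<Prod>i\<in>I. exp (- (c i)\<^sup>2 / 2))"
    unfolding eq std_gaussian_def
    using product_integral_prod[OF assms, of "\<lambda>i y. exp (\<i> * c i * complex_of_real y)"] std_normal_exp_linear by simp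
  also have "\<dots> = exp (\<Sum>i\<in>I. - (c i)\<^sup>2 / 2)" using assms by (simp add: exp_sum)
  also have "(\<Sum>i\<in>I. - (c i)\<^sup>2 / 2) = - (\<Sum>i\<in>I. (c i)\<^sup>2) / 2"
    by (simp add: sum_negf sum_divide_distrib)
  finally show "(LINT W|std_gaussian I. exp (\<i> * (\<Sum>i\<in>I. c i * complex_of_real (W i))))
          = exp (- (\<Sum>i\<in>I. (c i)\<^sup>2) / 2)" .
qed

text \<open>The differentiability in the definition of \<open>holomorphic_several\<close>, at one point and with the
  gradient named, so that the rules of calculus can be stated for it.\<close>

definition has_gradient_within ::
    "'i set \<Rightarrow> (('i \<Rightarrow> complex) \<Rightarrow> complex) \<Rightarrow> ('i \<Rightarrow> complex) \<Rightarrow> ('i \<Rightarrow> complex) set \<Rightarrow> ('i \<Rightarrow> complex) \<Rightarrow> bool" where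
  "has_gradient_within I H c \<Omega> z \<longleftrightarrow>
     (\<forall>e>0. \<exists>d>0. \<forall>u\<in>\<Omega>. (\<forall>i\<in>I. cmod (u i - z i) < d) \<longrightarrow>
        cmod (H u - H z - (\<Sum>i\<in>I. c i * (u i - z i))) \<le> e * (\<Sum>i\<in>I. cmod (u i - z i)))"

lemma holomorphic_several_altdef:
  "holomorphic_several I H \<Omega> \<longleftrightarrow> (\<forall>z\<in>\<Omega>. \<exists>c. has_gradient_within I H c \<Omega> z)"
  by (simp add: holomorphic_several_def has_gradient_within_def)

lemma has_gradient_within_linear:
  "has_gradient_within I (\<lambda>u. \<Sum>i\<in>I. p i * u i) p \<Omega> z"
proof -
  have "(\<Sum>i\<in>I. p i * u i) - (\<Sum>i\<in>I. p i * z i) - (\<Sum>i\<in>I. p i * (u i - z i)) = 0" for u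
    by (simp add: right_diff_distrib sum_subtractf)
  then show ?thesis
    unfolding has_gradient_within_def by (auto intro!: exI[of _ "1::real"] sum_nonneg mult_nonneg_nonneg[OF less_imp_le])
qed

lemma has_gradient_within_add:
  assumes "has_gradient_within I F c \<Omega> z" "has_gradient_within I G d \<Omega> z"
  shows "has_gradient_within I (\<lambda>u. F u + G u) (\<lambda>i. c i + d i) \<Omega> z"
  unfolding has_gradient_within_def
proof (intro allI impI)
  fix e :: real assume "e > 0"
  then have e2: "e / 2 > 0" by simp
  obtain d1 where d1: "d1 > 0" "\<And>u. u \<in> \<Omega> \<Longrightarrow> (\<forall>i\<in>I. cmod (u i - z i) < d1) \<Longrightarrow>
        cmod (F u - F z - (\<Sum>i\<in>I. c i * (u i - z i))) \<le> e / 2 * (\<Sum>i\<in>I. cmod (u i - z i))"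
    using assms(1)[unfolded has_gradient_within_def, rule_format, OF e2] by blast
  obtain d2 where d2: "d2 > 0" "\<And>u. u \<in> \<Omega> \<Longrightarrow> (\<forall>i\<in>I. cmod (u i - z i) < d2) \<Longrightarrow>
        cmod (G u - G z - (\<Sum>i\<in>I. d i * (u i - z i))) \<le> e / 2 * (\<Sum>i\<in>I. cmod (u i - z i))"
    using assms(2)[unfolded has_gradient_within_def, rule_format, OF e2] by blast
  show "\<exists>r>0. \<forall>u\<in>\<Omega>. (\<forall>i\<in>I. cmod (u i - z i) < r) \<longrightarrow>
        cmod (F u + G u - (F z + G z) - (\<Sum>i\<in>I. (c i + d i) * (u i - z i))) \<le> e * (\<Sum>i\<in>I. cmod (u i - z i))"
  proof (intro exI[of _ "min d1 d2"] conjI ballI impI)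
    fix u assume u: "u \<in> \<Omega>" "\<forall>i\<in>I. cmod (u i - z i) < min d1 d2"
    have "F u + G u - (F z + G z) - (\<Sum>i\<in>I. (c i + d i) * (u i - z i))
        = (F u - F z - (\<Sum>i\<in>I. c i * (u i - z i))) + (G u - G z - (\<Sum>i\<in>I. d i * (u i - z i)))"
      by (simp add: algebra_simps sum.distrib sum_subtractf)
    then show "cmod (F u + G u - (F z + G z) - (\<Sum>i\<in>I. (c i + d i) * (u i - z i))) \<le> e * (\<Sum>i\<in>I. cmod (u i - z i))"
      using d1(2)[of u] d2(2)[of u] u
        norm_triangle_ineq[of "F u - F z - (\<Sum>i\<in>I. c i * (u i - z i))" "G u - G z - (\<Sum>i\<in>I. d i * (u i - z i))"]
      by (simp only:) auto
  qed (use d1 d2 in auto)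
qed

lemma has_gradient_within_compose:
  assumes "finite I" and H: "has_gradient_within I H c \<Omega> z"
    and f: "(f has_field_derivative f') (at (H z))"
  shows "has_gradient_within I (\<lambda>u. f (H u)) (\<lambda>i. f' * c i) \<Omega> z"
  unfolding has_gradient_within_def
proof (intro allI impI)
  fix e :: real assume e: "e > 0"
  define K where "K = (\<Sum>i\<in>I. cmod (c i)) + 1"
  have K: "K \<ge> 1" unfolding K_def by (simp add: sum_nonneg)
  \<comment> \<open>half of \<open>e\<close> is spent on the linearisation of \<open>f\<close>, the other half on that of \<open>H\<close>\<close>
  define e1 where "e1 = e / (2 * K)"
  have "e1 > 0" using e K by (simp add: e1_def)
  then obtain d1 where d1: "d1 > 0"
    "\<And>y. cmod (y - H z) < d1 \<Longrightarrow> cmod (f y - f (H z) - f' * (y - H z)) \<le> e1 * cmod (y - H z)"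
    using f unfolding has_field_derivative_def has_derivative_at_alt by metis
  define e2 where "e2 = min 1 (e / (2 * (cmod f' + 1)))"
  have e2: "e2 > 0" "e2 \<le> 1" using e by (auto simp: e2_def add_nonneg_pos)
  have e2': "cmod f' * e2 \<le> e / 2"
  proof -
    have "cmod f' * e2 \<le> cmod f' * (e / (2 * (cmod f' + 1)))"
      by (intro mult_left_mono) (auto simp: e2_def)
    also have "\<dots> = e / 2 * (cmod f' / (cmod f' + 1))"
      using add_nonneg_pos[of "cmod f'" 1] by (simp add: field_simps)
    also have "\<dots> \<le> e / 2 * 1" using e
      by (intro mult_left_mono) (auto simp: divide_le_eq_1 add_nonneg_pos)
    finally show ?thesis by simp
  qed
  obtain d2 where d2: "d2 > 0" "\<And>u. u \<in> \<Omega> \<Longrightarrow> (\<forall>i\<in>I. cmod (u i - z i) < d2) \<Longrightarrow>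
        cmod (H u - H z - (\<Sum>i\<in>I. c i * (u i - z i))) \<le> e2 * (\<Sum>i\<in>I. cmod (u i - z i))"
    using H[unfolded has_gradient_within_def, rule_format, OF e2(1)] by blast
  define r where "r = min d2 (d1 / (K * (real (card I) + 1)))"
  have r: "r > 0" using d1 d2 K by (auto simp: r_def)
  show "\<exists>r>0. \<forall>u\<in>\<Omega>. (\<forall>i\<in>I. cmod (u i - z i) < r) \<longrightarrow>
        cmod (f (H u) - f (H z) - (\<Sum>i\<in>I. f' * c i * (u i - z i))) \<le> e * (\<Sum>i\<in>I. cmod (u i - z i))"
  proof (intro exI[of _ r] conjI ballI impI r)
    fix u assume u: "u \<in> \<Omega>" "\<forall>i\<in>I. cmod (u i - z i) < r"
    define D where "D = (\<Sum>i\<in>I. cmod (u i - z i))"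
    define S where "S = (\<Sum>i\<in>I. c i * (u i - z i))"
    have D0: "D \<ge> 0" by (simp add: D_def sum_nonneg)
    have "D \<le> real (card I) * r" unfolding D_def
      using u(2) by (intro sum_bounded_above) (auto intro: less_imp_le)
    also have "\<dots> < (real (card I) + 1) * r" using r by (simp add: algebra_simps)
    also have "\<dots> \<le> (real (card I) + 1) * (d1 / (K * (real (card I) + 1)))"
      by (intro mult_left_mono) (auto simp: r_def)
    also have "\<dots> = d1 / K" by (simp add: divide_simps)
    finally have KD: "K * D < d1" using K by (simp add: less_divide_eq mult.commute)
    have HS: "cmod (H u - H z - S) \<le> e2 * D"
      using d2(2)[of u] u unfolding S_def D_def r_def by auto
    have "cmod S \<le> (\<Sum>i\<in>I. cmod (c i) * cmod (u i - z i))" unfolding S_def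
      by (rule order.trans[OF norm_sum]) (simp add: norm_mult)
    also have "\<dots> \<le> (\<Sum>i\<in>I. cmod (c i) * D)" unfolding D_def
      using \<open>finite I\<close> by (intro sum_mono mult_left_mono member_le_sum) auto
    also have "\<dots> = (K - 1) * D" by (simp add: K_def sum_distrib_right)
    finally have "cmod S \<le> (K - 1) * D" .
    moreover have "cmod (H u - H z) \<le> cmod (H u - H z - S) + cmod S"
      using norm_triangle_ineq[of "H u - H z - S" S] by simp
    moreover have "e2 * D \<le> D" using e2 D0 using mult_right_mono[of e2 1 D] by simp
    ultimately have HK: "cmod (H u - H z) \<le> K * D" using HS unfolding left_diff_distrib by linarith
    with KD have "cmod (f (H u) - f (H z) - f' * (H u - H z)) \<le> e1 * cmod (H u - H z)"
      by (intro d1(2)) auto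
    also have "\<dots> \<le> e1 * (K * D)" using HK \<open>e1 > 0\<close> by (intro mult_left_mono) auto
    also have "\<dots> = e / 2 * D" using K by (simp add: e1_def)
    finally have 1: "cmod (f (H u) - f (H z) - f' * (H u - H z)) \<le> e / 2 * D" .
    have "cmod (f' * (H u - H z - S)) \<le> cmod f' * (e2 * D)"
      unfolding norm_mult by (intro mult_left_mono HS) auto
    also have "\<dots> \<le> e / 2 * D" using mult_right_mono[OF e2' D0] by (simp add: mult.assoc)
    finally have 2: "cmod (f' * (H u - H z - S)) \<le> e / 2 * D" .
    have "f (H u) - f (H z) - (\<Sum>i\<in>I. f' * c i * (u i - z i))
        = (f (H u) - f (H z) - f' * (H u - H z)) + f' * (H u - H z - S)"
      by (simp add: S_def algebra_simps sum_distrib_left)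
    also have "cmod \<dots> \<le> e / 2 * D + e / 2 * D"
      by (rule order.trans[OF norm_triangle_ineq add_mono[OF 1 2]])
    finally show "cmod (f (H u) - f (H z) - (\<Sum>i\<in>I. f' * c i * (u i - z i))) \<le> e * (\<Sum>i\<in>I. cmod (u i - z i))"
      by (simp add: D_def)
  qed
qed

lemma norm_exp_linear_le:
  fixes u :: "'i \<Rightarrow> complex" and q :: "'i \<Rightarrow> real"
  assumes "\<And>i. i \<in> I \<Longrightarrow> \<bar>q i\<bar> \<le> B"
  shows "cmod (\<Sum>i\<in>I. complex_of_real (q i) * u i) \<le> B * (\<Sum>i\<in>I. cmod (u i))"
proof -
  have "cmod (\<Sum>i\<in>I. complex_of_real (q i) * u i) \<le> (\<Sum>i\<in>I. \<bar>q i\<bar> * cmod (u i))"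
    by (rule order.trans[OF norm_sum]) (simp add: norm_mult)
  also have "\<dots> \<le> (\<Sum>i\<in>I. B * cmod (u i))" using assms by (intro sum_mono mult_right_mono) auto
  finally show ?thesis by (simp add: sum_distrib_left)
qed

lemma norm_integral_le:
  fixes f :: "'a \<Rightarrow> 'b::{banach,second_countable_topology}"
  assumes "integrable M f" "integrable M g" "\<And>x. norm (f x) \<le> g x"
  shows "norm (LINT x|M. f x) \<le> (LINT x|M. g x)"
  by (rule order.trans[OF integral_norm_bound]) (intro integral_mono integrable_norm assms)

lemma norm_exp_le: "cmod (exp s) \<le> exp (cmod s)"
  by (simp add: complex_Re_le_cmod)

lemma integrable_weight_times_bounded:
  fixes \<rho> :: "'t \<Rightarrow> real" and F :: "'t \<Rightarrow> complex"
  assumes "integrable N \<rho>" "\<And>t. \<rho> t \<ge> 0" "F \<in> borel_measurable N" "\<And>t. cmod (F t) \<le> K"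
  shows "integrable N (\<lambda>t. complex_of_real (\<rho> t) * F t)"
proof (rule Bochner_Integration.integrable_bound)
  have [measurable]: "\<rho> \<in> borel_measurable N" "F \<in> borel_measurable N" using assms by auto
  show "(\<lambda>t. complex_of_real (\<rho> t) * F t) \<in> borel_measurable N" by measurable
  show "integrable N (\<lambda>t. K * \<rho> t)" using assms by simp
  show "AE t in N. cmod (complex_of_real (\<rho> t) * F t) \<le> norm (K * \<rho> t)"
  proof (intro AE_I2)
    fix t
    have "cmod (complex_of_real (\<rho> t) * F t) \<le> \<rho> t * K"
      using assms(2)[of t] assms(4)[of t] by (auto simp: norm_mult intro!: mult_left_mono)
    then show "cmod (complex_of_real (\<rho> t) * F t) \<le> norm (K * \<rho> t)" by (simp add: mult.commute)
  qed
qed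

text \<open>Differentiation under the integral sign, with a uniform remainder: \<open>e\<^sup>s - 1 - s\<close> is bounded by
  \<open>\<bar>s\<bar>\<^sup>2 e\<^sup>|\<^sup>s\<^sup>|\<close>, and the exponent is a linear form whose coefficients are bounded in \<open>t\<close>.\<close>

lemma has_gradient_within_integral_exp:
  fixes N :: "'t measure" and q :: "'i \<Rightarrow> 't \<Rightarrow> real"
  assumes fin: "finite I" and rho: "integrable N \<rho>" "\<And>t. \<rho> t \<ge> 0"
    and q: "\<And>i. i \<in> I \<Longrightarrow> q i \<in> borel_measurable N" "\<And>i t. i \<in> I \<Longrightarrow> \<bar>q i t\<bar> \<le> B"
  shows "has_gradient_within I
     (\<lambda>u. LINT t|N. complex_of_real (\<rho> t) * exp (\<Sum>i\<in>I. complex_of_real (q i t) * u i))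
     (\<lambda>j. LINT t|N. complex_of_real (\<rho> t) * (complex_of_real (q j t) * exp (\<Sum>i\<in>I. complex_of_real (q i t) * z i))) \<Omega> z"
    (is "has_gradient_within I ?J ?c \<Omega> z")
  unfolding has_gradient_within_def
proof (intro allI impI)
  fix e :: real assume e: "e > 0"
  let ?l = "\<lambda>t u. \<Sum>i\<in>I. complex_of_real (q i t) * u i"
  have [measurable]: "\<And>i. i \<in> I \<Longrightarrow> q i \<in> borel_measurable N" "\<rho> \<in> borel_measurable N"
    using q rho by auto
  define B' where "B' = max B 0"
  have q': "\<And>i t. i \<in> I \<Longrightarrow> \<bar>q i t\<bar> \<le> B'" using q(2) unfolding B'_def by (meson max.coboundedI1)
  have B': "B' \<ge> 0" by (simp add: B'_def)
  have le: "cmod (?l t u) \<le> B' * (\<Sum>i\<in>I. cmod (u i))" for t u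
    by (rule norm_exp_linear_le) (rule q')
  note bnd = integrable_weight_times_bounded[OF rho]
  define Z where "Z = (\<Sum>i\<in>I. cmod (z i))"
  have eb: "cmod (exp (?l t u)) \<le> exp (B' * (\<Sum>i\<in>I. cmod (u i)))" for t u
    using le[of t u] by (intro order.trans[OF norm_exp_le]) simp
  have int1: "integrable N (\<lambda>t. complex_of_real (\<rho> t) * exp (?l t u))" for u
    by (rule bnd[OF _ eb]) measurable
  have int2: "integrable N (\<lambda>t. complex_of_real (\<rho> t) * (complex_of_real (q j t) * exp (?l t z)))" if "j \<in> I" for j
  proof (rule bnd)
    show "cmod (complex_of_real (q j t) * exp (?l t z)) \<le> B' * exp (B' * Z)" for t
      using q'[OF that, of t] eb[of t z] B' unfolding Z_def norm_mult
      by (intro mult_mono) (auto simp: sum_nonneg)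
  qed (use that in measurable)
  define R where "R = (LINT t|N. \<rho> t)"
  have R: "R \<ge> 0" unfolding R_def using rho by (simp add: integral_nonneg)
  define C where "C = R * (exp (B' * Z) * (exp B' * B'\<^sup>2))"
  have C: "C \<ge> 0" using R by (simp add: C_def)
  define r where "r = min 1 (e / (C + 1)) / (real (card I) + 1)"
  have r: "r > 0" using e C by (simp add: r_def)
  show "\<exists>r>0. \<forall>u\<in>\<Omega>. (\<forall>i\<in>I. cmod (u i - z i) < r) \<longrightarrow>
        cmod (?J u - ?J z - (\<Sum>i\<in>I. ?c i * (u i - z i))) \<le> e * (\<Sum>i\<in>I. cmod (u i - z i))"
  proof (intro exI[of _ r] conjI ballI impI r)
    fix u assume u: "\<forall>i\<in>I. cmod (u i - z i) < r"
    define D where "D = (\<Sum>i\<in>I. cmod (u i - z i))"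
    have D0: "D \<ge> 0" by (simp add: D_def sum_nonneg)
    have "D \<le> real (card I) * r" unfolding D_def
      using u by (intro sum_bounded_above) (auto intro: less_imp_le)
    also have "\<dots> \<le> (real (card I) + 1) * r" using r by (simp add: algebra_simps)
    also have "\<dots> = min 1 (e / (C + 1))" by (simp add: r_def)
    finally have D: "D \<le> 1" "D \<le> e / (C + 1)" by auto
    have CD: "C * D \<le> e"
    proof -
      have "C * D \<le> (C + 1) * D" using D0 by (simp add: algebra_simps)
      also have "\<dots> \<le> e" using D(2) C by (simp add: field_simps)
      finally show ?thesis .
    qed
    let ?s = "\<lambda>t. ?l t (\<lambda>i. u i - z i)"
    \<comment> \<open>\<open>D\<close> enters the remainder squared: one factor is the required one, the other is absorbed by \<open>C * D \<le> e\<close>\<close>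
    have split: "?l t u = ?l t z + ?s t" for t
      by (simp add: sum.distrib[symmetric] algebra_simps)
    have sumint: "(\<Sum>i\<in>I. ?c i * (u i - z i)) = (LINT t|N. complex_of_real (\<rho> t) * (exp (?l t z) * ?s t))"
    proof -
      have "(\<Sum>i\<in>I. ?c i * (u i - z i))
          = (\<Sum>i\<in>I. (LINT t|N. complex_of_real (\<rho> t) * (complex_of_real (q i t) * exp (?l t z)) * (u i - z i)))"
        by (intro sum.cong refl) (simp add: integral_mult_left_zero)
      also have "\<dots> = (LINT t|N. (\<Sum>i\<in>I. complex_of_real (\<rho> t) * (complex_of_real (q i t) * exp (?l t z)) * (u i - z i)))"
        by (rule Bochner_Integration.integral_sum[symmetric]) (intro integrable_mult_left int2)
      also have "\<dots> = (LINT t|N. complex_of_real (\<rho> t) * (exp (?l t z) * ?s t))"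
        by (intro Bochner_Integration.integral_cong refl) (simp add: sum_distrib_left algebra_simps)
      finally show ?thesis .
    qed
    have int3: "integrable N (\<lambda>t. complex_of_real (\<rho> t) * (exp (?l t z) * ?s t))"
    proof (rule bnd)
      show "cmod (exp (?l t z) * ?s t) \<le> exp (B' * Z) * (B' * D)" for t
        using eb[of t z] le[of t "\<lambda>i. u i - z i"] unfolding Z_def D_def norm_mult
        by (intro mult_mono) auto
    qed measurable
    have "?J u - ?J z - (\<Sum>i\<in>I. ?c i * (u i - z i))
        = (LINT t|N. complex_of_real (\<rho> t) * (exp (?l t z) * (exp (?s t) - 1 - ?s t)))"
      unfolding sumint
      by (subst Bochner_Integration.integral_diff[symmetric], intro int1, intro int1)+
         (subst Bochner_Integration.integral_diff[symmetric],
          intro Bochner_Integration.integrable_diff int1, rule int3,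
          intro Bochner_Integration.integral_cong refl, simp only: split exp_add, simp add: algebra_simps)
    also have "cmod \<dots> \<le> (LINT t|N. \<rho> t * (exp (B' * Z) * (exp B' * B'\<^sup>2 * D\<^sup>2)))"
    proof (rule norm_integral_le)
      show "integrable N (\<lambda>t. \<rho> t * (exp (B' * Z) * (exp B' * B'\<^sup>2 * D\<^sup>2)))" using rho by simp
      show "integrable N (\<lambda>t. complex_of_real (\<rho> t) * (exp (?l t z) * (exp (?s t) - 1 - ?s t)))"
      proof -
        have "integrable N (\<lambda>t. complex_of_real (\<rho> t) * exp (?l t u) - complex_of_real (\<rho> t) * exp (?l t z) - complex_of_real (\<rho> t) * (exp (?l t z) * ?s t))"
          by (intro Bochner_Integration.integrable_diff int1 int3)
        then show ?thesis by (simp only: split exp_add, simp add: algebra_simps)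
      qed
      fix t
      have sD: "cmod (?s t) \<le> B' * D" unfolding D_def by (rule le)
      then have sB: "cmod (?s t) \<le> B'" using D(1) B' D0
        by (meson mult_left_le order.trans)
      have "cmod (exp (?s t) - 1 - ?s t) \<le> exp (cmod (?s t)) * (cmod (?s t))\<^sup>2"
        using Taylor_exp_field[of "?s t" 1] by (simp add: algebra_simps power2_eq_square)
      also have "\<dots> \<le> exp B' * (B' * D)\<^sup>2"
        using sD sB by (intro mult_mono power_mono) auto
      finally have t2: "cmod (exp (?s t) - 1 - ?s t) \<le> exp B' * B'\<^sup>2 * D\<^sup>2" by (simp add: power_mult_distrib)
      show "cmod (complex_of_real (\<rho> t) * (exp (?l t z) * (exp (?s t) - 1 - ?s t))) \<le> \<rho> t * (exp (B' * Z) * (exp B' * B'\<^sup>2 * D\<^sup>2))"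
        using rho(2)[of t] eb[of t z] t2 unfolding Z_def norm_mult
        by (intro mult_mono) auto
    qed
    also have "\<dots> = C * D * D" using R_def by (simp add: C_def power2_eq_square algebra_simps)
    also have "\<dots> \<le> e * D" using CD D0 by (intro mult_right_mono)
    finally show "cmod (?J u - ?J z - (\<Sum>i\<in>I. ?c i * (u i - z i))) \<le> e * (\<Sum>i\<in>I. cmod (u i - z i))"
      by (simp add: D_def)
  qed
qed

lemma holomorphic_several_slice:
  fixes \<Omega> :: "('i \<Rightarrow> complex) set"
  assumes fin: "finite I" and op: "openin (product_topology (\<lambda>_. euclidean) I) \<Omega>"
    and H: "holomorphic_several I H \<Omega>" and j: "j \<in> I" and z: "z \<in> extensional I"
  shows "open {\<zeta>. z(j := \<zeta>) \<in> \<Omega>}" and "(\<lambda>\<zeta>. H (z(j := \<zeta>))) holomorphic_on {\<zeta>. z(j := \<zeta>) \<in> \<Omega>}"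
proof -
  have "continuous_map euclidean (product_topology (\<lambda>_. euclidean) I) (\<lambda>\<zeta>::complex. z(j := \<zeta>))"
    using j z by (auto simp: continuous_map_componentwise fun_upd_def extensional_def)
  from openin_continuous_map_preimage[OF this op] show "open {\<zeta>. z(j := \<zeta>) \<in> \<Omega>}" by simp
  show "(\<lambda>\<zeta>. H (z(j := \<zeta>))) holomorphic_on {\<zeta>. z(j := \<zeta>) \<in> \<Omega>}"
    unfolding holomorphic_on_def
  proof
    fix \<zeta> assume "\<zeta> \<in> {\<zeta>. z(j := \<zeta>) \<in> \<Omega>}"
    then have "z(j := \<zeta>) \<in> \<Omega>" by simp
    then obtain c where c: "has_gradient_within I H c \<Omega> (z(j := \<zeta>))"
      using H holomorphic_several_altdef by blast
    have sum1: "(\<Sum>i\<in>I. f i ((z(j := \<xi>)) i - (z(j := \<zeta>)) i)) = f j (\<xi> - \<zeta>)"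
      if "\<And>i. f i 0 = 0" for f :: "'i \<Rightarrow> complex \<Rightarrow> 'b::comm_monoid_add" and \<xi>
    proof -
      have "(\<Sum>i\<in>I. f i ((z(j := \<xi>)) i - (z(j := \<zeta>)) i)) = (\<Sum>i\<in>I. if i = j then f j (\<xi> - \<zeta>) else 0)"
        by (intro sum.cong refl) (auto simp: that)
      then show ?thesis using fin j by simp
    qed
    have "((\<lambda>\<zeta>. H (z(j := \<zeta>))) has_field_derivative c j) (at \<zeta> within {\<zeta>. z(j := \<zeta>) \<in> \<Omega>})"
      unfolding has_field_derivative_def has_derivative_within_alt
    proof (intro conjI allI impI)
      show "bounded_linear ((*) (c j))" by (rule bounded_linear_mult_right)
      fix e :: real assume "e > 0"
      from c[unfolded has_gradient_within_def, rule_format, OF this]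
      obtain d where d: "d > 0" "\<And>u. u \<in> \<Omega> \<Longrightarrow> \<forall>i\<in>I. cmod (u i - (z(j := \<zeta>)) i) < d \<Longrightarrow>
          cmod (H u - H (z(j := \<zeta>)) - (\<Sum>i\<in>I. c i * (u i - (z(j := \<zeta>)) i))) \<le> e * (\<Sum>i\<in>I. cmod (u i - (z(j := \<zeta>)) i))"
        by blast
      show "\<exists>d>0. \<forall>y\<in>{\<zeta>. z(j := \<zeta>) \<in> \<Omega>}. norm (y - \<zeta>) < d \<longrightarrow>
          norm (H (z(j := y)) - H (z(j := \<zeta>)) - c j * (y - \<zeta>)) \<le> e * norm (y - \<zeta>)"
      proof (intro exI[of _ d] conjI ballI impI d(1))
        fix y assume y: "y \<in> {\<zeta>. z(j := \<zeta>) \<in> \<Omega>}" "norm (y - \<zeta>) < d"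
        have "\<forall>i\<in>I. cmod ((z(j := y)) i - (z(j := \<zeta>)) i) < d" using y d(1) by auto
        from d(2)[OF _ this] y(1)
        have "cmod (H (z(j := y)) - H (z(j := \<zeta>)) - (\<Sum>i\<in>I. c i * ((z(j := y)) i - (z(j := \<zeta>)) i)))
            \<le> e * (\<Sum>i\<in>I. cmod ((z(j := y)) i - (z(j := \<zeta>)) i))" by blast
        then show "norm (H (z(j := y)) - H (z(j := \<zeta>)) - c j * (y - \<zeta>)) \<le> e * norm (y - \<zeta>)"
          using sum1[of "\<lambda>i w. c i * w" y] sum1[of "\<lambda>i w. cmod w" y] by simp
      qed
    qed
    then show "(\<lambda>\<zeta>. H (z(j := \<zeta>))) field_differentiable (at \<zeta> within {\<zeta>. z(j := \<zeta>) \<in> \<Omega>})"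
      unfolding field_differentiable_def by blast
  qed
qed

abbreviation axes :: "complex set" where
  "axes \<equiv> range complex_of_real \<union> range (\<lambda>y. \<i> * complex_of_real y)"

lemma connected_axes: "connected axes"
proof (rule connected_Un)
  show "connected (range complex_of_real)"
    by (intro connected_continuous_image continuous_intros) auto
  show "connected (range (\<lambda>y. \<i> * complex_of_real y))"
    by (intro connected_continuous_image continuous_intros) auto
  have "0 \<in> range complex_of_real" "0 \<in> range (\<lambda>y. \<i> * complex_of_real y)"
    by (auto intro: range_eqI[of _ _ 0])
  then show "range complex_of_real \<inter> range (\<lambda>y. \<i> * complex_of_real y) \<noteq> {}" by blast
qed

text \<open>Identity theorem: the two axes form a connected set, hence lie in one component of \<open>S\<close>, in which the
  real axis has an accumulation point.\<close>

lemma holomorphic_eq_on_axes: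
  assumes S: "open S" "axes \<subseteq> S" and f: "f holomorphic_on S" and g: "g holomorphic_on S"
    and eq: "\<And>r. f (complex_of_real r) = g (complex_of_real r)" and \<zeta>: "\<zeta> \<in> axes"
  shows "f \<zeta> = g \<zeta>"
proof -
  define T where "T = connected_component_set S 0"
  have "0 \<in> axes" by (auto intro: range_eqI[of _ _ 0])
  then have AT: "axes \<subseteq> T"
    unfolding T_def using connected_axes S(2) by (intro connected_component_maximal) auto
  have TS: "T \<subseteq> S" unfolding T_def by (rule connected_component_subset)
  have "(\<lambda>w. f w - g w) \<zeta> = 0"
  proof (rule analytic_continuation[of "\<lambda>w. f w - g w" T "range complex_of_real" 0])
    show "(\<lambda>w. f w - g w) holomorphic_on T"
      using f g TS by (intro holomorphic_intros) (auto intro: holomorphic_on_subset)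
    show "open T" unfolding T_def using S(1) by (rule open_connected_component)
    show "connected T" unfolding T_def by (rule connected_connected_component)
    show "0 islimpt range complex_of_real"
      unfolding islimpt_approachable
    proof (intro allI impI)
      fix e :: real assume "e > 0"
      then show "\<exists>x'\<in>range complex_of_real. x' \<noteq> 0 \<and> dist x' 0 < e"
        by (intro bexI[of _ "complex_of_real (e / 2)"] rangeI) (auto simp: norm_divide)
    qed
  qed (use AT \<zeta> eq \<open>0 \<in> axes\<close> in auto)
  then show ?thesis by simp
qed

text \<open>Two extensions agree when all coordinates are real; the coordinates are released from the real axis
  to the union of both axes one after the other, by the identity theorem in that coordinate.\<close>

lemma holomorphic_extension_unique:
  assumes fin: "finite I"
    and e1: "holomorphic_extension I h H1 \<Omega>1" and e2: "holomorphic_extension I h H2 \<Omega>2"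
    and u: "u \<in> I \<rightarrow>\<^sub>E axes"
  shows "H1 u = H2 u"
proof -
  have op: "openin (product_topology (\<lambda>_. euclidean) I) \<Omega>1" "openin (product_topology (\<lambda>_. euclidean) I) \<Omega>2"
    and sub: "I \<rightarrow>\<^sub>E axes \<subseteq> \<Omega>1" "I \<rightarrow>\<^sub>E axes \<subseteq> \<Omega>2"
    and hol: "holomorphic_several I H1 \<Omega>1" "holomorphic_several I H2 \<Omega>2"
    and val: "\<And>x. x \<in> I \<rightarrow>\<^sub>E UNIV \<Longrightarrow> H1 (\<lambda>i\<in>I. complex_of_real (x i)) = h x"
      "\<And>x. x \<in> I \<rightarrow>\<^sub>E UNIV \<Longrightarrow> H2 (\<lambda>i\<in>I. complex_of_real (x i)) = h x"
    using e1 e2 unfolding holomorphic_extension_def by auto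
  \<comment> \<open>the coordinates in \<open>J\<close> may be imaginary, all others are still real\<close>
  have "\<forall>u\<in>I \<rightarrow>\<^sub>E axes. (\<forall>i\<in>I - J. u i \<in> range complex_of_real) \<longrightarrow> H1 u = H2 u" if "J \<subseteq> I" for J
    using finite_subset[OF that fin] that
  proof (induction J rule: finite_induct)
    case empty
    show ?case
    proof (intro ballI impI)
      fix u assume u: "u \<in> I \<rightarrow>\<^sub>E axes" "\<forall>i\<in>I - {}. u i \<in> range complex_of_real"
      define x where "x = (\<lambda>i\<in>I. Re (u i))"
      have "u = (\<lambda>i\<in>I. complex_of_real (x i))"
        using u by (auto simp: x_def fun_eq_iff PiE_def extensional_def)
      moreover have "x \<in> I \<rightarrow>\<^sub>E UNIV" by (simp add: x_def)
      ultimately show "H1 u = H2 u" using val by metis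
    qed
  next
    case (insert j J)
    show ?case
    proof (intro ballI impI)
      fix u assume u: "u \<in> I \<rightarrow>\<^sub>E axes" "\<forall>i\<in>I - insert j J. u i \<in> range complex_of_real"
      have j: "j \<in> I" and ue: "u \<in> extensional I" using insert u by (auto simp: PiE_def)
      have upd: "u(j := \<zeta>) \<in> I \<rightarrow>\<^sub>E axes" if "\<zeta> \<in> axes" for \<zeta>
        using u(1) j that by (auto simp: PiE_def extensional_def Pi_def)
      let ?S = "{\<zeta>. u(j := \<zeta>) \<in> \<Omega>1} \<inter> {\<zeta>. u(j := \<zeta>) \<in> \<Omega>2}"
      have "H1 (u(j := u j)) = H2 (u(j := u j))"
      proof (rule holomorphic_eq_on_axes[where S = ?S and f = "\<lambda>\<zeta>. H1 (u(j := \<zeta>))" and g = "\<lambda>\<zeta>. H2 (u(j := \<zeta>))"])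
        show "open ?S"
          using holomorphic_several_slice(1)[OF fin op(1) hol(1) j ue]
            holomorphic_several_slice(1)[OF fin op(2) hol(2) j ue] by (rule open_Int)
        show "axes \<subseteq> ?S"
        proof
          fix \<zeta> assume "\<zeta> \<in> axes"
          then have "u(j := \<zeta>) \<in> I \<rightarrow>\<^sub>E axes" by (rule upd)
          then show "\<zeta> \<in> ?S" using sub by (simp add: subset_iff)
        qed
        show "(\<lambda>\<zeta>. H1 (u(j := \<zeta>))) holomorphic_on ?S" "(\<lambda>\<zeta>. H2 (u(j := \<zeta>))) holomorphic_on ?S"
          using holomorphic_several_slice(2)[OF fin op(1) hol(1) j ue]
            holomorphic_several_slice(2)[OF fin op(2) hol(2) j ue]
          by (blast intro: holomorphic_on_subset)+
        show "u j \<in> axes" using u(1) j by (auto simp: PiE_def Pi_def)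
        fix r
        show "H1 (u(j := complex_of_real r)) = H2 (u(j := complex_of_real r))"
        proof (rule insert.IH[rule_format])
          show "J \<subseteq> I" using insert.prems by simp
          show "u(j := complex_of_real r) \<in> I \<rightarrow>\<^sub>E axes" by (rule upd) simp
          show "(u(j := complex_of_real r)) i \<in> range complex_of_real" if "i \<in> I - J" for i
            using u(2) that by (cases "i = j") simp_all
        qed
      qed
      then show "H1 u = H2 u" by simp
    qed
  qed
  from this[of I] show ?thesis using u by auto
qed

lemma has_wrong_sign_expectation_unique:
  assumes "finite I" "holomorphic_extension I h H \<Omega>"
    and "integrable (std_gaussian I) (\<lambda>W. H (\<lambda>i\<in>I. \<i> * complex_of_real (W i)))"
  shows "has_wrong_sign_expectation I h c \<longleftrightarrow>
    c = (LINT W|std_gaussian I. H (\<lambda>i\<in>I. \<i> * complex_of_real (W i)))"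
proof -
  have "H' (\<lambda>i\<in>I. \<i> * complex_of_real (W i)) = H (\<lambda>i\<in>I. \<i> * complex_of_real (W i))"
    if "holomorphic_extension I h H' \<Omega>'" for H' \<Omega>' W
    by (rule holomorphic_extension_unique[OF assms(1) that assms(2)]) auto
  then have *: "(\<lambda>W. H' (\<lambda>i\<in>I. \<i> * complex_of_real (W i))) = (\<lambda>W. H (\<lambda>i\<in>I. \<i> * complex_of_real (W i)))"
    if "holomorphic_extension I h H' \<Omega>'" for H' \<Omega>' using that by (intro ext)
  show ?thesis
  proof
    assume "has_wrong_sign_expectation I h c"
    then obtain H' \<Omega>' where "holomorphic_extension I h H' \<Omega>'"
      "c = (LINT W|std_gaussian I. H' (\<lambda>i\<in>I. \<i> * complex_of_real (W i)))"
      unfolding has_wrong_sign_expectation_def by blast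
    then show "c = (LINT W|std_gaussian I. H (\<lambda>i\<in>I. \<i> * complex_of_real (W i)))"
      by (simp only: *)
  qed (use assms in \<open>auto simp: has_wrong_sign_expectation_def\<close>)
qed

text \<open>The expectation of \<open>C exp (\<Sum> p\<^sub>i X\<^sub>i - \<mu> \<integral> \<rho>(t) exp (\<Sum> q\<^sub>i(t) X\<^sub>i) dN(t))\<close>.  On the imaginary
  axes the inner integral \<open>A\<close> is bounded by the mass of \<open>\<rho>\<close>.  Hence the outer exponential may be
  expanded under the expectation, \<open>A\<^sup>n\<close> may be written as an \<open>n\<close>-fold integral, and Fubini's theorem leaves the
  Gaussian expectation of the exponential of a linear form.\<close>

theorem wrong_sign_expectation_exp_exp:
  fixes N :: "'t measure" and q :: "'i \<Rightarrow> 't \<Rightarrow> real" and p :: "'i \<Rightarrow> complex"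
  assumes fin: "finite I" and N: "sigma_finite_measure N"
    and rho: "integrable N \<rho>" "\<And>t. \<rho> t \<ge> 0"
    and q: "\<And>i. i \<in> I \<Longrightarrow> q i \<in> borel_measurable N" "\<And>i t. i \<in> I \<Longrightarrow> \<bar>q i t\<bar> \<le> B"
    and h: "\<And>X. h X = C * exp ((\<Sum>i\<in>I. p i * complex_of_real (X i))
              - complex_of_real (\<mu> * (LINT t|N. \<rho> t * exp (\<Sum>i\<in>I. q i t * X i))))"
  shows "has_wrong_sign_expectation I h c \<longleftrightarrow>
    c = C * (\<Sum>n. (- complex_of_real \<mu>) ^ n / fact n *
      (LINT t|PiM {1..n} (\<lambda>_. N). complex_of_real (\<Prod>l=1..n. \<rho> (t l)) *
         exp (- (\<Sum>i\<in>I. (p i + complex_of_real (\<Sum>l=1..n. q i (t l)))\<^sup>2) / 2)))"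
proof -
  have [measurable]: "\<And>i. i \<in> I \<Longrightarrow> q i \<in> borel_measurable N" "\<rho> \<in> borel_measurable N"
    using q rho by auto
  let ?G = "std_gaussian I"
  interpret G: prob_space ?G by (rule prob_space_std_gaussian)
  interpret N: sigma_finite_measure N by (rule N)
  interpret NN: product_sigma_finite "\<lambda>_::nat. N" by (rule product_sigma_finite.intro) (rule N)
  have setsG[measurable_cong]: "sets ?G = sets (PiM I (\<lambda>_. borel))"
    unfolding std_gaussian_def by (intro sets_PiM_cong refl) simp
  define J where "J = (\<lambda>u. LINT t|N. complex_of_real (\<rho> t) * exp (\<Sum>i\<in>I. complex_of_real (q i t) * u i))"
  define H where "H = (\<lambda>u. C * exp ((\<Sum>i\<in>I. p i * u i) + (- complex_of_real \<mu>) * J u))"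
  define \<Omega> where "\<Omega> = topspace (product_topology (\<lambda>_. euclidean) I :: ('i \<Rightarrow> complex) topology)"
  have ext: "holomorphic_extension I h H \<Omega>"
    unfolding holomorphic_extension_def
  proof (intro conjI ballI)
    show "openin (product_topology (\<lambda>_. euclidean) I) \<Omega>" unfolding \<Omega>_def by (rule openin_topspace)
    show "I \<rightarrow>\<^sub>E axes \<subseteq> \<Omega>" unfolding \<Omega>_def by (auto simp: PiE_def)
    show "holomorphic_several I H \<Omega>"
      unfolding holomorphic_several_altdef
    proof
      fix z
      have "\<exists>c. has_gradient_within I J c \<Omega> z"
        unfolding J_def
        by (intro exI, rule has_gradient_within_integral_exp[where B = B]) (use fin rho q in auto)
      then obtain c where J: "has_gradient_within I J c \<Omega> z" ..
      have "((\<lambda>x. - complex_of_real \<mu> * x) has_field_derivative - complex_of_real \<mu>) (at (J z))"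
        by (auto intro!: derivative_eq_intros)
      note 1 = has_gradient_within_add[OF has_gradient_within_linear[where p = p]
          has_gradient_within_compose[OF fin J this]]
      have "((\<lambda>x. C * exp x) has_field_derivative C * exp y) (at y)" for y
        by (auto intro!: derivative_eq_intros)
      from has_gradient_within_compose[OF fin 1 this]
      show "\<exists>c. has_gradient_within I H c \<Omega> z" unfolding H_def by blast
    qed
    fix x :: "'i \<Rightarrow> real"
    have "J (\<lambda>i\<in>I. complex_of_real (x i)) = (LINT t|N. complex_of_real (\<rho> t * exp (\<Sum>i\<in>I. q i t * x i)))"
      unfolding J_def by (intro Bochner_Integration.integral_cong refl) (simp add: exp_of_real[symmetric])
    then have "J (\<lambda>i\<in>I. complex_of_real (x i)) = complex_of_real (LINT t|N. \<rho> t * exp (\<Sum>i\<in>I. q i t * x i))"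
      by (simp only: integral_complex_of_real)
    then show "H (\<lambda>i\<in>I. complex_of_real (x i)) = h x" by (simp add: H_def h)
  qed
  \<comment> \<open>\<open>\<Phi>\<close> need not be bounded, as \<open>p\<close> is complex, but it is integrable; \<open>f\<close> has modulus \<open>\<rho>\<close>\<close>
  define \<Phi> where "\<Phi> = (\<lambda>W. exp (\<i> * (\<Sum>i\<in>I. p i * complex_of_real (W i))))"
  define f where "f = (\<lambda>(W::'i \<Rightarrow> real) t. complex_of_real (\<rho> t) * exp (\<i> * complex_of_real (\<Sum>i\<in>I. q i t * W i)))"
  define A where "A = (\<lambda>W. LINT t|N. f W t)"
  define R where "R = (LINT t|N. \<rho> t)"
  have R: "R \<ge> 0" unfolding R_def using rho by (simp add: integral_nonneg)
  have int_\<Phi>: "integrable ?G \<Phi>" unfolding \<Phi>_def by (rule std_gaussian_exp_linear(1)[OF fin])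
  have [measurable]: "\<Phi> \<in> borel_measurable ?G" using int_\<Phi> by auto
  have norm_f: "cmod (f W t) = \<rho> t" for W t using rho(2)[of t] by (simp add: f_def norm_mult)
  have f_meas: "f W \<in> borel_measurable N" for W unfolding f_def by measurable
  have int_f: "integrable N (f W)" for W
    by (rule Bochner_Integration.integrable_bound[OF rho(1)]) (auto simp: f_meas norm_f)
  have meas_qW: "(\<lambda>x. q i (snd x) * (fst x) i) \<in> borel_measurable (?G \<Otimes>\<^sub>M N)" if i: "i \<in> I" for i
  proof -
    have 1: "(\<lambda>x. q i (snd x)) \<in> borel_measurable (?G \<Otimes>\<^sub>M N)"
      by (rule measurable_compose[OF measurable_snd q(1)[OF i]])
    have "(\<lambda>W. W i) \<in> borel_measurable ?G"
      using i measurable_component_singleton[of i I "\<lambda>_. borel"] by (simp cong: measurable_cong_sets add: setsG)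
    from measurable_compose[OF measurable_fst this] 1 show ?thesis by (intro borel_measurable_times)
  qed
  have "(\<lambda>x. f (fst x) (snd x)) \<in> borel_measurable (?G \<Otimes>\<^sub>M N)"
    unfolding f_def using meas_qW by (intro borel_measurable_times) measurable
  then have meas_A[measurable]: "A \<in> borel_measurable ?G"
    unfolding A_def by (intro N.borel_measurable_lebesgue_integral) (simp add: split_beta')
  have norm_A: "cmod (A W) \<le> R" for W
    unfolding A_def R_def by (rule norm_integral_le[OF int_f rho(1)]) (simp add: norm_f)
  have HW: "H (\<lambda>i\<in>I. \<i> * complex_of_real (W i)) = C * (\<Phi> W * exp (- complex_of_real \<mu> * A W))" for W
  proof -
    have "J (\<lambda>i\<in>I. \<i> * complex_of_real (W i)) = A W"
      unfolding J_def A_def f_def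
      by (intro Bochner_Integration.integral_cong refl) (simp add: sum_distrib_left algebra_simps)
    then show ?thesis
      by (simp add: H_def \<Phi>_def exp_add[symmetric] sum_distrib_left algebra_simps)
  qed
  define F where "F = (\<lambda>n W. (- complex_of_real \<mu>) ^ n / fact n * (\<Phi> W * A W ^ n))"
  have F_sums: "(\<lambda>n. F n W) sums (\<Phi> W * exp (- complex_of_real \<mu> * A W))" for W
  proof -
    have "F n W = \<Phi> W * ((- complex_of_real \<mu> * A W) ^ n /\<^sub>R fact n)" for n
      unfolding F_def power_mult_distrib scaleR_conv_of_real by (simp only: divide_inverse) simp
    then show ?thesis using sums_mult[OF exp_converges[of "- complex_of_real \<mu> * A W"], of "\<Phi> W"] by simp
  qed
  have norm_F: "cmod (F n W) \<le> (\<bar>\<mu>\<bar> * R) ^ n / fact n * cmod (\<Phi> W)" for n W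
  proof -
    have "cmod (A W) ^ n \<le> R ^ n" using norm_A[of W] by (intro power_mono) auto
    then have "\<bar>\<mu>\<bar> ^ n / fact n * (cmod (\<Phi> W) * cmod (A W) ^ n) \<le> \<bar>\<mu>\<bar> ^ n / fact n * (cmod (\<Phi> W) * R ^ n)"
      by (intro mult_left_mono) auto
    then show ?thesis by (simp add: F_def norm_mult norm_power norm_divide power_mult_distrib mult_ac)
  qed
  have F_meas: "F n \<in> borel_measurable ?G" for n unfolding F_def by measurable
  have int_F: "integrable ?G (F n)" for n
    by (rule Bochner_Integration.integrable_bound[where f = "\<lambda>W. (\<bar>\<mu>\<bar> * R) ^ n / fact n * cmod (\<Phi> W)"])
       (use int_\<Phi> norm_F F_meas R in \<open>auto simp: abs_mult\<close>)
  have sum_exp: "summable (\<lambda>n. (\<bar>\<mu>\<bar> * R) ^ n / fact n * K)" for K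
    using exp_converges[of "\<bar>\<mu>\<bar> * R"] by (intro summable_mult2) (simp add: sums_iff divide_inverse mult.commute)
  have sum_norm: "summable (\<lambda>n. cmod (F n W))" for W
    by (rule summable_comparison_test'[OF sum_exp[of "cmod (\<Phi> W)"], of 0]) (use norm_F in auto)
  have sum_int: "summable (\<lambda>n. LINT W|?G. cmod (F n W))"
  proof (rule summable_comparison_test'[OF sum_exp[of "LINT W|?G. cmod (\<Phi> W)"], of 0])
    fix n
    have "(LINT W|?G. cmod (F n W)) \<le> (LINT W|?G. (\<bar>\<mu>\<bar> * R) ^ n / fact n * cmod (\<Phi> W))"
      using int_F int_\<Phi> norm_F by (intro integral_mono) auto
    then show "norm (LINT W|?G. cmod (F n W)) \<le> (\<bar>\<mu>\<bar> * R) ^ n / fact n * (LINT W|?G. cmod (\<Phi> W))"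
      by (simp add: integral_nonneg)
  qed
  have moment: "(LINT W|?G. \<Phi> W * A W ^ n) =
      (LINT t|PiM {1..n} (\<lambda>_. N). complex_of_real (\<Prod>l=1..n. \<rho> (t l)) *
         exp (- (\<Sum>i\<in>I. (p i + complex_of_real (\<Sum>l=1..n. q i (t l)))\<^sup>2) / 2))" for n
  proof -
    let ?P = "PiM {1..n} (\<lambda>_. N)"
    interpret P: sigma_finite_measure ?P by (rule NN.sigma_finite) simp
    interpret GP: pair_sigma_finite ?G ?P by standard
    define g where "g = (\<lambda>W t. \<Phi> W * (\<Prod>l=1..n. f W (t l)))"
    have g_alt: "g W t = complex_of_real (\<Prod>l=1..n. \<rho> (t l)) *
        exp (\<i> * (\<Sum>i\<in>I. (p i + complex_of_real (\<Sum>l=1..n. q i (t l))) * complex_of_real (W i)))" for W t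
    proof -
      have "(\<Sum>l=1..n. \<Sum>i\<in>I. q i (t l) * W i) = (\<Sum>i\<in>I. (\<Sum>l=1..n. q i (t l)) * W i)"
        by (subst sum.swap) (simp add: sum_distrib_right)
      then have "(\<Prod>l=1..n. exp (\<i> * complex_of_real (\<Sum>i\<in>I. q i (t l) * W i)))
          = exp (\<i> * complex_of_real (\<Sum>i\<in>I. (\<Sum>l=1..n. q i (t l)) * W i))"
        by (simp only: exp_sum[symmetric] finite_atLeastAtMost sum_distrib_left[symmetric] of_real_sum[symmetric])
      then show ?thesis
        unfolding g_def f_def \<Phi>_def prod.distrib
        by (simp add: exp_add[symmetric] distrib_left distrib_right sum.distrib mult_ac of_real_prod)
    qed
    have norm_g: "cmod (g W t) = cmod (\<Phi> W) * (\<Prod>l=1..n. \<rho> (t l))" for W t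
      by (simp add: g_def norm_mult prod_norm[symmetric] norm_f)
    have int_prod_f: "integrable ?P (\<lambda>t. \<Prod>l=1..n. f W (t l))" for W
      by (rule NN.product_integrable_prod) (auto simp: int_f)
    have int_prod_\<rho>: "integrable ?P (\<lambda>t. \<Prod>l=1..n. \<rho> (t l))"
      by (rule NN.product_integrable_prod) (auto simp: rho)
    have meas_l: "(\<lambda>x. q i (snd x l)) \<in> borel_measurable (?G \<Otimes>\<^sub>M ?P)" if "i \<in> I" "l \<in> {1..n}" for i l
      by (rule measurable_compose[OF measurable_compose[OF measurable_snd measurable_component_singleton[OF that(2)]] q(1)[OF that(1)]])
    have meas_r: "(\<lambda>x. \<rho> (snd x l)) \<in> borel_measurable (?G \<Otimes>\<^sub>M ?P)" if "l \<in> {1..n}" for l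
      by (rule measurable_compose[OF measurable_compose[OF measurable_snd measurable_component_singleton[OF that]]]) measurable
    have meas_W: "(\<lambda>x. fst x i) \<in> borel_measurable (?G \<Otimes>\<^sub>M ?P)" if "i \<in> I" for i
    proof -
      have "(\<lambda>W. W i) \<in> borel_measurable ?G"
        using that measurable_component_singleton[of i I "\<lambda>_. borel"] by (simp cong: measurable_cong_sets add: setsG)
      from measurable_compose[OF measurable_fst this] show ?thesis .
    qed
    have m1: "(\<lambda>x. complex_of_real (\<Sum>l=1..n. q i (snd x l))) \<in> borel_measurable (?G \<Otimes>\<^sub>M ?P)" if "i \<in> I" for i
    proof -
      have [measurable]: "(\<lambda>x. \<Sum>l=1..n. q i (snd x l)) \<in> borel_measurable (?G \<Otimes>\<^sub>M ?P)"
        by (rule borel_measurable_sum) (rule meas_l[OF that])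
      show ?thesis by measurable
    qed
    have m2: "(\<lambda>x. (\<Sum>i\<in>I. (p i + complex_of_real (\<Sum>l=1..n. q i (snd x l))) * complex_of_real (fst x i)))
        \<in> borel_measurable (?G \<Otimes>\<^sub>M ?P)"
    proof (rule borel_measurable_sum)
      fix i assume i: "i \<in> I"
      note [measurable] = m1[OF i] meas_W[OF i]
      show "(\<lambda>x. (p i + complex_of_real (\<Sum>l=1..n. q i (snd x l))) * complex_of_real (fst x i))
        \<in> borel_measurable (?G \<Otimes>\<^sub>M ?P)" by measurable
    qed
    have m3: "(\<lambda>x. \<Prod>l=1..n. \<rho> (snd x l)) \<in> borel_measurable (?G \<Otimes>\<^sub>M ?P)"
      using meas_r by (intro borel_measurable_prod) auto
    have meas_g: "(\<lambda>x. g (fst x) (snd x)) \<in> borel_measurable (?G \<Otimes>\<^sub>M ?P)"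
      unfolding g_alt using m2 m3 by measurable
    have int_g: "integrable (?G \<Otimes>\<^sub>M ?P) (\<lambda>(W, t). g W t)"
    proof (rule GP.Fubini_integrable)
      show "(\<lambda>(W, t). g W t) \<in> borel_measurable (?G \<Otimes>\<^sub>M ?P)" using meas_g by (simp add: split_beta')
      show "integrable ?G (\<lambda>W. LINT t|?P. norm (case (W, t) of (W, t) \<Rightarrow> g W t))"
        using int_\<Phi> by (simp add: norm_g)
      show "AE W in ?G. integrable ?P (\<lambda>t. case (W, t) of (W, t) \<Rightarrow> g W t)"
        using int_prod_f by (simp add: g_def)
    qed
    have "(LINT W|?G. \<Phi> W * A W ^ n) = (LINT W|?G. LINT t|?P. g W t)"
    proof (intro Bochner_Integration.integral_cong refl)
      fix W
      have "(LINT t|?P. (\<Prod>l=1..n. f W (t l))) = (\<Prod>l\<in>{1..n}. A W)"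
        unfolding A_def by (rule NN.product_integral_prod) (auto simp: int_f)
      then show "\<Phi> W * A W ^ n = (LINT t|?P. g W t)" by (simp add: g_def)
    qed
    also have "\<dots> = (LINT t|?P. LINT W|?G. g W t)" by (rule GP.Fubini_integral[OF int_g, symmetric])
    also have "\<dots> = (LINT t|?P. complex_of_real (\<Prod>l=1..n. \<rho> (t l)) *
         exp (- (\<Sum>i\<in>I. (p i + complex_of_real (\<Sum>l=1..n. q i (t l)))\<^sup>2) / 2))"
      unfolding g_alt integral_mult_right_zero std_gaussian_exp_linear(2)[OF fin] ..
    finally show ?thesis .
  qed
  have eq: "(\<lambda>W. H (\<lambda>i\<in>I. \<i> * complex_of_real (W i))) = (\<lambda>W. C * (\<Sum>n. F n W))"
    using F_sums by (simp add: HW sums_iff)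
  have int: "integrable ?G (\<lambda>W. H (\<lambda>i\<in>I. \<i> * complex_of_real (W i)))"
    unfolding eq by (intro integrable_mult_right integrable_suminf int_F AE_I2 sum_norm sum_int)
  have "(LINT W|?G. H (\<lambda>i\<in>I. \<i> * complex_of_real (W i))) = C * (\<Sum>n. LINT W|?G. F n W)"
    unfolding eq integral_mult_right_zero
    by (subst integral_suminf[OF int_F AE_I2[OF sum_norm] sum_int]) (rule refl)
  also have "(\<lambda>n. LINT W|?G. F n W) = (\<lambda>n. (- complex_of_real \<mu>) ^ n / fact n *
      (LINT t|PiM {1..n} (\<lambda>_. N). complex_of_real (\<Prod>l=1..n. \<rho> (t l)) *
         exp (- (\<Sum>i\<in>I. (p i + complex_of_real (\<Sum>l=1..n. q i (t l)))\<^sup>2) / 2)))"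
    unfolding F_def integral_mult_right_zero moment ..
  finally show ?thesis using has_wrong_sign_expectation_unique[OF fin ext int] by simp
qed

section \<open>The sphere in stereographic coordinates\<close>

text \<open>A map that matches orthonormal bases carries boxes to boxes with the same side lengths.  This
  identifies the Lebesgue measures on \<open>\<complex>\<close>, \<open>\<real>\<^sup>2\<close> and \<open>\<real> \<times> \<real>\<close>: the first carries the integration
  variables of the theorem, the second has a change of variables formula with a Jacobian
  determinant, and the third has Fubini's theorem and the polar angles.\<close>

lemma lborel_distr_basis_map:
  fixes T :: "'a::euclidean_space \<Rightarrow> 'b::euclidean_space"
  assumes f: "bij_betw f Basis Basis"
    and T: "\<And>x b. b \<in> Basis \<Longrightarrow> T x \<bullet> f b = x \<bullet> b"
    and meas: "T \<in> borel_measurable borel"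
  shows "lborel = distr lborel borel T"
proof (rule lborel_eqI)
  fix l u :: 'b
  assume lu: "\<And>b. b \<in> Basis \<Longrightarrow> l \<bullet> b \<le> u \<bullet> b"
  define S where "S = (\<lambda>y::'b. \<Sum>b\<in>Basis. (y \<bullet> f b) *\<^sub>R b :: 'a)"
  have S: "S y \<bullet> b = y \<bullet> f b" if "b \<in> Basis" for y b
    using that by (simp add: S_def inner_sum_left_Basis)
  have fB: "f b \<in> Basis" if "b \<in> Basis" for b using f that by (auto simp: bij_betw_def)
  have Bf: "\<exists>b\<in>Basis. c = f b" if "c \<in> Basis" for c using f that by (auto simp: bij_betw_def)
  have "T -` box l u = box (S l) (S u)"
  proof (intro set_eqI iffI)
    fix x assume x: "x \<in> T -` box l u"
    have "l \<bullet> f b < x \<bullet> b \<and> x \<bullet> b < u \<bullet> f b" if "b \<in> Basis" for b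
    proof -
      have "l \<bullet> f b < T x \<bullet> f b \<and> T x \<bullet> f b < u \<bullet> f b"
        using x fB[OF that] unfolding vimage_eq mem_box by blast
      then show ?thesis unfolding T[OF that] .
    qed
    then show "x \<in> box (S l) (S u)" by (simp add: mem_box S)
  next
    fix x assume x: "x \<in> box (S l) (S u)"
    have "l \<bullet> c < T x \<bullet> c \<and> T x \<bullet> c < u \<bullet> c" if c: "c \<in> Basis" for c
    proof -
      obtain b where b: "b \<in> Basis" "c = f b" using Bf[OF c] by auto
      then show ?thesis using x by (auto simp: mem_box S T)
    qed
    then show "x \<in> T -` box l u" by (auto simp: mem_box)
  qed
  then have "emeasure (distr lborel borel T) (box l u) = emeasure lborel (box (S l) (S u))"
    using meas by (subst emeasure_distr) auto
  also have "\<dots> = ennreal (\<Prod>b\<in>Basis. (S u - S l) \<bullet> b)"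
    using lu fB by (intro emeasure_lborel_box) (simp add: S)
  also have "(\<Prod>b\<in>Basis. (S u - S l) \<bullet> b) = (\<Prod>b\<in>Basis. (u - l) \<bullet> f b)"
    by (intro prod.cong refl) (simp add: inner_diff_left S)
  also have "\<dots> = (\<Prod>b\<in>Basis. (u - l) \<bullet> b)"
    by (rule prod.reindex_bij_betw[OF f])
  finally show "emeasure (distr lborel borel T) (box l u) = ennreal (prod ((\<bullet>) (u - l)) Basis)" .
qed simp

lemma Basis_real2: "(Basis :: (real^2) set) = {axis 1 1, axis 2 1}"
  by (auto simp: Basis_vec_def UNIV_2)

lemma lborel_complex_real2: "(lborel :: complex measure) = distr (lborel :: (real^2) measure) borel (\<lambda>u. Complex (u$1) (u$2))"
proof (rule lborel_distr_basis_map[where f = "\<lambda>b. Complex (b$1) (b$2)"])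
  have "axis 1 1 \<noteq> (axis 2 1 :: real^2)" by (simp add: axis_eq_axis)
  then show "bij_betw (\<lambda>b::real^2. Complex (b $ 1) (b $ 2)) Basis Basis"
    by (auto simp: Basis_real2 Basis_complex_def bij_betw_def inj_on_def axis_def complex_eq_iff)
  show "Complex (x $ 1) (x $ 2) \<bullet> Complex (b $ 1) (b $ 2) = x \<bullet> b" for x b :: "real^2"
    by (simp add: inner_complex_def inner_vec_def sum_2)
  show "(\<lambda>u::real^2. Complex (u $ 1) (u $ 2)) \<in> borel_measurable borel"
    unfolding Complex_eq by measurable
qed

lemma lborel_pair_real2: "(lborel :: (real \<times> real) measure) = distr (lborel :: (real^2) measure) borel (\<lambda>u. (u$1, u$2))"
proof (rule lborel_distr_basis_map[where f = "\<lambda>b. (b$1, b$2)"])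
  show "bij_betw (\<lambda>b::real^2. (b $ 1, b $ 2)) Basis Basis"
    by (auto simp: Basis_real2 Basis_prod_def bij_betw_def inj_on_def axis_def)
  show "(x $ 1, x $ 2) \<bullet> (b $ 1, b $ 2) = x \<bullet> b" for x b :: "real^2"
    by (simp add: inner_vec_def sum_2)
  show "(\<lambda>u::real^2. (u $ 1, u $ 2)) \<in> borel_measurable borel"
    by (intro borel_measurable_Pair) measurable
qed

lemma lborel_complex_pair: "(lborel :: complex measure) = distr (lborel :: (real \<times> real) measure) borel (\<lambda>(u, v). Complex u v)"
proof (rule lborel_distr_basis_map[where f = "\<lambda>b. Complex (fst b) (snd b)"])
  show "bij_betw (\<lambda>b. Complex (fst b) (snd b)) Basis Basis"
    by (auto simp: Basis_prod_def Basis_complex_def bij_betw_def inj_on_def complex_eq_iff)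
  show "(case x of (u, v) \<Rightarrow> Complex u v) \<bullet> Complex (fst b) (snd b) = x \<bullet> b" for x b :: "real \<times> real"
    by (cases x; cases b) (simp add: inner_complex_def)
  show "(\<lambda>(u, v). Complex u v) \<in> borel_measurable borel"
    unfolding Complex_eq split_beta' by (intro borel_measurable_continuous_onI continuous_intros)
qed

definition stereo_inv :: "complex \<Rightarrow> real^3" where
  "stereo_inv t = vector [2 * Re t / (1 + (cmod t)\<^sup>2), 2 * Im t / (1 + (cmod t)\<^sup>2),
     ((cmod t)\<^sup>2 - 1) / ((cmod t)\<^sup>2 + 1)]"

lemma one_plus_cmod2_pos: "1 + (cmod t)\<^sup>2 > 0"
  by (simp add: add_pos_nonneg)

lemma stereo_inv_nth:
  "stereo_inv t $ 1 = 2 * Re t / (1 + (cmod t)\<^sup>2)"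
  "stereo_inv t $ 2 = 2 * Im t / (1 + (cmod t)\<^sup>2)"
  "stereo_inv t $ 3 = 1 - 2 / (1 + (cmod t)\<^sup>2)"
  using one_plus_cmod2_pos[of t] by (simp_all add: stereo_inv_def vector_3 field_simps)

text \<open>Half the squared chordal distance of two points, in the plane.  All kernels below depend on the
  points only through this quantity.\<close>

lemma stereo_inv_inner:
  "1 - stereo_inv t \<bullet> stereo_inv z = 2 * (cmod (t - z))\<^sup>2 / ((1 + (cmod t)\<^sup>2) * (1 + (cmod z)\<^sup>2))"
proof -
  define A where "A = 1 + (cmod t)\<^sup>2"
  define B where "B = 1 + (cmod z)\<^sup>2"
  have AB: "A > 0" "B > 0" unfolding A_def B_def by (rule one_plus_cmod2_pos)+
  have "stereo_inv t \<bullet> stereo_inv z = (4 * (Re t * Re z) + 4 * (Im t * Im z) + (A - 2) * (B - 2)) / (A * B)"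
    unfolding inner_vec_def sum_3 stereo_inv_nth A_def[symmetric] B_def[symmetric] using AB
    by (simp add: field_simps)
  then have "1 - stereo_inv t \<bullet> stereo_inv z = (A * B - (4 * (Re t * Re z) + 4 * (Im t * Im z) + (A - 2) * (B - 2))) / (A * B)"
    using AB by (simp add: field_simps)
  also have "A * B - (4 * (Re t * Re z) + 4 * (Im t * Im z) + (A - 2) * (B - 2)) = 2 * (cmod (t - z))\<^sup>2"
    unfolding A_def B_def cmod_power2 by (simp add: power2_eq_square algebra_simps)
  finally show ?thesis unfolding A_def B_def .
qed

lemma stereo_inv_in_sphere: "stereo_inv t \<in> sphere 0 1"
  using stereo_inv_inner[of t t] by (simp add: norm_eq_1)

lemma north_pole_nth: "north_pole $ 1 = 0" "north_pole $ 2 = 0" "north_pole $ 3 = 1"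
  by (simp_all add: north_pole_def vector_3)

lemma stereo_stereo_inv: "stereo (stereo_inv t) = t"
  using one_plus_cmod2_pos[of t]
  by (simp add: stereo_def stereo_inv_nth complex_eq_iff Re_divide_of_real Im_divide_of_real)

lemma stereo_inv_stereo:
  assumes "x \<in> sphere 0 1 - {north_pole}"
  shows "stereo_inv (stereo x) = x"
proof -
  have n: "(x$1)\<^sup>2 + (x$2)\<^sup>2 + (x$3)\<^sup>2 = 1"
    using assms by (simp add: norm_eq_1 inner_vec_def sum_3 power2_eq_square)
  have x3: "x$3 \<noteq> 1"
  proof
    assume 3: "x$3 = 1"
    then have "(x$1)\<^sup>2 + (x$2)\<^sup>2 = 0" using n by simp
    then have "x$1 = 0" "x$2 = 0" by (simp_all add: sum_power2_eq_zero_iff)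
    then have "x = north_pole" using 3 by (simp add: vec_eq_iff forall_3 north_pole_nth)
    then show False using assms by simp
  qed
  define d where "d = 1 - x$3"
  have d: "d \<noteq> 0" using x3 by (simp add: d_def)
  have re: "Re (stereo x) = x$1 / d" "Im (stereo x) = x$2 / d"
    by (simp_all add: stereo_def d_def Re_divide_of_real Im_divide_of_real flip: of_real_diff)
  have "(cmod (stereo x))\<^sup>2 = ((x$1)\<^sup>2 + (x$2)\<^sup>2) / d\<^sup>2"
    unfolding cmod_power2 re by (simp add: power_divide add_divide_distrib)
  also have "(x$1)\<^sup>2 + (x$2)\<^sup>2 = d * (2 - d)" using n by (simp add: d_def power2_eq_square algebra_simps)
  also have "d * (2 - d) / d\<^sup>2 = 2 / d - 1" using d by (simp add: power2_eq_square diff_divide_distrib)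
  finally have c: "1 + (cmod (stereo x))\<^sup>2 = 2 / d" by simp
  have "stereo_inv (stereo x) $ i = x $ i" for i
    using exhaust_3[of i] unfolding c re using d by (auto simp: stereo_inv_nth c re d_def field_simps)
  then show ?thesis by (simp add: vec_eq_iff)
qed

lemma inj_on_stereo: "inj_on stereo (sphere 0 1 - {north_pole})"
  by (rule inj_on_inverseI) (rule stereo_inv_stereo)

lemma sphere_metric_pos: "sphere_metric t > 0"
  using one_plus_cmod2_pos[of t] by (simp add: sphere_metric_def)

lemma borel_measurable_vecI:
  fixes f :: "'a \<Rightarrow> real ^ 'n"
  assumes "\<And>i. (\<lambda>x. f x $ i) \<in> borel_measurable M"
  shows "f \<in> borel_measurable M"
  unfolding borel_measurable_euclidean_space[of f]
  using assms by (auto simp: Basis_vec_def inner_axis)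

lemma measurable_stereo_inv[measurable]: "stereo_inv \<in> borel_measurable borel"
proof (rule borel_measurable_vecI)
  fix i :: 3
  show "(\<lambda>t. stereo_inv t $ i) \<in> borel_measurable borel"
    using exhaust_3[of i] by (auto simp: stereo_inv_nth)
qed

lemma measurable_sphere_metric[measurable]: "sphere_metric \<in> borel_measurable borel"
  unfolding sphere_metric_def[abs_def] by measurable

text \<open>The point of the plane that is the projection of the point with colatitude \<open>\<theta>\<close> and longitude
  \<open>\<phi>\<close>: since \<open>sin \<theta> / (1 - cos \<theta>) = cot (\<theta>/2)\<close>, it is \<open>cot (\<theta>/2) e\<^sup>\<i>\<^sup>\<phi>\<close>.\<close>

definition polar_stereo :: "real^2 \<Rightarrow> real^2" where
  "polar_stereo p = vector [cot (p$1 / 2) * cos (p$2), cot (p$1 / 2) * sin (p$2)]"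

definition polar_rect :: "(real^2) set" where
  "polar_rect = {p. 0 < p$1 \<and> p$1 < pi \<and> 0 < p$2 \<and> p$2 < 2 * pi}"

lemma Complex_polar_stereo:
  "Complex (polar_stereo p $ 1) (polar_stereo p $ 2) = complex_of_real (cot (p$1 / 2)) * exp (\<i> * complex_of_real (p$2))"
  by (simp add: polar_stereo_def vector_2 complex_eq_iff Re_exp Im_exp)

lemma polar_rect_half_angle:
  assumes "p \<in> polar_rect"
  shows "sin (p$1 / 2) > 0" "cos (p$1 / 2) > 0" "cot (p$1 / 2) > 0"
proof -
  show "sin (p$1 / 2) > 0" "cos (p$1 / 2) > 0"
    using assms by (auto simp: polar_rect_def intro!: sin_gt_zero cos_gt_zero_pi)
  then show "cot (p$1 / 2) > 0" by (simp add: cot_def)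
qed

lemma polar_stereo_cmod:
  assumes "p \<in> polar_rect"
  shows "cmod (Complex (polar_stereo p $ 1) (polar_stereo p $ 2)) = cot (p$1 / 2)"
  unfolding Complex_polar_stereo using polar_rect_half_angle(3)[OF assms] by (simp add: norm_mult)

lemma stereo_inv_polar_stereo:
  assumes "p \<in> polar_rect"
  shows "stereo_inv (Complex (polar_stereo p $ 1) (polar_stereo p $ 2))
    = vector [sin (p$1) * cos (p$2), sin (p$1) * sin (p$2), cos (p$1)]"
proof -
  let ?h = "p$1 / 2"
  note h = polar_rect_half_angle[OF assms]
  have c1: "1 + (cot ?h)\<^sup>2 = 1 / (sin ?h)\<^sup>2"
    using h(1) sin_cos_squared_add[of ?h] by (simp add: cot_def field_simps)
  have sin1: "sin (p$1) = 2 * sin ?h * cos ?h" using sin_double[of ?h] by simp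
  have cos1: "cos (p$1) = 1 - 2 * (sin ?h)\<^sup>2" using cos_double_sin[of ?h] by simp
  have "2 * cot ?h / (1 + (cot ?h)\<^sup>2) = sin (p$1)"
    unfolding c1 sin1 using h(1) by (simp add: cot_def power2_eq_square)
  then have *: "2 * (cot ?h * a) / (1 + (cot ?h)\<^sup>2) = sin (p$1) * a" for a
    by (metis mult.assoc mult.commute times_divide_eq_right)
  have "2 / (1 + (cot ?h)\<^sup>2) = 2 * (sin ?h)\<^sup>2" unfolding c1 by simp
  then have "stereo_inv (Complex (polar_stereo p $ 1) (polar_stereo p $ 2)) $ i
    = vector [sin (p$1) * cos (p$2), sin (p$1) * sin (p$2), cos (p$1)] $ i" for i
    using exhaust_3[of i]
    by (auto simp: stereo_inv_nth polar_stereo_cmod[OF assms] * cos1) (simp_all add: polar_stereo_def *)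
  then show ?thesis by (simp add: vec_eq_iff)
qed

lemma inj_on_polar_stereo: "inj_on polar_stereo polar_rect"
proof (rule inj_onI)
  fix p q assume p: "p \<in> polar_rect" and q: "q \<in> polar_rect" and eq: "polar_stereo p = polar_stereo q"
  have arg: "Arg2pi (Complex (polar_stereo p $ 1) (polar_stereo p $ 2)) = p$2" if "p \<in> polar_rect" for p
    unfolding Complex_polar_stereo using that polar_rect_half_angle(3)[OF that]
    by (intro Arg2pi_unique[OF refl]) (auto simp: polar_rect_def)
  have half: "p$1 = 2 * arctan (1 / cmod (Complex (polar_stereo p $ 1) (polar_stereo p $ 2)))" if "p \<in> polar_rect" for p
  proof -
    have "1 / cot (p$1 / 2) = tan (p$1 / 2)" by (simp add: cot_def tan_def)
    moreover have "arctan (tan (p$1 / 2)) = p$1 / 2" using that by (intro arctan_tan) (auto simp: polar_rect_def)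
    ultimately show ?thesis unfolding polar_stereo_cmod[OF that] by simp
  qed
  have "p$1 = q$1" using half[OF p] half[OF q] eq by simp
  moreover have "p$2 = q$2" using arg[OF p] arg[OF q] eq by simp
  ultimately show "p = q" by (simp add: vec_eq_iff forall_2)
qed

text \<open>The image of the open rectangle misses only the half-line of non-negative reals; excluding the
  whole real axis costs nothing, being a null set as well.\<close>

lemma polar_stereo_surj:
  assumes "u$2 \<noteq> 0"
  shows "u \<in> polar_stereo ` polar_rect"
proof -
  define z where "z = Complex (u$1) (u$2)"
  have z: "z \<noteq> 0" using assms by (auto simp: z_def complex_eq_iff)
  have "Arg2pi z \<noteq> 0" using assms by (simp add: Arg2pi_eq_0 z_def complex_is_Real_iff)
  then have A: "0 < Arg2pi z" "Arg2pi z < 2 * pi" using Arg2pi[of z] by auto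
  define p where "p = (vector [2 * arctan (1 / cmod z), Arg2pi z] :: real^2)"
  have p: "p$1 = 2 * arctan (1 / cmod z)" "p$2 = Arg2pi z" by (simp_all add: p_def)
  have pr: "p \<in> polar_rect"
    unfolding polar_rect_def p using A z arctan_ubound[of "1 / cmod z"] by (auto simp: p)
  have "cot (p$1 / 2) = cmod z"
    using tan_arctan[of "1 / cmod z"] unfolding p by (simp add: cot_altdef)
  then have "polar_stereo p $ 1 = u$1" "polar_stereo p $ 2 = u$2"
    using cos_Arg2pi[of z] sin_Arg2pi[of z] by (simp_all add: polar_stereo_def p z_def)
  then have "polar_stereo p = u" by (simp add: vec_eq_iff forall_2)
  then show ?thesis using pr by blast
qed

definition polar_stereo_deriv :: "real^2 \<Rightarrow> real^2 \<Rightarrow> real^2" where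
  "polar_stereo_deriv p d = vector
     [- (1 / (2 * (sin (p$1 / 2))\<^sup>2)) * d$1 * cos (p$2) - cot (p$1 / 2) * sin (p$2) * d$2,
      - (1 / (2 * (sin (p$1 / 2))\<^sup>2)) * d$1 * sin (p$2) + cot (p$1 / 2) * cos (p$2) * d$2]"

lemma polar_stereo_has_derivative:
  assumes "p \<in> polar_rect"
  shows "(polar_stereo has_derivative polar_stereo_deriv p) (at p within S)"
proof -
  note h = polar_rect_half_angle[OF assms]
  have nth: "((\<lambda>x::real^2. x $ i) has_derivative (\<lambda>d. d $ i)) (at p within S)" for i
    by (intro bounded_linear_imp_has_derivative bounded_linear_vec_nth)
  have "(cot has_real_derivative - inverse ((sin (p$1 / 2))\<^sup>2)) (at (p$1 / 2))"
    using h(1) by (intro DERIV_cot) auto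
  then have dcot: "(cot has_derivative (*) (- inverse ((sin (p$1 / 2))\<^sup>2))) (at (p$1 / 2))"
    by (simp add: has_field_derivative_def)
  have c: "((\<lambda>x::real^2. cot (x $ 1 / 2)) has_derivative (\<lambda>d. - inverse ((sin (p$1 / 2))\<^sup>2) * (d $ 1 / 2))) (at p within S)"
  proof -
    have "((\<lambda>x::real^2. x $ 1 / 2) has_derivative (\<lambda>d. d $ 1 / 2)) (at p within S)"
      by (auto intro!: derivative_eq_intros nth)
    from has_derivative_compose[OF this, of cot "(*) (- inverse ((sin (p$1 / 2))\<^sup>2))"] dcot
    show ?thesis by simp
  qed
  have 1: "((\<lambda>x. polar_stereo x $ 1) has_derivative (\<lambda>d. polar_stereo_deriv p d $ 1)) (at p within S)"
    unfolding polar_stereo_def polar_stereo_deriv_def vector_2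
    by (rule has_derivative_eq_rhs[OF has_derivative_mult[OF c has_derivative_cos[OF nth]]])
       (simp add: fun_eq_iff field_simps)
  have 2: "((\<lambda>x. polar_stereo x $ 2) has_derivative (\<lambda>d. polar_stereo_deriv p d $ 2)) (at p within S)"
    unfolding polar_stereo_def polar_stereo_deriv_def vector_2
    by (rule has_derivative_eq_rhs[OF has_derivative_mult[OF c has_derivative_sin[OF nth]]])
       (simp add: fun_eq_iff field_simps)
  show ?thesis
    unfolding has_derivative_componentwise_within[of polar_stereo]
    using 1 2 by (auto simp: Basis_real2 inner_axis)
qed

text \<open>The conformal factor \<open>g\<close> is exactly what turns Lebesgue measure on the plane into
  \<open>sin \<theta> d\<theta> d\<phi>\<close>.\<close>

lemma polar_stereo_jacobian:
  assumes "p \<in> polar_rect"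
  shows "\<bar>det (matrix (polar_stereo_deriv p))\<bar> * sphere_metric (Complex (polar_stereo p $ 1) (polar_stereo p $ 2)) = sin (p$1)"
proof -
  let ?h = "p$1 / 2"
  note h = polar_rect_half_angle[OF assms]
  let ?a = "1 / (2 * (sin ?h)\<^sup>2)"
  have "det (matrix (polar_stereo_deriv p)) = - ?a * cot ?h * ((cos (p$2))\<^sup>2 + (sin (p$2))\<^sup>2)"
    unfolding det_2 matrix_def polar_stereo_deriv_def
    by (simp add: vector_2 axis_def power2_eq_square algebra_simps add_divide_distrib del: sin_cos_squared_add3)
  also have "\<dots> = - (?a * cot ?h)" by simp
  finally have "\<bar>det (matrix (polar_stereo_deriv p))\<bar> = ?a * cot ?h"
    using h by (simp add: abs_mult)
  moreover have c1: "1 + (cot ?h)\<^sup>2 = 1 / (sin ?h)\<^sup>2"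
    using h(1) sin_cos_squared_add[of ?h] by (simp add: cot_def field_simps)
  have "sphere_metric (Complex (polar_stereo p $ 1) (polar_stereo p $ 2)) = 4 * (sin ?h)^4"
    unfolding sphere_metric_def polar_stereo_cmod[OF assms] c1 by (simp add: power_divide)
  moreover have "?a * cot ?h * (4 * (sin ?h)^4) = 2 * sin ?h * cos ?h"
    using h(1) by (simp add: cot_def power4_eq_xxxx power2_eq_square)
  moreover have "sin (p$1) = 2 * sin ?h * cos ?h" using sin_double[of ?h] by simp
  ultimately show ?thesis by simp
qed

lemma AE_coordinate_neq:
  fixes k :: 2
  shows "AE u in (lborel :: (real^2) measure). u $ k \<noteq> a"
proof -
  have "negligible {u :: real^2. u $ k = a}" 
  proof -
    have "axis k 1 \<in> (Basis :: (real^2) set)" by (auto simp: Basis_vec_def)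
    from negligible_standard_hyperplane[OF this, of a] show ?thesis by (simp add: inner_axis)
  qed
  then have "{u :: real^2. u $ k = a} \<in> null_sets lebesgue" by (simp add: negligible_iff_null_sets)
  then have "AE u in lebesgue. (u :: real^2) \<notin> {u. u $ k = a}" by (rule AE_not_in)
  then show ?thesis by (simp add: AE_completion_iff)
qed

lemma polar_rect_eq_box: "polar_rect = box (vector [0, 0]) (vector [pi, 2 * pi])"
  by (auto simp: polar_rect_def mem_box_cart forall_2)

lemma polar_change_of_variables:
  fixes F :: "real^2 \<Rightarrow> real"
  assumes h: "h absolutely_integrable_on polar_rect" and h0: "\<And>p. p \<in> polar_rect \<Longrightarrow> h p \<ge> 0"
    and hF: "\<And>p. p \<in> polar_rect \<Longrightarrow> h p = \<bar>det (matrix (polar_stereo_deriv p))\<bar> * F (polar_stereo p)"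
    and F0: "\<And>u. F u \<ge> 0"
  shows "(\<integral>\<^sup>+p. ennreal (h p) * indicator polar_rect p \<partial>lborel)
    = (\<integral>\<^sup>+u. ennreal (F u) \<partial>lborel)"
proof -
  define b where "b = integral polar_rect h"
  have hb: "(h has_integral b) polar_rect"
    using h unfolding b_def by (intro integrable_integral) (simp add: absolutely_integrable_on_def)
  \<comment> \<open>the change of variables formula is applied to functions with values in the one-dimensional space \<open>real^1\<close>\<close>
  define f where "f = (\<lambda>u. vec (F u) :: real^1)"
  have S: "polar_rect \<in> sets lebesgue" unfolding polar_rect_eq_box by simp
  have eq: "\<bar>det (matrix (polar_stereo_deriv p))\<bar> *\<^sub>R f (polar_stereo p) = vec (h p)" if "p \<in> polar_rect" for p
    using hF[OF that] by (simp add: f_def vec_eq_iff)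
  have bl: "bounded_linear (vec :: real \<Rightarrow> real^1)"
    by (rule linear_conv_bounded_linear[THEN iffD1]) (auto intro!: linearI simp: vec_eq_iff)
  have "(vec \<circ> h :: real^2 \<Rightarrow> real^1) absolutely_integrable_on polar_rect"
    by (rule absolutely_integrable_linear[OF h bl])
  then have 1: "(\<lambda>p. \<bar>det (matrix (polar_stereo_deriv p))\<bar> *\<^sub>R f (polar_stereo p)) absolutely_integrable_on polar_rect"
    by (rule absolutely_integrable_spike[where S = "{}"]) (auto simp: eq)
  have vh: "((vec \<circ> h :: real^2 \<Rightarrow> real^1) has_integral vec b) polar_rect"
    by (rule has_integral_linear[OF hb bl])
  have 2: "integral polar_rect (\<lambda>p. \<bar>det (matrix (polar_stereo_deriv p))\<bar> *\<^sub>R f (polar_stereo p)) = vec b"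
    by (rule integral_unique, rule has_integral_eq[rotated, OF vh]) (simp add: eq)
  have "f absolutely_integrable_on (polar_stereo ` polar_rect) \<and> integral (polar_stereo ` polar_rect) f = vec b"
  proof -
    have "(\<lambda>p. \<bar>det (matrix (polar_stereo_deriv p))\<bar> *\<^sub>R f (polar_stereo p)) absolutely_integrable_on polar_rect \<and>
        integral polar_rect (\<lambda>p. \<bar>det (matrix (polar_stereo_deriv p))\<bar> *\<^sub>R f (polar_stereo p)) = vec b
      \<longleftrightarrow> f absolutely_integrable_on (polar_stereo ` polar_rect) \<and> integral (polar_stereo ` polar_rect) f = vec b"
      by (rule has_absolute_integral_change_of_variables[OF S _ inj_on_polar_stereo]) (rule polar_stereo_has_derivative)
    then show ?thesis using 1 2 by (simp only: simp_thms)
  qed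
  then have fi: "f integrable_on (polar_stereo ` polar_rect)" "integral (polar_stereo ` polar_rect) f = vec b"
    by (simp_all only: absolutely_integrable_on_def)
  have f: "(f has_integral vec b) (polar_stereo ` polar_rect)"
    using integrable_integral[OF fi(1)] unfolding fi(2) .
  have bl': "bounded_linear (\<lambda>x::real^1. x $ 1)" by (rule bounded_linear_vec_nth)
  have "(((\<lambda>x. x $ 1) \<circ> f) has_integral ((vec b :: real^1) $ 1)) (polar_stereo ` polar_rect)"
    by (rule has_integral_linear[OF f bl'])
  then have F: "(F has_integral b) (polar_stereo ` polar_rect)" by (simp add: f_def o_def)
  have "(\<integral>\<^sup>+p. ennreal (h p) * indicator polar_rect p \<partial>lborel) = ennreal b"
    by (rule nn_integral_has_integral_lebesgue'[OF h0 hb])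
  also have "\<dots> = (\<integral>\<^sup>+u. ennreal (F u) * indicator (polar_stereo ` polar_rect) u \<partial>lborel)"
    by (rule nn_integral_has_integral_lebesgue'[OF F0 F, symmetric])
  also have "\<dots> = (\<integral>\<^sup>+u. ennreal (F u) \<partial>lborel)"
  proof (rule nn_integral_cong_AE)
    show "AE u in lborel. ennreal (F u) * indicator (polar_stereo ` polar_rect) u = ennreal (F u)"
      using AE_coordinate_neq[of 2 0] by eventually_elim (simp add: polar_stereo_surj)
  qed
  finally show ?thesis .
qed

theorem sphere_area_eq_stereo: "sphere_area = distr (density lborel sphere_metric) borel stereo_inv"
proof (rule measure_eqI)
  show "sets sphere_area = sets (distr (density lborel sphere_metric) borel stereo_inv)"
    by (simp add: sphere_area_def)
  fix B assume "B \<in> sets sphere_area"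
  then have B[measurable]: "B \<in> sets borel" by (simp add: sphere_area_def)
  define X where "X = (\<lambda>(\<theta>::real, \<phi>::real). vector [sin \<theta> * cos \<phi>, sin \<theta> * sin \<phi>, cos \<theta>] :: real^3)"
  have Xm[measurable]: "X \<in> borel_measurable borel"
  proof (rule borel_measurable_vecI)
    fix i :: 3
    have "(\<lambda>p::real\<times>real. sin (fst p) * cos (snd p)) \<in> borel_measurable borel"
      "(\<lambda>p::real\<times>real. sin (fst p) * sin (snd p)) \<in> borel_measurable borel"
      "(\<lambda>p::real\<times>real. cos (fst p)) \<in> borel_measurable borel"
      by (intro borel_measurable_continuous_onI continuous_intros)+
    then show "(\<lambda>x. X x $ i) \<in> borel_measurable borel"
      using exhaust_3[of i] by (auto simp: X_def split_beta' vector_3)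
  qed
  define k where "k = (\<lambda>(\<theta>::real, \<phi>::real). ennreal (indicator ({0..pi} \<times> {0..2*pi}) (\<theta>, \<phi>) * sin \<theta>))"
  have km[measurable]: "k \<in> borel_measurable borel"
  proof -
    have "(\<lambda>p::real\<times>real. sin (fst p)) \<in> borel_measurable borel"
      by (intro borel_measurable_continuous_onI continuous_intros)
    moreover have "{0..pi} \<times> {0..2*pi} \<in> sets (borel :: (real \<times> real) measure)"
      by (intro borel_closed closed_Times) auto
    moreover have "k = (\<lambda>p. ennreal (indicator ({0..pi} \<times> {0..2*pi}) p * sin (fst p)))"
      by (simp add: k_def split_beta')
    ultimately show ?thesis by simp
  qed
  have Pm[measurable]: "(\<lambda>u::real^2. (u$1, u$2)) \<in> borel_measurable borel"
    by (intro borel_measurable_Pair) measurable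
  have Cm[measurable]: "(\<lambda>u::real^2. Complex (u$1) (u$2)) \<in> borel_measurable borel"
    unfolding Complex_eq by measurable
  define h where "h = (\<lambda>p::real^2. sin (p$1) * indicator B (X (p$1, p$2)))"
  define F where "F = (\<lambda>u::real^2. sphere_metric (Complex (u$1) (u$2)) * indicator B (stereo_inv (Complex (u$1) (u$2))))"
  have "emeasure sphere_area B = (\<integral>\<^sup>+x. indicator B x \<partial>sphere_area)"
    by (simp add: sphere_area_def)
  also have "\<dots> = (\<integral>\<^sup>+x. indicator B (X x) \<partial>density lborel k)"
    unfolding sphere_area_def X_def[symmetric] k_def[symmetric]
    by (subst nn_integral_distr) (auto cong: measurable_cong_sets)
  also have "\<dots> = (\<integral>\<^sup>+x. k x * indicator B (X x) \<partial>lborel)"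
    by (subst nn_integral_density) auto
  also have "\<dots> = (\<integral>\<^sup>+u. k ((u :: real^2)$1, u$2) * indicator B (X (u$1, u$2)) \<partial>lborel)"
    by (subst lborel_pair_real2, subst nn_integral_distr) auto
  also have "\<dots> = (\<integral>\<^sup>+p. ennreal (h p) * indicator polar_rect p \<partial>lborel)"
  proof (rule nn_integral_cong_AE)
    show "AE p in lborel. k (p$1, p$2) * indicator B (X (p$1, p$2)) = ennreal (h p) * indicator polar_rect p"
      using AE_coordinate_neq[of 1 0] AE_coordinate_neq[of 1 pi] AE_coordinate_neq[of 2 0] AE_coordinate_neq[of 2 "2 * pi"]
      by eventually_elim (auto simp: k_def h_def polar_rect_def indicator_def)
  qed
  also have "\<dots> = (\<integral>\<^sup>+u. ennreal (F u) \<partial>lborel)"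
  proof (rule polar_change_of_variables)
    show "h absolutely_integrable_on polar_rect"
    proof (rule measurable_bounded_by_integrable_imp_absolutely_integrable)
      have "h \<in> borel_measurable borel" unfolding h_def by measurable
      then have "h \<in> borel_measurable lborel" by simp
      then have "h \<in> borel_measurable lebesgue" by (rule measurable_completion)
      then show "h \<in> borel_measurable (lebesgue_on polar_rect)" by (rule measurable_restrict_space1)
      show "polar_rect \<in> sets lebesgue" unfolding polar_rect_eq_box by simp
      show "(\<lambda>_. 1) integrable_on polar_rect"
        unfolding polar_rect_eq_box by (rule integrable_on_const[OF lmeasurable_box])
      show "norm (h p) \<le> 1" for p by (auto simp: h_def indicator_def)
    qed
    fix p assume p: "p \<in> polar_rect"
    have "sin (p$1) > 0" using p by (auto simp: polar_rect_def sin_gt_zero)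
    then show "h p \<ge> 0" by (simp add: h_def)
    show "h p = \<bar>det (matrix (polar_stereo_deriv p))\<bar> * F (polar_stereo p)"
      unfolding h_def F_def stereo_inv_polar_stereo[OF p] mult.assoc[symmetric] polar_stereo_jacobian[OF p]
      by (simp add: X_def)
  next
    show "F u \<ge> 0" for u
      using sphere_metric_pos[of "Complex (u$1) (u$2)"] by (simp add: F_def)
  qed
  also have "\<dots> = (\<integral>\<^sup>+u. ennreal (sphere_metric (Complex ((u :: real^2)$1) (u$2))) * indicator B (stereo_inv (Complex (u$1) (u$2))) \<partial>lborel)"
    by (intro nn_integral_cong) (auto simp: F_def indicator_def)
  also have "\<dots> = (\<integral>\<^sup>+t. ennreal (sphere_metric t) * indicator B (stereo_inv t) \<partial>lborel)"
    by (subst lborel_complex_real2, subst nn_integral_distr) auto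
  also have "\<dots> = (\<integral>\<^sup>+t. indicator B (stereo_inv t) \<partial>density lborel sphere_metric)"
    by (subst nn_integral_density) auto
  also have "\<dots> = (\<integral>\<^sup>+x. indicator B x \<partial>distr (density lborel sphere_metric) borel stereo_inv)"
    by (subst nn_integral_distr) (auto cong: measurable_cong_sets)
  also have "\<dots> = emeasure (distr (density lborel sphere_metric) borel stereo_inv) B" by simp
  finally show "emeasure sphere_area B = emeasure (distr (density lborel sphere_metric) borel stereo_inv) B" .
qed

lemma integral_sphere_area:
  fixes f :: "real^3 \<Rightarrow> real"
  assumes [measurable]: "f \<in> borel_measurable borel"
  shows "(LINT x|sphere_area. f x) = (LINT t|lborel. sphere_metric t * f (stereo_inv t))"
proof -
  have m: "stereo_inv \<in> measurable (density lborel sphere_metric) borel" by (simp cong: measurable_cong_sets)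
  have "(LINT x|sphere_area. f x) = (LINT t|density lborel sphere_metric. f (stereo_inv t))"
    unfolding sphere_area_eq_stereo by (rule integral_distr[OF m assms])
  also have "\<dots> = (LINT t|lborel. sphere_metric t * f (stereo_inv t))"
    using sphere_metric_pos by (subst integral_density) (auto intro: less_imp_le)
  finally show ?thesis .
qed

text \<open>A one-dimensional profile with an integrable tail, and for \<open>q < 1\<close> an integrable singularity at the origin.\<close>

definition powr_tail :: "real \<Rightarrow> real \<Rightarrow> real" where
  "powr_tail q s = (if \<bar>s\<bar> \<le> 1 then \<bar>s\<bar> powr (- q) else \<bar>s\<bar> powr (- 2))"

lemma powr_tail_nonneg: "powr_tail q s \<ge> 0"
  by (simp add: powr_tail_def)

lemma measurable_powr_tail[measurable]: "powr_tail q \<in> borel_measurable borel"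
  unfolding powr_tail_def[abs_def] by measurable

lemma nn_integral_powr_tail_finite:
  assumes q: "0 < q" "q < 1"
  shows "(\<integral>\<^sup>+s. ennreal (powr_tail q (s - a)) \<partial>lborel) < \<infinity>"
proof -
  define I where "I = (\<integral>\<^sup>+s. ennreal (powr_tail q s) * indicator {0..} s \<partial>lborel)"
  have "I \<le> (\<integral>\<^sup>+s. ennreal (s powr (- q)) * indicator {0..1} s + ennreal (s powr (- 2)) * indicator {1..} s \<partial>lborel)"
    unfolding I_def by (intro nn_integral_mono) (auto simp: powr_tail_def indicator_def)
  also have "\<dots> = (\<integral>\<^sup>+s. ennreal (s powr (- q)) * indicator {0..1} s \<partial>lborel) + (\<integral>\<^sup>+s. ennreal (s powr (- 2)) * indicator {1..} s \<partial>lborel)"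
    by (rule nn_integral_add) auto
  also have "(\<integral>\<^sup>+s. ennreal (s powr (- q)) * indicator {0..1} s \<partial>lborel) = ennreal (1 powr (- q + 1) / (- q + 1))"
    using q has_integral_powr_from_0[of "- q" 1] by (intro nn_integral_has_integral_lebesgue') auto
  also have "(\<integral>\<^sup>+s. ennreal (s powr (- 2)) * indicator {1..} s \<partial>lborel) = ennreal (- (1 powr (- 2 + 1)) / (- 2 + 1))"
    using has_integral_powr_to_inf[of "- 2" 1] by (intro nn_integral_has_integral_lebesgue') auto
  finally have I: "I < \<infinity>" by (simp add: le_less_trans)
  have "(\<integral>\<^sup>+s. ennreal (powr_tail q (s - a)) \<partial>lborel) = (\<integral>\<^sup>+s. ennreal (powr_tail q s) \<partial>lborel)"
    using nn_integral_real_affine[of "\<lambda>s. ennreal (powr_tail q (s - a))" 1 a] by simp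
  also have "\<dots> \<le> (\<integral>\<^sup>+s. ennreal (powr_tail q s) * indicator {0..} s + ennreal (powr_tail q (- s)) * indicator {0..} (- s) \<partial>lborel)"
    by (intro nn_integral_mono) (auto simp: powr_tail_def indicator_def)
  also have "\<dots> = I + (\<integral>\<^sup>+s. ennreal (powr_tail q (- s)) * indicator {0..} (- s) \<partial>lborel)"
    unfolding I_def by (rule nn_integral_add) auto
  also have "(\<integral>\<^sup>+s. ennreal (powr_tail q (- s)) * indicator {0..} (- s) \<partial>lborel) = I"
    unfolding I_def using nn_integral_real_affine[of "\<lambda>s. ennreal (powr_tail q s) * indicator {0..} s" "-1" 0] by simp
  finally show ?thesis using I by (auto intro: le_less_trans)
qed

text \<open>Far from \<open>a\<close>, the factor \<open>1 + u\<^sup>2\<close> is comparable to \<open>(u - a)\<^sup>2\<close>, which produces the exponent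
  \<open>- q + (q - 2) = - 2\<close> of the tail.\<close>

lemma powr_tail_bound:
  assumes q: "0 < q" "q < 1"
  shows "\<bar>u - a\<bar> powr (- q) * (1 + u\<^sup>2) powr (q / 2 - 1) \<le> (2 * (1 + a\<^sup>2)) * powr_tail q (u - a)"
proof (cases "\<bar>u - a\<bar> \<le> 1")
  case True
  have "1 + u\<^sup>2 \<ge> 1" by simp
  then have "(1 + u\<^sup>2) powr (q / 2 - 1) \<le> 1"
    using q powr_mono2'[of "q / 2 - 1" 1 "1 + u\<^sup>2"] by simp
  then have "\<bar>u - a\<bar> powr (- q) * (1 + u\<^sup>2) powr (q / 2 - 1) \<le> \<bar>u - a\<bar> powr (- q) * (2 * (1 + a\<^sup>2))"
    by (intro mult_left_mono) (auto intro: order.trans)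
  then show ?thesis using True by (simp add: powr_tail_def mult.commute)
next
  case False
  define s where "s = \<bar>u - a\<bar>"
  have s: "s > 1" using False by (simp add: s_def)
  have s2: "s\<^sup>2 \<le> 2 * (1 + a\<^sup>2) * (1 + u\<^sup>2)"
  proof -
    have "s\<^sup>2 = (u - a)\<^sup>2" by (simp add: s_def)
    also have "\<dots> \<le> 2 * u\<^sup>2 + 2 * a\<^sup>2"
      using zero_le_power2[of "u + a"] by (simp add: power2_eq_square algebra_simps)
    also have "\<dots> \<le> 2 * (1 + a\<^sup>2) * (1 + u\<^sup>2)"
      using mult_nonneg_nonneg[OF zero_le_power2[of a] zero_le_power2[of u]] by (simp add: algebra_simps)
    finally show ?thesis .
  qed
  define A where "A = 2 * (1 + a\<^sup>2)"
  have A: "A \<ge> 1" by (simp add: A_def)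
  have u0: "1 + u\<^sup>2 > 0" by (simp add: add_pos_nonneg)
  have "(1 + u\<^sup>2) powr (q / 2 - 1) \<le> (s\<^sup>2 / A) powr (q / 2 - 1)"
  proof -
    have "s\<^sup>2 / A \<le> 1 + u\<^sup>2" using s2 A unfolding A_def[symmetric] by (simp add: pos_divide_le_eq mult.commute)
    then show ?thesis using powr_mono2'[of "q / 2 - 1" "s\<^sup>2 / A" "1 + u\<^sup>2"] q s A by simp
  qed
  also have "\<dots> = s powr (q - 2) * A powr (1 - q / 2)"
  proof -
    have "(s\<^sup>2 / A) powr (q / 2 - 1) = (s\<^sup>2) powr (q / 2 - 1) / A powr (q / 2 - 1)"
      using s A by (simp add: powr_divide)
    also have "(s\<^sup>2) powr (q / 2 - 1) = s powr (q - 2)"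
      using s by (simp add: powr_powr flip: powr_numeral)
    also have "s powr (q - 2) / A powr (q / 2 - 1) = s powr (q - 2) * A powr (1 - q / 2)"
      using powr_minus_divide[of A "q / 2 - 1"] by simp
    finally show ?thesis .
  qed
  also have "\<dots> \<le> s powr (q - 2) * A"
    using powr_mono[of "1 - q / 2" 1 A] q A by (intro mult_left_mono) auto
  finally have "s powr (- q) * (1 + u\<^sup>2) powr (q / 2 - 1) \<le> s powr (- q) * (s powr (q - 2) * A)"
    by (intro mult_left_mono) auto
  also have "\<dots> = A * s powr (- 2)" using s by (simp add: powr_add[symmetric] mult.assoc[symmetric])
  finally show ?thesis using False by (simp add: powr_tail_def s_def A_def)
qed

text \<open>Integrability against the area measure of the chordal distance to the power \<open>-p\<close> for \<open>p < 2\<close>.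
  Instead of polar coordinates, the integrand is bounded by a product of functions of the two real
  coordinates, using \<open>\<bar>t - z\<bar>\<^sup>2 \<ge> \<bar>Re (t - z)\<bar> \<bar>Im (t - z)\<bar>\<close> and
  \<open>(1 + u\<^sup>2 + v\<^sup>2)\<^sup>2 \<ge> (1 + u\<^sup>2) (1 + v\<^sup>2)\<close>.\<close>

lemma integrable_chordal_power:
  assumes p: "0 < p" "p < 2"
  shows "integrable lborel (\<lambda>t. sphere_metric t * (1 - stereo_inv z \<bullet> stereo_inv t) powr (- p / 2))"
proof -
  define q where "q = p / 2"
  have q: "0 < q" "q < 1" using p by (auto simp: q_def)
  define A where "A = 1 + (cmod z)\<^sup>2"
  have A: "A > 0" unfolding A_def by (rule one_plus_cmod2_pos)
  define C where "C = 4 * (2 / A) powr (- q)"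
  define D where "D = C * (2 * (1 + (Re z)\<^sup>2)) * (2 * (1 + (Im z)\<^sup>2))"
  have C: "C \<ge> 0" by (simp add: C_def)
  have D: "D \<ge> 0" using C by (simp add: D_def)
  define f where "f = (\<lambda>t. sphere_metric t * (1 - stereo_inv z \<bullet> stereo_inv t) powr (- q))"
  have f0: "f t \<ge> 0" for t using sphere_metric_pos[of t] by (simp add: f_def)
  have bound: "f (Complex u v) \<le> D * (powr_tail q (u - Re z) * powr_tail q (v - Im z))"
    if uv: "u \<noteq> Re z" "v \<noteq> Im z" for u v
  proof -
    let ?t = "Complex u v"
    define T where "T = 1 + (cmod ?t)\<^sup>2"
    have T: "T > 0" unfolding T_def by (rule one_plus_cmod2_pos)
    have T2: "(1 + u\<^sup>2) * (1 + v\<^sup>2) \<le> T\<^sup>2"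
    proof -
      have Tuv: "T = 1 + u\<^sup>2 + v\<^sup>2" by (simp add: T_def cmod_power2)
      have "T\<^sup>2 = (1 + u\<^sup>2) * (1 + v\<^sup>2) + (u\<^sup>2 + v\<^sup>2 + u\<^sup>2 * v\<^sup>2 + u\<^sup>2 * u\<^sup>2 + v\<^sup>2 * v\<^sup>2)"
        unfolding Tuv power2_eq_square[of "_ + _"] by (simp add: algebra_simps)
      moreover have "u\<^sup>2 + v\<^sup>2 + u\<^sup>2 * v\<^sup>2 + u\<^sup>2 * u\<^sup>2 + v\<^sup>2 * v\<^sup>2 \<ge> 0" by simp
      ultimately show ?thesis by linarith
    qed
    define x where "x = \<bar>u - Re z\<bar>"
    define y where "y = \<bar>v - Im z\<bar>"
    have xy: "x > 0" "y > 0" using uv by (auto simp: x_def y_def)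
    have r: "x * y \<le> (cmod (z - ?t))\<^sup>2"
    proof -
      have "(cmod (z - ?t))\<^sup>2 = x\<^sup>2 + y\<^sup>2" unfolding cmod_power2 x_def y_def by (simp add: power2_commute)
      moreover have "2 * x * y \<le> x\<^sup>2 + y\<^sup>2" by (rule sum_squares_bound)
      moreover have "0 \<le> x * y" using xy by simp
      ultimately show ?thesis by linarith
    qed
    have "1 - stereo_inv z \<bullet> stereo_inv ?t = 2 / A * ((cmod (z - ?t))\<^sup>2 / T)"
      unfolding stereo_inv_inner A_def T_def by simp
    moreover have "2 / A * (x * y / T) \<le> 2 / A * ((cmod (z - ?t))\<^sup>2 / T)"
      using r T A by (intro mult_left_mono divide_right_mono) auto
    ultimately have "(1 - stereo_inv z \<bullet> stereo_inv ?t) powr (- q) \<le> (2 / A * (x * y / T)) powr (- q)"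
      using q xy T A by (intro powr_mono2') auto
    also have "\<dots> = (2 / A) powr (- q) * (x powr (- q) * y powr (- q) / T powr (- q))"
      using xy T A by (simp add: powr_mult powr_divide)
    also have "\<dots> = (2 / A) powr (- q) * (x powr (- q) * y powr (- q)) * T powr q"
      using powr_minus_divide[of T "-q"] by simp
    finally have "f ?t \<le> 4 / T\<^sup>2 * ((2 / A) powr (- q) * (x powr (- q) * y powr (- q)) * T powr q)"
      unfolding f_def sphere_metric_def T_def[symmetric] using T by (intro mult_left_mono) auto
    also have "\<dots> = C * (x powr (- q) * y powr (- q)) * (T powr q / T\<^sup>2)" by (simp add: C_def)
    also have "T powr q / T\<^sup>2 = (T\<^sup>2) powr (q / 2 - 1)"
      using T by (simp add: powr_powr powr_diff flip: powr_numeral)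
    also have "C * (x powr (- q) * y powr (- q)) * (T\<^sup>2) powr (q / 2 - 1)
        \<le> C * (x powr (- q) * y powr (- q)) * ((1 + u\<^sup>2) * (1 + v\<^sup>2)) powr (q / 2 - 1)"
    proof (rule mult_left_mono)
      have "(1 + u\<^sup>2) * (1 + v\<^sup>2) > 0" by (intro mult_pos_pos add_pos_nonneg) auto
      then show "(T\<^sup>2) powr (q / 2 - 1) \<le> ((1 + u\<^sup>2) * (1 + v\<^sup>2)) powr (q / 2 - 1)"
        using powr_mono2'[of "q / 2 - 1" "(1 + u\<^sup>2) * (1 + v\<^sup>2)" "T\<^sup>2"] T2 q by simp
    qed (use C in simp)
    also have "\<dots> = C * ((x powr (- q) * (1 + u\<^sup>2) powr (q / 2 - 1)) * (y powr (- q) * (1 + v\<^sup>2) powr (q / 2 - 1)))"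
      by (simp add: powr_mult mult_ac)
    also have "\<dots> \<le> C * ((2 * (1 + (Re z)\<^sup>2) * powr_tail q (u - Re z)) * (2 * (1 + (Im z)\<^sup>2) * powr_tail q (v - Im z)))"
      unfolding x_def y_def using C q
      by (intro mult_left_mono mult_mono powr_tail_bound) (auto simp: powr_tail_nonneg)
    also have "\<dots> = D * (powr_tail q (u - Re z) * powr_tail q (v - Im z))" by (simp add: D_def mult_ac)
    finally show ?thesis .
  qed
  have fm[measurable]: "f \<in> borel_measurable borel" unfolding f_def by measurable
  have Cm[measurable]: "(\<lambda>(u, v). Complex u v) \<in> borel_measurable borel"
    unfolding Complex_eq split_beta' by (intro borel_measurable_continuous_onI continuous_intros)
  have Cm'[measurable]: "(\<lambda>(u, v). Complex u v) \<in> borel_measurable (lborel \<Otimes>\<^sub>M lborel)"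
    using Cm unfolding lborel_prod by simp
  have "integrable lborel f"
  proof (rule integrableI_bounded)
    have "(\<integral>\<^sup>+t. ennreal (norm (f t)) \<partial>lborel) = (\<integral>\<^sup>+x. ennreal (f (case x of (u, v) \<Rightarrow> Complex u v)) \<partial>(lborel \<Otimes>\<^sub>M lborel))"
      using f0 unfolding lborel_prod by (subst lborel_complex_pair, subst nn_integral_distr) auto
    also have "\<dots> = (\<integral>\<^sup>+u. \<integral>\<^sup>+v. ennreal (f (Complex u v)) \<partial>lborel \<partial>lborel)"
    proof -
      have "(\<lambda>x. ennreal (f (case x of (u, v) \<Rightarrow> Complex u v))) \<in> borel_measurable (lborel \<Otimes>\<^sub>M lborel)" by measurable
      from lborel.nn_integral_fst[OF this] show ?thesis by simp
    qed
    also have "\<dots> \<le> (\<integral>\<^sup>+u. \<integral>\<^sup>+v. ennreal D * (ennreal (powr_tail q (u - Re z)) * ennreal (powr_tail q (v - Im z))) \<partial>lborel \<partial>lborel)"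
    proof (rule nn_integral_mono_AE)
      have "AE u in lborel. (u::real) \<noteq> Re z" by (rule AE_lborel_singleton)
      then show "AE u in lborel. (\<integral>\<^sup>+v. ennreal (f (Complex u v)) \<partial>lborel)
          \<le> (\<integral>\<^sup>+v. ennreal D * (ennreal (powr_tail q (u - Re z)) * ennreal (powr_tail q (v - Im z))) \<partial>lborel)"
      proof eventually_elim
        fix u assume u: "u \<noteq> Re z"
        show "(\<integral>\<^sup>+v. ennreal (f (Complex u v)) \<partial>lborel)
          \<le> (\<integral>\<^sup>+v. ennreal D * (ennreal (powr_tail q (u - Re z)) * ennreal (powr_tail q (v - Im z))) \<partial>lborel)"
        proof (rule nn_integral_mono_AE)
          have "AE v in lborel. (v::real) \<noteq> Im z" by (rule AE_lborel_singleton)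
          then show "AE v in lborel. ennreal (f (Complex u v)) \<le> ennreal D * (ennreal (powr_tail q (u - Re z)) * ennreal (powr_tail q (v - Im z)))"
          proof eventually_elim
            fix v assume "v \<noteq> Im z"
            from bound[OF u this] show "ennreal (f (Complex u v)) \<le> ennreal D * (ennreal (powr_tail q (u - Re z)) * ennreal (powr_tail q (v - Im z)))"
              using D powr_tail_nonneg by (simp add: ennreal_mult[symmetric] ennreal_leI)
          qed
        qed
      qed
    qed
    also have "\<dots> = ennreal D * ((\<integral>\<^sup>+u. ennreal (powr_tail q (u - Re z)) \<partial>lborel) * (\<integral>\<^sup>+v. ennreal (powr_tail q (v - Im z)) \<partial>lborel))"
      by (simp add: nn_integral_cmult nn_integral_multc)
    also have "\<dots> < \<infinity>"
      using nn_integral_powr_tail_finite[OF q] by (auto simp: ennreal_mult_less_top)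
    finally show "(\<integral>\<^sup>+t. ennreal (norm (f t)) \<partial>lborel) < \<infinity>" .
  qed measurable
  then show ?thesis by (simp add: f_def q_def)
qed

section \<open>The addition theorem for spherical harmonics\<close>

text \<open>The coefficient of \<open>s\<^sup>n\<close> in the Laurent polynomial \<open>(a + (v s - cnj v / s) / 2)\<^sup>l\<close>.  For
  \<open>a = x\<^sub>3\<close> and \<open>v = x\<^sub>1 + \<i> x\<^sub>2\<close> the base is the bilinear product of \<open>x\<close> with a vector whose square is
  zero, so its powers are harmonic polynomials in \<open>x\<close> and their coefficients are, up to
  factors, the spherical harmonics of degree \<open>l\<close>.\<close>

primrec harm_coeff :: "nat \<Rightarrow> real \<Rightarrow> complex \<Rightarrow> int \<Rightarrow> complex" where
  "harm_coeff 0 a v n = (if n = 0 then 1 else 0)"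
| "harm_coeff (Suc l) a v n =
     complex_of_real a * harm_coeff l a v n + v / 2 * harm_coeff l a v (n - 1) - cnj v / 2 * harm_coeff l a v (n + 1)"

lemma harm_coeff_outside: "\<bar>n\<bar> > int l \<Longrightarrow> harm_coeff l a v n = 0"
  by (induction l arbitrary: n) auto

lemma harm_coeff_uminus:
  "harm_coeff l a v (- n) = (if even n then 1 else -1) * cnj (harm_coeff l a v n)"
proof (induction l arbitrary: n)
  case (Suc l)
  have e: "- n - 1 = - (n + 1)" "- n + 1 = - (n - 1)" by auto
  show ?case unfolding harm_coeff.simps e Suc.IH by (auto simp: algebra_simps)
qed auto

lemma harm_coeff_rotate:
  assumes "cmod e = 1"
  shows "harm_coeff l a (e * v) n = e powi n * harm_coeff l a v n"
proof (induction l arbitrary: n)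
  case (Suc l)
  have "e \<noteq> 0" using assms by auto
  have c: "cnj e = 1 / e" using assms complex_norm_square[of e] \<open>e \<noteq> 0\<close> by (simp add: field_simps)
  have "e * e powi (n - 1) = e powi n" "1 / e * e powi (n + 1) = e powi n"
    using \<open>e \<noteq> 0\<close> by (simp_all add: power_int_diff power_int_add field_simps)
  then have *: "(e * v) * (e powi (n - 1) * h) = e powi n * (v * h)"
    "cnj (e * v) * (e powi (n + 1) * h) = e powi n * (cnj v * h)" for h
    unfolding complex_cnj_mult c by (metis mult.assoc mult.commute)+
  have "harm_coeff (Suc l) a (e * v) n = complex_of_real a * (e powi n * harm_coeff l a v n)
      + (e * v) * (e powi (n - 1) * harm_coeff l a v (n - 1)) / 2
      - cnj (e * v) * (e powi (n + 1) * harm_coeff l a v (n + 1)) / 2"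
    unfolding harm_coeff.simps Suc.IH by simp
  then show ?case unfolding * by (simp add: algebra_simps)
qed (auto simp: power_int_def)

lemma harm_coeff_eq_poly_coeff:
  fixes a r :: real
  shows "complex_of_real (coeff ([:- r / 2, a, r / 2:] ^ l) k) = harm_coeff l a (complex_of_real r) (int k - int l)"
proof (induction l arbitrary: k)
  case 0
  then show ?case by (simp add: coeff_1)
next
  case (Suc l)
  let ?q = "[:- r / 2, a, r / 2:] ^ l"
  have out: "harm_coeff l a (complex_of_real r) (- 1 - int l) = 0" "harm_coeff l a (complex_of_real r) (- 2 - int l) = 0"
    by (auto intro: harm_coeff_outside)
  have "coeff ([:- r / 2, a, r / 2:] ^ Suc l) k = - r / 2 * coeff ?q k
      + a * (if k \<ge> 1 then coeff ?q (k - 1) else 0) + r / 2 * (if k \<ge> 2 then coeff ?q (k - 2) else 0)"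
    by (cases k; cases "k - 1") (auto simp: mult_pCons_left coeff_pCons)
  then have "complex_of_real (coeff ([:- r / 2, a, r / 2:] ^ Suc l) k)
      = - complex_of_real r / 2 * harm_coeff l a (complex_of_real r) (int k - int l)
      + complex_of_real a * harm_coeff l a (complex_of_real r) (int k - 1 - int l)
      + complex_of_real r / 2 * harm_coeff l a (complex_of_real r) (int k - 2 - int l)"
  proof -
    have 1: "complex_of_real (if k \<ge> 1 then coeff ?q (k - 1) else 0) = harm_coeff l a (complex_of_real r) (int k - 1 - int l)"
    proof (cases "k \<ge> 1")
      case True
      then have "int (k - 1) - int l = int k - 1 - int l" by simp
      then show ?thesis using True Suc.IH[of "k - 1"] by (simp only: if_True)
    next
      case False
      then have "k = 0" by simp
      then show ?thesis using out by simp
    qed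
    have 2: "complex_of_real (if k \<ge> 2 then coeff ?q (k - 2) else 0) = harm_coeff l a (complex_of_real r) (int k - 2 - int l)"
    proof (cases "k \<ge> 2")
      case True
      then have "int (k - 2) - int l = int k - 2 - int l" by simp
      then show ?thesis using True Suc.IH[of "k - 2"] by (simp only: if_True)
    next
      case False
      then have "k = 0 \<or> k = 1" by auto
      then show ?thesis using out by auto
    qed
    show ?thesis if "coeff ([:- r / 2, a, r / 2:] ^ Suc l) k = - r / 2 * coeff ?q k
      + a * (if k \<ge> 1 then coeff ?q (k - 1) else 0) + r / 2 * (if k \<ge> 2 then coeff ?q (k - 2) else 0)"
      unfolding that of_real_add of_real_mult 1 2 Suc.IH by simp
  qed
  then show ?case by (simp add: algebra_simps)
qed

lemma coeff_eq_higher_pderiv: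
  fixes q :: "real poly"
  shows "coeff q j = poly ((pderiv ^^ j) q) 0 / fact j"
proof (induction j arbitrary: q)
  case (Suc j)
  have "poly ((pderiv ^^ Suc j) q) 0 = fact j * coeff (pderiv q) j"
    using Suc.IH[of "pderiv q"] by (simp add: funpow_swap1)
  then show ?case by (simp add: coeff_pderiv)
qed (simp add: poly_0_coeff_0)

lemma coeff_taylor_shift:
  fixes p :: "real poly"
  shows "coeff (pcompose p [:a, 1:]) j = poly ((pderiv ^^ j) p) a / fact j"
proof -
  have "(pderiv ^^ j) (pcompose p [:a, 1:]) = pcompose ((pderiv ^^ j) p) [:a, 1:]"
    by (induction j) (simp_all add: pderiv_pcompose pderiv_pCons)
  then show ?thesis by (simp add: coeff_eq_higher_pderiv poly_pcompose)
qed

text \<open>If \<open>a\<^sup>2 + r\<^sup>2 = 1\<close> then \<open>2 r s (a + (r s - r / s) / 2) = (a + r s)\<^sup>2 - 1\<close>.  So the coefficients in question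
  are, up to powers of \<open>2 r\<close>, the Taylor coefficients at \<open>a\<close> of \<open>(X\<^sup>2 - 1)\<^sup>l\<close>, which are the derivatives in
  Rodrigues' formula.  The two poles \<open>r = 0\<close> are treated separately.\<close>

lemma harm_coeff_legendre_real:
  fixes a r :: real
  assumes "a\<^sup>2 + r\<^sup>2 = 1"
  shows "harm_coeff l a (complex_of_real r) (int n)
    = complex_of_real (fact l / fact (l + n) * r ^ n * poly ((pderiv ^^ n) (legendre_poly l)) a)"
proof -
  let ?P = "[:-1, 0, 1:] ^ l :: real poly"
  have D: "poly ((pderiv ^^ n) (legendre_poly l)) a = poly ((pderiv ^^ (l + n)) ?P) a / (2 ^ l * fact l)"
  proof -
    have "(pderiv ^^ n) (smult c p) = smult c ((pderiv ^^ n) p)" for c and p :: "real poly"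
      by (induction n) (simp_all add: pderiv_smult)
    then show ?thesis by (simp add: legendre_poly_def funpow_add add.commute[of l])
  qed
  have pc: "pcompose (p ^ m) q = pcompose p q ^ m" for p q :: "real poly" and m
    by (induction m) (simp_all add: pcompose_mult pcompose_1)
  have taylor: "coeff ([:a\<^sup>2 - 1, 2 * a, 1:] ^ l) (l + n) = poly ((pderiv ^^ (l + n)) ?P) a / fact (l + n)"
    using coeff_taylor_shift[of ?P a "l + n"]
    by (simp add: pc pcompose_pCons power2_eq_square algebra_simps)
  have link: "harm_coeff l a (complex_of_real r) (int n) = complex_of_real (coeff ([:- r / 2, a, r / 2:] ^ l) (l + n))"
    using harm_coeff_eq_poly_coeff[of r a l "l + n"] by simp
  have "coeff ([:- r / 2, a, r / 2:] ^ l) (l + n)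
      = fact l / fact (l + n) * r ^ n * poly ((pderiv ^^ n) (legendre_poly l)) a"
  proof (cases "r = 0")
    case False
    \<comment> \<open>multiplying the Laurent polynomial by \<open>s\<close> makes it the polynomial \<open>- r/2 + a s + r/2 s\<^sup>2\<close>\<close>
    have "smult (2 * r) [:- r / 2, a, r / 2:] = pcompose [:a\<^sup>2 - 1, 2 * a, 1:] [:0, r:]"
      using assms by (simp add: pcompose_pCons power2_eq_square algebra_simps)
    then have "smult ((2 * r) ^ l) ([:- r / 2, a, r / 2:] ^ l) = pcompose ([:a\<^sup>2 - 1, 2 * a, 1:] ^ l) [:0, r:]"
      by (metis pc smult_power)
    then have "(2 * r) ^ l * coeff ([:- r / 2, a, r / 2:] ^ l) (l + n) = r ^ (l + n) * coeff ([:a\<^sup>2 - 1, 2 * a, 1:] ^ l) (l + n)"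
      by (metis coeff_smult coeff_pcompose_linear)
    then have "2 ^ l * coeff ([:- r / 2, a, r / 2:] ^ l) (l + n) = r ^ n * coeff ([:a\<^sup>2 - 1, 2 * a, 1:] ^ l) (l + n)"
      using False by (simp add: power_mult_distrib power_add)
    then show ?thesis unfolding taylor D by (simp add: divide_simps mult_ac)
  next
    case True
    then have a2: "a\<^sup>2 = 1" using assms by simp
    have mono: "coeff ([:0, a:] ^ l) k = (if k = l then a ^ l else 0)" for k
    proof -
      have "[:0, a:] = monom a 1" by (simp add: monom_Suc monom_0)
      then have "[:0, a:] ^ l = monom (a ^ l) l" by (simp add: monom_power)
      then show ?thesis by simp
    qed
    show ?thesis
    proof (cases "n = 0")
      case True
      have "[:a\<^sup>2 - 1, 2 * a, 1:] = [:0, 1:] * [:2 * a, 1:]" using a2 by simp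
      then have "[:a\<^sup>2 - 1, 2 * a, 1:] ^ l = monom 1 l * [:2 * a, 1:] ^ l"
        by (simp add: power_mult_distrib monom_altdef del: mult_pCons_left mult_pCons_right)
      then have "coeff ([:a\<^sup>2 - 1, 2 * a, 1:] ^ l) l = (2 * a) ^ l"
        by (simp add: coeff_monom_mult coeff_0_power)
      then have "poly ((pderiv ^^ n) (legendre_poly l)) a = a ^ l"
        unfolding D using taylor True by (simp add: field_simps power_mult_distrib)
      with True \<open>r = 0\<close> show ?thesis by (simp add: mono)
    next
      case False
      then show ?thesis using \<open>r = 0\<close> by (simp add: mono)
    qed
  qed
  then show ?thesis by (simp add: link)
qed

text \<open>The associated Legendre functions times \<open>e\<^sup>\<i>\<^sup>n\<^sup>\<phi>\<close>; a rotation about the axis through the poles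
  reduces to real \<open>v\<close>.\<close>

lemma harm_coeff_legendre:
  assumes "a\<^sup>2 + (cmod v)\<^sup>2 = 1"
  shows "harm_coeff l a v (int n)
    = complex_of_real (fact l / fact (l + n) * poly ((pderiv ^^ n) (legendre_poly l)) a) * v ^ n"
proof -
  obtain e where e: "cmod e = 1" "v = e * complex_of_real (cmod v)"
  proof (cases "v = 0")
    case False
    then show ?thesis using that[of "v / complex_of_real (cmod v)"] by (simp add: norm_divide)
  qed (use that[of 1] in simp)
  have "harm_coeff l a v (int n) = e ^ n * harm_coeff l a (complex_of_real (cmod v)) (int n)"
    by (subst e(2), subst harm_coeff_rotate[OF e(1)]) simp
  also have "\<dots> = complex_of_real (fact l / fact (l + n) * poly ((pderiv ^^ n) (legendre_poly l)) a) * (e * complex_of_real (cmod v)) ^ n"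
    by (simp add: harm_coeff_legendre_real[OF assms] power_mult_distrib)
  finally show ?thesis using e(2) by simp
qed

text \<open>The curve \<open>(a, v)\<close> is a rotation in the plane of the second and third coordinates.  Such a rotation
  acts on the coefficients by a ladder operator, which only connects neighbouring indices.\<close>

lemma harm_coeff_rotation_derivative:
  fixes a :: "real \<Rightarrow> real" and v :: "real \<Rightarrow> complex"
  assumes a: "(a has_real_derivative Im (v t)) (at t)"
    and v: "(v has_vector_derivative (- \<i> * complex_of_real (a t))) (at t)"
  shows "((\<lambda>t. harm_coeff l (a t) (v t) n) has_vector_derivative
     (- \<i> / 2 * ((of_nat l - of_int n + 1) * harm_coeff l (a t) (v t) (n - 1)
       + (of_nat l + of_int n + 1) * harm_coeff l (a t) (v t) (n + 1)))) (at t)"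
proof (induction l arbitrary: n)
  case 0
  have "- \<i> / 2 * ((of_nat 0 - of_int n + 1) * harm_coeff 0 (a t) (v t) (n - 1)
       + (of_nat 0 + of_int n + 1) * harm_coeff 0 (a t) (v t) (n + 1)) = 0"
    by (auto simp: add_eq_0_iff)
  then show ?case by (simp only: harm_coeff.simps) simp
next
  case (Suc l)
  have a': "((\<lambda>t. complex_of_real (a t)) has_vector_derivative complex_of_real (Im (v t))) (at t)"
    using a by (rule has_vector_derivative_of_real)
  have v': "((\<lambda>t. v t / 2) has_vector_derivative (- \<i> * complex_of_real (a t)) / 2) (at t)"
    using has_vector_derivative_mult_right[OF v, of "1/2"] by (simp add: field_simps)
  have "((\<lambda>t. cnj (v t)) has_vector_derivative cnj (- \<i> * complex_of_real (a t))) (at t)"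
    using v by (rule has_vector_derivative_cnj)
  then have cv': "((\<lambda>t. cnj (v t) / 2) has_vector_derivative (\<i> * complex_of_real (a t)) / 2) (at t)"
    using has_vector_derivative_mult_right[of "\<lambda>t. cnj (v t)" _ "at t" "1/2"] by (simp add: field_simps)
  have im: "complex_of_real (Im (v t)) = - \<i> / 2 * (v t - cnj (v t))"
    by (simp add: complex_eq_iff)
  note d = has_vector_derivative_diff[OF has_vector_derivative_add[OF
        has_vector_derivative_mult[OF a' Suc.IH[of n]]
        has_vector_derivative_mult[OF v' Suc.IH[of "n - 1"]]]
        has_vector_derivative_mult[OF cv' Suc.IH[of "n + 1"]]]
  show ?case
    unfolding harm_coeff.simps
    by (rule has_vector_derivative_eq_rhs[OF d]) (simp add: im field_simps)
qed

text \<open>The weights are those for which the ladder operators of \<open>harm_coeff_rotation_derivative\<close> become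
  skew-adjoint; they are also the ones of the normalised spherical harmonics.\<close>

definition zonal_kernel :: "nat \<Rightarrow> real \<Rightarrow> complex \<Rightarrow> real \<Rightarrow> complex \<Rightarrow> complex" where
  "zonal_kernel l a v a' v' = (\<Sum>n\<in>{- int l..int l}.
     complex_of_real (fact (nat (int l - n)) * fact (nat (int l + n)) / (fact l)\<^sup>2)
       * (harm_coeff l a v n * cnj (harm_coeff l a' v' n)))"

lemma sum_int_telescope:
  fixes T :: "int \<Rightarrow> 'a::ab_group_add"
  shows "(\<Sum>n\<in>{- int l..int l}. T n - T (n - 1)) = T (int l) - T (- int l - 1)"
proof (induction l)
  case (Suc l)
  have "{- int (Suc l)..int (Suc l)} = insert (- int l - 1) (insert (int (Suc l)) {- int l..int l})" by auto
  then have "(\<Sum>n\<in>{- int (Suc l)..int (Suc l)}. T n - T (n - 1)) = (T (- int l - 1) - T (- int l - 1 - 1))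
      + ((T (int (Suc l)) - T (int (Suc l) - 1)) + (T (int l) - T (- int l - 1)))"
    using Suc.IH by simp
  also have "\<dots> = T (int (Suc l)) - T (- int l - 1 - 1)" by simp
  also have "- int l - 1 - 1 = - int (Suc l) - 1" by simp
  finally show ?case .
qed simp

lemma sum_int_symmetric:
  fixes f :: "int \<Rightarrow> 'a::comm_monoid_add"
  shows "(\<Sum>n\<in>{- int l..int l}. f n) = f 0 + (\<Sum>n=1..l. f (int n) + f (- int n))"
proof (induction l)
  case (Suc l)
  have "{- int (Suc l)..int (Suc l)} = insert (- int (Suc l)) (insert (int (Suc l)) {- int l..int l})" by auto
  then show ?case using Suc by (simp add: add_ac)
qed simp

text \<open>Rotating both points changes the summand by a difference \<open>T n - T (n - 1)\<close>, and \<open>T\<close> vanishes at both ends of the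
  range.\<close>

lemma zonal_kernel_rotation_derivative:
  fixes a a' :: "real \<Rightarrow> real" and v v' :: "real \<Rightarrow> complex"
  assumes a: "(a has_real_derivative Im (v t)) (at t)"
    and v: "(v has_vector_derivative (- \<i> * complex_of_real (a t))) (at t)"
    and a': "(a' has_real_derivative Im (v' t)) (at t)"
    and v': "(v' has_vector_derivative (- \<i> * complex_of_real (a' t))) (at t)"
  shows "((\<lambda>t. zonal_kernel l (a t) (v t) (a' t) (v' t)) has_vector_derivative 0) (at t)"
proof -
  define c where "c = harm_coeff l (a t) (v t)"
  define d where "d = (\<lambda>n. cnj (harm_coeff l (a' t) (v' t) n))"
  define w where "w = (\<lambda>n. complex_of_real (fact (nat (int l - n)) * fact (nat (int l + n)) / (fact l)\<^sup>2))"
  \<comment> \<open>the matrix element of the ladder operator between \<open>n\<close> and \<open>n + 1\<close>, computed from either side\<close>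
  define \<kappa> where "\<kappa> = (\<lambda>n. complex_of_real (fact (nat (int l - n)) * fact (nat (int l + n + 1)) / (fact l)\<^sup>2))"
  define T where "T = (\<lambda>n. - \<i> / 2 * \<kappa> n * (c (n + 1) * d n - c n * d (n + 1)))"
  define c' where "c' = (\<lambda>n. - \<i> / 2 * ((of_nat l - of_int n + 1) * c (n - 1) + (of_nat l + of_int n + 1) * c (n + 1)))"
  define d' where "d' = (\<lambda>n. \<i> / 2 * ((of_nat l - of_int n + 1) * d (n - 1) + (of_nat l + of_int n + 1) * d (n + 1)))"
  have dc: "((\<lambda>t. harm_coeff l (a t) (v t) n) has_vector_derivative c' n) (at t)" for n
    unfolding c'_def c_def by (rule harm_coeff_rotation_derivative[OF a v])
  have dd: "((\<lambda>t. cnj (harm_coeff l (a' t) (v' t) n)) has_vector_derivative d' n) (at t)" for n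
    using has_vector_derivative_cnj[OF harm_coeff_rotation_derivative[OF a' v', of l n]]
    unfolding d'_def d_def by (simp add: algebra_simps)
  have D: "((\<lambda>t. zonal_kernel l (a t) (v t) (a' t) (v' t)) has_vector_derivative
      (\<Sum>n\<in>{- int l..int l}. w n * (c n * d' n + c' n * d n))) (at t)"
    unfolding zonal_kernel_def w_def c_def d_def
    by (intro has_vector_derivative_sum has_vector_derivative_mult_right has_vector_derivative_mult dc dd)
  have w1: "w n * (of_nat l + of_int n + 1) = \<kappa> n" and w2: "w n * (of_nat l - of_int n + 1) = \<kappa> (n - 1)"
    if n: "n \<in> {- int l..int l}" for n
  proof -
    have "nat (int l + n + 1) = Suc (nat (int l + n))" "nat (int l - (n - 1)) = Suc (nat (int l - n))"
      using n by auto
    moreover have "real (nat (int l + n)) = real l + real_of_int n" "real (nat (int l - n)) = real l - real_of_int n"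
      using n by auto
    ultimately have f: "(fact (nat (int l + n + 1)) :: real) = (real l + real_of_int n + 1) * fact (nat (int l + n))"
      "(fact (nat (int l - (n - 1))) :: real) = (real l - real_of_int n + 1) * fact (nat (int l - n))"
      by (simp_all add: algebra_simps)
    show "w n * (of_nat l + of_int n + 1) = \<kappa> n"
      unfolding w_def \<kappa>_def f(1) by simp
    show "w n * (of_nat l - of_int n + 1) = \<kappa> (n - 1)"
      unfolding w_def \<kappa>_def f(2) by simp
  qed
  have *: "w n * (c n * d' n + c' n * d n) = T n - T (n - 1)" if n: "n \<in> {- int l..int l}" for n
  proof -
    have "w n * (c n * d' n + c' n * d n) = - \<i> / 2 * (
        (w n * (of_nat l + of_int n + 1)) * (c (n + 1) * d n - c n * d (n + 1))
      - (w n * (of_nat l - of_int n + 1)) * (c n * d (n - 1) - c (n - 1) * d n))"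
      unfolding c'_def d'_def by (simp add: field_simps)
    then show ?thesis unfolding w1[OF n] w2[OF n] T_def by (simp add: algebra_simps)
  qed
  have "(\<Sum>n\<in>{- int l..int l}. w n * (c n * d' n + c' n * d n)) = T (int l) - T (- int l - 1)"
    unfolding sum_int_telescope[symmetric] by (rule sum.cong[OF refl *])
  also have "\<dots> = 0"
    by (simp add: T_def c_def d_def harm_coeff_outside)
  finally show ?thesis using D by simp
qed

lemma zonal_kernel_rotate_axis:
  assumes "cmod e = 1"
  shows "zonal_kernel l a (e * v) a' (e * v') = zonal_kernel l a v a' v'"
proof -
  have "e powi n * cnj (e powi n) = 1" for n
    using assms by (metis complex_norm_square norm_power_int of_real_1 one_power2 power_int_1_left)
  then have "e powi n * x * (cnj (e powi n) * y) = x * y" for n and x y :: complex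
    by (metis (no_types, lifting) ab_semigroup_mult_class.mult_ac(1) mult.left_commute mult.right_neutral)
  then have *: "(e powi n * x) * (cnj (e powi n) * y) = x * y" for n and x y :: complex
    by (simp only: mult.assoc)
  show ?thesis
    unfolding zonal_kernel_def harm_coeff_rotate[OF assms] complex_cnj_mult * ..
qed

lemma harm_coeff_pole: "harm_coeff l 1 0 n = (if n = 0 then 1 else 0)"
  by (induction l arbitrary: n) auto

lemma legendre_eq_harm_coeff:
  assumes "a\<^sup>2 + (cmod v)\<^sup>2 = 1"
  shows "complex_of_real (poly (legendre_poly l) a) = harm_coeff l a v 0"
  using harm_coeff_legendre[OF assms, of l 0] by simp

lemma zonal_kernel_pole:
  assumes "a\<^sup>2 + (cmod v)\<^sup>2 = 1"
  shows "zonal_kernel l a v 1 0 = complex_of_real (poly (legendre_poly l) a)"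
proof -
  have "zonal_kernel l a v 1 0 = (\<Sum>n\<in>{- int l..int l}. if n = 0 then harm_coeff l a v 0 else 0)"
    unfolding zonal_kernel_def harm_coeff_pole by (intro sum.cong refl) (auto simp: power2_eq_square)
  then show ?thesis by (simp add: legendre_eq_harm_coeff[OF assms])
qed

text \<open>The kernel is invariant under rotations about the third axis and under rotations about the first axis.
  These suffice to move the second point to the pole, where only the coefficient with
  index zero is left and the kernel is a Legendre polynomial in the third coordinate of the
  first point.\<close>

theorem zonal_kernel_eq_legendre:
  assumes x: "a\<^sup>2 + (cmod v)\<^sup>2 = 1" and y: "a'\<^sup>2 + (cmod v')\<^sup>2 = 1"
  shows "zonal_kernel l a v a' v' = complex_of_real (poly (legendre_poly l) (a * a' + Re (v * cnj v')))"
proof -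
  \<comment> \<open>a rotation about the third axis brings the second point into the plane of the second and third coordinates\<close>
  obtain e where e: "cmod e = 1" "e * v' = \<i> * complex_of_real (cmod v')"
  proof (cases "v' = 0")
    case False
    have "v' * cnj v' = complex_of_real (cmod v') * complex_of_real (cmod v')"
      using complex_norm_square[of v'] by (simp add: power2_eq_square)
    then show ?thesis
      using False that[of "\<i> * cnj v' / complex_of_real (cmod v')"] by (simp add: norm_mult norm_divide field_simps)
  qed (use that[of 1] in simp)
  define r where "r = cmod v'"
  define x1 where "x1 = Re (e * v)"
  define x2 where "x2 = Im (e * v)"
  have ev: "e * v = Complex x1 x2" by (simp add: x1_def x2_def complex_eq_iff)
  have rx2: "r * x2 = Re (v * cnj v')"
  proof -
    have "e * v * cnj (e * v') = (e * cnj e) * (v * cnj v')" by (simp add: algebra_simps)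
    also have "e * cnj e = 1" using complex_norm_square[of e] e(1) by simp
    finally have "v * cnj v' = e * v * cnj (\<i> * complex_of_real r)" using e(2) by (simp add: r_def)
    then show ?thesis by (simp add: ev)
  qed
  have nx: "a\<^sup>2 + (x1\<^sup>2 + x2\<^sup>2) = 1"
  proof -
    have "(cmod (e * v))\<^sup>2 = (cmod v)\<^sup>2" using e(1) by (simp add: norm_mult)
    then show ?thesis using x by (simp add: ev cmod_power2)
  qed
  obtain \<tau> where tau: "r = sin \<tau>" "a' = cos \<tau>"
    using y sincos_total_2pi[of a' r] by (metis r_def)
  \<comment> \<open>\<open>(A, V)\<close> and \<open>(A', V')\<close> are the two points rotated by the angle \<open>t\<close>; at \<open>t = \<tau>\<close> the second is the pole\<close>
  define A where "A = (\<lambda>t. x2 * sin t + a * cos t)"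
  define V where "V = (\<lambda>t. Complex x1 (x2 * cos t - a * sin t))"
  define A' where "A' = (\<lambda>t. r * sin t + a' * cos t)"
  define V' where "V' = (\<lambda>t. Complex 0 (r * cos t - a' * sin t))"
  have dA: "(A has_real_derivative Im (V t)) (at t)" "(A' has_real_derivative Im (V' t)) (at t)" for t
    unfolding A_def V_def A'_def V'_def by (auto intro!: derivative_eq_intros)
  have dC: "((\<lambda>t. Complex u (p * cos t - q * sin t)) has_vector_derivative (- \<i> * complex_of_real (p * sin t + q * cos t))) (at t)"
    for u p q t :: real
  proof -
    have "((\<lambda>t. p * cos t - q * sin t) has_real_derivative - (p * sin t + q * cos t)) (at t)"
      by (auto intro!: derivative_eq_intros)
    from has_vector_derivative_mult_right[OF has_vector_derivative_of_real[OF this], of \<i>]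
    have "((\<lambda>t. complex_of_real u + \<i> * complex_of_real (p * cos t - q * sin t)) has_vector_derivative
        0 + \<i> * complex_of_real (- (p * sin t + q * cos t))) (at t)"
      by (intro has_vector_derivative_add has_vector_derivative_const)
    then show ?thesis by (simp add: Complex_eq algebra_simps)
  qed
  have dV: "(V has_vector_derivative (- \<i> * complex_of_real (A t))) (at t)"
    "(V' has_vector_derivative (- \<i> * complex_of_real (A' t))) (at t)" for t
    unfolding A_def V_def A'_def V'_def by (rule dC)+
  have "((\<lambda>t. zonal_kernel l (A t) (V t) (A' t) (V' t)) has_vector_derivative 0) (at t within UNIV)" for t
    using zonal_kernel_rotation_derivative[OF dA(1) dV(1) dA(2) dV(2)] by simp
  then obtain c where c: "\<And>t. t \<in> UNIV \<Longrightarrow> zonal_kernel l (A t) (V t) (A' t) (V' t) = c"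
    using has_vector_derivative_zero_constant[OF convex_UNIV, of "\<lambda>t. zonal_kernel l (A t) (V t) (A' t) (V' t)"] by blast
  have "zonal_kernel l a v a' v' = zonal_kernel l a (e * v) a' (e * v')"
    by (rule zonal_kernel_rotate_axis[OF e(1), symmetric])
  also have "\<dots> = zonal_kernel l (A 0) (V 0) (A' 0) (V' 0)"
    unfolding e(2) by (simp add: A_def V_def A'_def V'_def ev Complex_eq r_def)
  also have "\<dots> = zonal_kernel l (A \<tau>) (V \<tau>) (A' \<tau>) (V' \<tau>)" by (simp only: c[OF UNIV_I])
  also have "A' \<tau> = 1"
    unfolding A'_def tau by (metis power2_eq_square sin_cos_squared_add)
  also have "V' \<tau> = 0" by (simp add: V'_def tau Complex_eq)
  also have "zonal_kernel l (A \<tau>) (V \<tau>) 1 0 = complex_of_real (poly (legendre_poly l) (A \<tau>))"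
  proof (rule zonal_kernel_pole)
    have "(A \<tau>)\<^sup>2 + (cmod (V \<tau>))\<^sup>2 = (x2 * sin \<tau> + a * cos \<tau>)\<^sup>2 + (x1\<^sup>2 + (x2 * cos \<tau> - a * sin \<tau>)\<^sup>2)"
      by (simp add: A_def V_def cmod_power2)
    also have "\<dots> = x1\<^sup>2 + (x2\<^sup>2 + a\<^sup>2) * ((sin \<tau>)\<^sup>2 + (cos \<tau>)\<^sup>2)"
      by (simp only: power2_eq_square) (simp only: algebra_simps)
    also have "\<dots> = 1" using nx by (simp add: algebra_simps)
    finally show "(A \<tau>)\<^sup>2 + (cmod (V \<tau>))\<^sup>2 = 1" .
  qed
  also have "A \<tau> = a * a' + Re (v * cnj v')"
    using rx2 tau by (simp add: A_def mult.commute)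
  finally show ?thesis .
qed

lemma legendre_at_1: "poly (legendre_poly l) 1 = 1"
  using legendre_eq_harm_coeff[of 1 0 l] harm_coeff_pole[of l 0] by simp

text \<open>By \<open>zonal_kernel_eq_legendre\<close> the vector of weighted coefficients of every point has norm
  \<open>P\<^sub>l(1) = 1\<close>, and \<open>P\<^sub>l(c)\<close> is the scalar product of two such vectors.\<close>

lemma abs_legendre_le_1:
  assumes "\<bar>c\<bar> \<le> 1"
  shows "\<bar>poly (legendre_poly l) c\<bar> \<le> 1"
proof -
  define r where "r = sqrt (1 - c\<^sup>2)"
  have c2: "c\<^sup>2 \<le> 1" using assms by (simp add: abs_square_le_1)
  have r: "c\<^sup>2 + (cmod (complex_of_real r))\<^sup>2 = 1" using c2 by (simp add: r_def)
  define w where "w = (\<lambda>n. fact (nat (int l - n)) * fact (nat (int l + n)) / (fact l)\<^sup>2 :: real)"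
  have w: "w n \<ge> 0" for n by (simp add: w_def)
  let ?c = "harm_coeff l c (complex_of_real r)" and ?d = "harm_coeff l 1 0"
  have norm1: "(\<Sum>n\<in>{- int l..int l}. w n * (cmod (harm_coeff l a v n))\<^sup>2) = 1" if "a\<^sup>2 + (cmod v)\<^sup>2 = 1" for a v
  proof -
    have "complex_of_real (\<Sum>n\<in>{- int l..int l}. w n * (cmod (harm_coeff l a v n))\<^sup>2) = zonal_kernel l a v a v"
      unfolding zonal_kernel_def of_real_sum of_real_mult w_def
      by (intro sum.cong refl) (simp add: complex_norm_square[symmetric])
    also have "\<dots> = complex_of_real (poly (legendre_poly l) (a * a + Re (v * cnj v)))"
      by (rule zonal_kernel_eq_legendre[OF that that])
    also have "a * a + Re (v * cnj v) = 1"
      using that by (simp add: power2_eq_square[symmetric] cmod_power2)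
    finally show ?thesis unfolding legendre_at_1 by (simp only: of_real_eq_iff)
  qed
  have "\<bar>poly (legendre_poly l) c\<bar> = cmod (zonal_kernel l c (complex_of_real r) 1 0)"
    using zonal_kernel_pole[OF r] by simp
  also have "\<dots> \<le> (\<Sum>n\<in>{- int l..int l}. w n * (cmod (?c n) * cmod (?d n)))"
    unfolding zonal_kernel_def w_def
    by (rule order.trans[OF norm_sum]) (simp add: norm_mult norm_divide norm_power)
  also have "\<dots> \<le> (\<Sum>n\<in>{- int l..int l}. w n * (((cmod (?c n))\<^sup>2 + (cmod (?d n))\<^sup>2) / 2))"
  proof (intro sum_mono mult_left_mono w)
    show "cmod (?c n) * cmod (?d n) \<le> ((cmod (?c n))\<^sup>2 + (cmod (?d n))\<^sup>2) / 2" for n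
      using sum_squares_bound[of "cmod (?c n)" "cmod (?d n)"] by simp
  qed
  also have "\<dots> = ((\<Sum>n\<in>{- int l..int l}. w n * (cmod (?c n))\<^sup>2) + (\<Sum>n\<in>{- int l..int l}. w n * (cmod (?d n))\<^sup>2)) / 2"
    by (simp add: sum.distrib[symmetric] sum_divide_distrib algebra_simps)
  also have "\<dots> = 1" using norm1[OF r] norm1[of 1 0] by simp
  finally show ?thesis .
qed

text \<open>The effect of the derivation \<open>s d/ds\<close> on the \<open>(l+1)\<close>-st power.\<close>

lemma harm_coeff_index:
  "of_int n * harm_coeff (Suc l) a v n
    = (of_nat l + 1) * (v / 2 * harm_coeff l a v (n - 1) + cnj v / 2 * harm_coeff l a v (n + 1))"
proof (induction l arbitrary: n)
  case 0
  have "n + 1 = 0 \<longleftrightarrow> n = - 1" by auto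
  then show ?case by (cases "n = 1"; cases "n = - 1"; simp)
next
  case (Suc l)
  let ?c = "harm_coeff (Suc l) a v"
  have e: "of_int (n - 1) = (of_int n - 1 :: complex)" "of_int (n + 1) = (of_int n + 1 :: complex)" by auto
  have IH: "of_int n * ?c n = (of_nat l + 1) * (v / 2 * harm_coeff l a v (n - 1) + cnj v / 2 * harm_coeff l a v (n + 1))"
    "of_int n * ?c (n - 1) = ?c (n - 1) + (of_nat l + 1) * (v / 2 * harm_coeff l a v (n - 2) + cnj v / 2 * harm_coeff l a v n)"
    "of_int n * ?c (n + 1) = - ?c (n + 1) + (of_nat l + 1) * (v / 2 * harm_coeff l a v n + cnj v / 2 * harm_coeff l a v (n + 2))"
    using Suc.IH[of n] Suc.IH[of "n - 1"] Suc.IH[of "n + 1"] unfolding e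
    by (simp_all del: harm_coeff.simps add: algebra_simps)
  have "of_int n * harm_coeff (Suc (Suc l)) a v n = complex_of_real a * (of_int n * ?c n)
      + v / 2 * (of_int n * ?c (n - 1)) - cnj v / 2 * (of_int n * ?c (n + 1))"
    unfolding harm_coeff.simps(2)[of "Suc l"] by (simp del: harm_coeff.simps add: algebra_simps)
  also have "\<dots> = (of_nat l + 1) * (v / 2 * ?c (n - 1) + cnj v / 2 * ?c (n + 1)) + v / 2 * ?c (n - 1) + cnj v / 2 * ?c (n + 1)"
    unfolding IH by (simp add: field_simps)
  finally show ?case by (simp del: harm_coeff.simps add: field_simps)
qed

lemma legendre_0: "poly (legendre_poly 0) c = 1"
  by (simp add: legendre_poly_def)

lemma legendre_1: "poly (legendre_poly (Suc 0)) c = c"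
  by (simp add: legendre_poly_def pderiv_pCons)

text \<open>At \<open>n = 0\<close> the recursion for \<open>harm_coeff\<close> involves the neighbours \<open>\<plusminus>1\<close> through \<open>s\<close> below.
  Expressing \<open>s\<close> once by the index relation and once by the recursion itself gives two equations, from
  which the coefficients with index \<open>\<plusminus>2\<close> are eliminated.\<close>

lemma legendre_recurrence:
  assumes "\<bar>c\<bar> \<le> 1"
  shows "(real l + 2) * poly (legendre_poly (Suc (Suc l))) c
    = (2 * real l + 3) * c * poly (legendre_poly (Suc l)) c - (real l + 1) * poly (legendre_poly l) c"
proof -
  define v where "v = complex_of_real (sqrt (1 - c\<^sup>2))"
  have c2: "c\<^sup>2 \<le> 1" using assms by (simp add: abs_square_le_1)
  have v: "c\<^sup>2 + (cmod v)\<^sup>2 = 1" using c2 by (simp add: v_def)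
  have vv: "v * v = 1 - complex_of_real c * complex_of_real c" "cnj v = v"
    using c2 by (auto simp: v_def of_real_mult[symmetric] power2_eq_square simp del: of_real_mult)
  let ?h = "\<lambda>l n. harm_coeff l c v n"
  have p: "complex_of_real (poly (legendre_poly l) c) = ?h l 0" for l
    by (rule legendre_eq_harm_coeff[OF v])
  define s where "s = v / 2 * (?h (Suc l) 1 - ?h (Suc l) (-1))"
  have 1: "?h (Suc (Suc l)) 0 = complex_of_real c * ?h (Suc l) 0 - s"
    unfolding harm_coeff.simps(2)[of "Suc l"] s_def vv(2) by (simp add: algebra_simps del: harm_coeff.simps)
  have 2: "s = (of_nat l + 1) * (v * v / 4) * (2 * ?h l 0 + ?h l 2 + ?h l (-2))"
  proof -
    have hx: "?h (Suc l) 1 = (of_nat l + 1) * (v / 2 * ?h l 0 + v / 2 * ?h l 2)"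
      using harm_coeff_index[of 1 l c v] by (simp del: harm_coeff.simps add: vv(2))
    have hy: "- ?h (Suc l) (-1) = (of_nat l + 1) * (v / 2 * ?h l (-2) + v / 2 * ?h l 0)"
      using harm_coeff_index[of "-1" l c v] by (simp del: harm_coeff.simps add: vv(2))
    have "s = v / 2 * (?h (Suc l) 1 + (- ?h (Suc l) (-1)))" by (simp add: s_def del: harm_coeff.simps)
    also have "\<dots> = (of_nat l + 1) * (v * v / 4) * (2 * ?h l 0 + ?h l 2 + ?h l (-2))"
      unfolding hx hy by (simp add: field_simps del: harm_coeff.simps)
    finally show ?thesis .
  qed
  have 3: "?h (Suc l) 0 = complex_of_real c * ?h l 0 + v / 2 * (?h l (-1) - ?h l 1)"
    by (simp add: vv(2) algebra_simps)
  have 4: "s = v / 2 * (complex_of_real c * (?h l 1 - ?h l (-1))) + v * v / 4 * (2 * ?h l 0 - ?h l 2 - ?h l (-2))"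
    by (simp add: s_def vv(2) algebra_simps)
  have 5: "v / 2 * (?h l 1 - ?h l (-1)) = complex_of_real c * ?h l 0 - ?h (Suc l) 0"
    unfolding 3 by (simp add: algebra_simps)
  have 6: "v * v / 4 * (?h l 2 + ?h l (-2)) = complex_of_real c * (complex_of_real c * ?h l 0 - ?h (Suc l) 0) + v * v / 2 * ?h l 0 - s"
    unfolding 4 5[symmetric] by (simp add: field_simps del: harm_coeff.simps)
  have "s = (of_nat l + 1) * (v * v / 2 * ?h l 0 + v * v / 4 * (?h l 2 + ?h l (-2)))"
    by (rule trans[OF 2]) (simp add: field_simps del: harm_coeff.simps)
  also have "\<dots> = (of_nat l + 1) * (?h l 0 - complex_of_real c * ?h (Suc l) 0 - s)"
    unfolding 6 unfolding vv(1) by (simp add: field_simps del: harm_coeff.simps)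
  finally have "(of_nat l + 2) * s = (of_nat l + 1) * (?h l 0 - complex_of_real c * ?h (Suc l) 0)"
    by (simp add: algebra_simps del: harm_coeff.simps)
  then have "(of_nat l + 2) * ?h (Suc (Suc l)) 0 = (2 * of_nat l + 3) * complex_of_real c * ?h (Suc l) 0 - (of_nat l + 1) * ?h l 0"
    unfolding 1 by (simp add: algebra_simps del: harm_coeff.simps)
  then have "complex_of_real ((real l + 2) * poly (legendre_poly (Suc (Suc l))) c)
    = complex_of_real ((2 * real l + 3) * c * poly (legendre_poly (Suc l)) c - (real l + 1) * poly (legendre_poly l) c)"
    unfolding of_real_mult of_real_diff of_real_add p by (simp del: harm_coeff.simps)
  then show ?thesis by (simp only: of_real_eq_iff)
qed

lemma sphere_coordinates:
  fixes x :: "real^3"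
  assumes "x \<in> sphere 0 1"
  shows "(x$3)\<^sup>2 + (cmod (complex_of_real (x$1) + \<i> * complex_of_real (x$2)))\<^sup>2 = 1"
  using assms unfolding cmod_power2 by (simp add: norm_eq_1 inner_vec_def sum_3 power2_eq_square)

lemma inner_coordinates:
  fixes x y :: "real^3"
  shows "x \<bullet> y = x$3 * y$3 + Re ((complex_of_real (x$1) + \<i> * complex_of_real (x$2))
    * cnj (complex_of_real (y$1) + \<i> * complex_of_real (y$2)))"
  by (simp add: inner_vec_def sum_3)

text \<open>The terms \<open>\<plusminus>n\<close> of the kernel are complex conjugates of each other, and
  \<open>Re (u cnj u') = Re u Re u' + Im u Im u'\<close> is the sum over the cosine and the sine harmonic.\<close>

theorem sph_harm_addition:
  fixes x y :: "real^3"
  assumes x: "x \<in> sphere 0 1" and y: "y \<in> sphere 0 1"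
  shows "(\<Sum>m=-int l..int l. sph_harm l m x * sph_harm l m y)
    = (2 * real l + 1) / (4 * pi) * poly (legendre_poly l) (x \<bullet> y)"
proof -
  define v where "v = complex_of_real (x$1) + \<i> * complex_of_real (x$2)"
  define v' where "v' = complex_of_real (y$1) + \<i> * complex_of_real (y$2)"
  define N where "N = (2 * real l + 1) / (4 * pi)"
  define D where "D = (\<lambda>n c. poly ((pderiv ^^ n) (legendre_poly l)) c)"
  define S where "S = (\<lambda>m. sph_harm l m x * sph_harm l m y)"
  note nx = sphere_coordinates[OF x, folded v_def] and ny = sphere_coordinates[OF y, folded v'_def]
  define T where "T = (\<lambda>n. complex_of_real (fact (nat (int l - n)) * fact (nat (int l + n)) / (fact l)\<^sup>2)
       * (harm_coeff l (x$3) v n * cnj (harm_coeff l (y$3) v' n)))"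
  have N0: "N \<ge> 0" by (simp add: N_def)
  have sq: "sqrt (N * q) * sqrt (N * q) = N * q" if "q \<ge> 0" for q
    using N0 that by (metis mult_nonneg_nonneg real_sqrt_mult_self abs_of_nonneg)
  have S0: "complex_of_real (S 0) = complex_of_real N * T 0"
  proof -
    have sph: "sph_harm l 0 z = sqrt (N * (fact (l - 0) / fact (l + 0))) * D 0 (z$3)" for z
      by (simp add: sph_harm_def D_def N_def Let_def)
    have "S 0 = (sqrt (N * (fact (l - 0) / fact (l + 0))) * sqrt (N * (fact (l - 0) / fact (l + 0)))) * (D 0 (x$3) * D 0 (y$3))"
      unfolding S_def sph by (simp only: mult_ac)
    also have "\<dots> = N * (D 0 (x$3) * D 0 (y$3))" by (subst sq) auto
    finally show ?thesis
      using harm_coeff_legendre[OF nx, of l 0] harm_coeff_legendre[OF ny, of l 0]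
      by (simp add: T_def D_def power2_eq_square)
  qed
  have Sn: "complex_of_real (S (int n) + S (- int n)) = complex_of_real N * (T (int n) + T (- int n))"
    if n: "n \<in> {1..l}" for n
  proof -
    define Q where "Q = fact (l - n) / (fact (l + n) :: real)"
    have Q: "Q \<ge> 0" by (simp add: Q_def)
    define u where "u = v ^ n"
    define u' where "u' = v' ^ n"
    have sph: "sph_harm l (int n) z = sqrt (N * Q) * D n (z$3) * (sqrt 2 * Re ((complex_of_real (z$1) + \<i> * complex_of_real (z$2)) ^ n))"
      "sph_harm l (- int n) z = sqrt (N * Q) * D n (z$3) * (sqrt 2 * Im ((complex_of_real (z$1) + \<i> * complex_of_real (z$2)) ^ n))" for z
      using n by (simp_all add: sph_harm_def D_def N_def Q_def Let_def)
    have "S (int n) = (sqrt (N * Q) * sqrt (N * Q)) * (D n (x$3) * D n (y$3)) * ((sqrt 2 * sqrt 2) * (Re u * Re u'))"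
      unfolding S_def sph u_def u'_def v_def v'_def by (simp only: mult_ac)
    moreover have "S (- int n) = (sqrt (N * Q) * sqrt (N * Q)) * (D n (x$3) * D n (y$3)) * ((sqrt 2 * sqrt 2) * (Im u * Im u'))"
      unfolding S_def sph u_def u'_def v_def v'_def by (simp only: mult_ac)
    ultimately have 1: "S (int n) + S (- int n) = N * (Q * (D n (x$3) * D n (y$3)) * (2 * Re (u * cnj u')))"
      unfolding sq[OF Q] by (simp add: algebra_simps)
    have nat: "nat (int l - int n) = l - n" "nat (int l + int n) = l + n" "nat (int l - - int n) = l + n" "nat (int l + - int n) = l - n"
      using n by auto
    have fr: "complex_of_real (fact (l - n) * fact (l + n) / (fact l)\<^sup>2) * (complex_of_real (fact l / fact (l + n) * d) * z * (complex_of_real (fact l / fact (l + n) * d') * z'))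
        = complex_of_real (Q * (d * d')) * (z * z')" for d d' z z'
    proof -
      have "fact (l - n) * fact (l + n) / (fact l)\<^sup>2 * ((fact l / fact (l + n) * d) * (fact l / fact (l + n) * d')) = Q * (d * d')"
        by (simp add: Q_def power2_eq_square field_simps)
      then show ?thesis by (metis (no_types, lifting) mult.assoc mult.left_commute of_real_mult)
    qed
    have T1: "T (int n) = complex_of_real (Q * (D n (x$3) * D n (y$3))) * (u * cnj u')"
      unfolding T_def nat harm_coeff_legendre[OF nx] harm_coeff_legendre[OF ny] D_def u_def[symmetric] u'_def[symmetric]
        complex_cnj_mult complex_cnj_complex_of_real by (rule fr)
    have T2: "T (- int n) = complex_of_real (Q * (D n (x$3) * D n (y$3))) * (cnj u * u')"
    proof -
      have "T (- int n) = cnj (T (int n))"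
        unfolding T_def nat harm_coeff_uminus by (simp add: algebra_simps)
      then show ?thesis unfolding T1 by simp
    qed
    have "T (int n) + T (- int n) = complex_of_real (Q * (D n (x$3) * D n (y$3)) * (2 * Re (u * cnj u')))"
      unfolding T1 T2 by (simp add: complex_eq_iff algebra_simps)
    then show ?thesis unfolding 1 by simp
  qed
  have "complex_of_real (\<Sum>m=-int l..int l. S m) = complex_of_real (S 0) + (\<Sum>n=1..l. complex_of_real (S (int n) + S (- int n)))"
    unfolding sum_int_symmetric by simp
  also have "\<dots> = complex_of_real N * (T 0 + (\<Sum>n=1..l. T (int n) + T (- int n)))"
    unfolding S0 using Sn by (simp add: distrib_left sum_distrib_left)
  also have "\<dots> = complex_of_real N * zonal_kernel l (x$3) v (y$3) v'"
    unfolding zonal_kernel_def T_def[symmetric] sum_int_symmetric ..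
  also have "\<dots> = complex_of_real (N * poly (legendre_poly l) (x \<bullet> y))"
    unfolding zonal_kernel_eq_legendre[OF nx ny] inner_coordinates[of x y, folded v_def v'_def] by simp
  finally show ?thesis unfolding S_def N_def by (simp only: of_real_eq_iff)
qed

section \<open>Legendre series and the Green function\<close>

definition legendre_radius :: "real \<Rightarrow> real \<Rightarrow> real" where
  "legendre_radius c t = sqrt (1 - 2 * c * t + t\<^sup>2)"

lemma legendre_radius_pos:
  assumes "\<bar>c\<bar> \<le> 1" "\<bar>t\<bar> < 1"
  shows "1 - 2 * c * t + t\<^sup>2 > 0" and "legendre_radius c t > 0"
proof -
  have "\<bar>c * t\<bar> < 1"
    using assms by (metis abs_mult abs_ge_zero mult_le_cancel_right1 mult_less_cancel_right1 order_le_less_trans mult.commute mult_right_le_one_le not_less)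
  then have "(1 - c * t)\<^sup>2 > 0" by (auto simp: zero_less_power2)
  moreover have "t\<^sup>2 * (1 - c\<^sup>2) \<ge> 0" using assms(1) by (simp add: abs_square_le_1)
  moreover have "1 - 2 * c * t + t\<^sup>2 = (1 - c * t)\<^sup>2 + t\<^sup>2 * (1 - c\<^sup>2)"
    by (simp add: power2_eq_square algebra_simps)
  ultimately show "1 - 2 * c * t + t\<^sup>2 > 0" by linarith
  then show "legendre_radius c t > 0" by (simp add: legendre_radius_def)
qed

lemma legendre_radius_deriv:
  assumes "\<bar>c\<bar> \<le> 1" "\<bar>t\<bar> < 1"
  shows "(legendre_radius c has_real_derivative (t - c) / legendre_radius c t) (at t)"
  unfolding legendre_radius_def [abs_def]
  using legendre_radius_pos(1)[OF assms]
  by (auto intro!: derivative_eq_intros simp: field_simps)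

lemma summable_bounded_power:
  fixes a :: "nat \<Rightarrow> real"
  assumes "\<And>n. \<bar>a n\<bar> \<le> 1" "\<bar>t\<bar> < 1"
  shows "summable (\<lambda>n. a n * t ^ n)"
proof (rule summable_comparison_test')
  show "summable (\<lambda>n. \<bar>t\<bar> ^ n)" using assms(2) by (simp add: summable_geometric)
  show "norm (a n * t ^ n) \<le> \<bar>t\<bar> ^ n" if "n \<ge> 0" for n
    using assms(1)[of n] by (simp add: abs_mult power_abs mult_left_le_one_le)
qed

lemma power_series_deriv:
  fixes a :: "nat \<Rightarrow> real"
  assumes "\<And>n. \<bar>a n\<bar> \<le> 1" "\<bar>t\<bar> < 1"
  shows "((\<lambda>t. \<Sum>n. a n * t ^ n) has_real_derivative (\<Sum>n. diffs a n * t ^ n)) (at t)"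
    and "summable (\<lambda>n. diffs a n * t ^ n)"
proof -
  obtain r where r: "\<bar>t\<bar> < r" "r < 1" using dense[OF assms(2)] by auto
  have s: "summable (\<lambda>n. a n * r ^ n)" using r by (intro summable_bounded_power assms(1)) auto
  show "((\<lambda>t. \<Sum>n. a n * t ^ n) has_real_derivative (\<Sum>n. diffs a n * t ^ n)) (at t)"
    by (rule termdiffs_strong[OF s]) (use r in auto)
  show "summable (\<lambda>n. diffs a n * t ^ n)"
    using termdiff_converges[of t 1 a] assms(2) summable_bounded_power[of a] assms(1) by auto
qed

text \<open>The termwise antiderivative, obtained from \<open>power_series_deriv\<close> for the shifted
  coefficient sequence \<open>0, a\<^sub>0, a\<^sub>1 / 2, a\<^sub>2 / 3, \<dots>\<close>.\<close>

lemma power_series_integral: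
  fixes a :: "nat \<Rightarrow> real"
  assumes a: "\<And>n. \<bar>a n\<bar> \<le> 1" and t: "\<bar>t\<bar> < 1"
  shows "((\<lambda>t. \<Sum>n. a n * t ^ Suc n / real (Suc n)) has_real_derivative (\<Sum>n. a n * t ^ n)) (at t)"
    and "summable (\<lambda>n. a n * t ^ Suc n / real (Suc n))"
proof -
  define g where "g = (\<lambda>n. case n of 0 \<Rightarrow> 0 | Suc k \<Rightarrow> a k / real (Suc k))"
  have g1: "\<bar>g n\<bar> \<le> 1" for n
  proof (cases n)
    case (Suc k)
    have "\<bar>a k\<bar> \<le> real (Suc k)" using a[of k] by simp
    then show ?thesis by (simp add: g_def Suc divide_le_eq)
  qed (simp add: g_def)
  have d: "diffs g = a" by (rule ext) (simp add: diffs_def g_def)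
  have sg: "summable (\<lambda>n. g n * s ^ n)" if "\<bar>s\<bar> < 1" for s
    by (rule summable_bounded_power[OF g1 that])
  have shift: "(\<Sum>n. g n * s ^ n) = (\<Sum>n. a n * s ^ Suc n / real (Suc n))" if "\<bar>s\<bar> < 1" for s
    using suminf_split_head[OF sg[OF that]] by (simp add: g_def)
  show "summable (\<lambda>n. a n * t ^ Suc n / real (Suc n))"
    using sg[OF t] summable_Suc_iff[of "\<lambda>n. g n * t ^ n"] by (simp add: g_def)
  have "((\<lambda>t. \<Sum>n. g n * t ^ n) has_real_derivative (\<Sum>n. a n * t ^ n)) (at t)"
    using power_series_deriv(1)[of g, OF g1 t] by (simp add: d)
  then show "((\<lambda>t. \<Sum>n. a n * t ^ Suc n / real (Suc n)) has_real_derivative (\<Sum>n. a n * t ^ n)) (at t)"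
  proof (rule has_field_derivative_transform_within_open[where S = "{-1<..<1}"])
    show "\<And>x. x \<in> {- 1<..<1} \<Longrightarrow> (\<Sum>n. g n * x ^ n) = (\<Sum>n. a n * x ^ Suc n / real (Suc n))"
      by (rule shift) auto
  qed (use t in auto)
qed

lemma constant_on_unit_interval:
  fixes f :: "real \<Rightarrow> real"
  assumes "\<And>s. \<bar>s\<bar> < 1 \<Longrightarrow> (f has_real_derivative 0) (at s)" "\<bar>t\<bar> < 1"
  shows "f t = f 0"
proof -
  have "(f has_derivative (\<lambda>h. 0)) (at s within {-1<..<1})" if "s \<in> {-1<..<1}" for s
  proof -
    have "(f has_real_derivative 0) (at s within {-1<..<1})"
      by (rule has_field_derivative_at_within, rule assms(1)) (use that in auto)
    then show ?thesis by (simp add: has_field_derivative_def lambda_zero)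
  qed
  from has_derivative_zero_constant[OF convex_real_interval(8) this]
  obtain c where c: "\<forall>s\<in>{-1<..<1}. f s = c" by blast
  have "t \<in> {-1<..<1}" "(0::real) \<in> {-1<..<1}" using assms(2) by auto
  then show ?thesis using c by metis
qed

text \<open>The three-term recurrence says that the series \<open>f\<close> satisfies \<open>R\<^sup>2 f' = (c - t) f\<close> where
  \<open>R\<^sup>2 = 1 - 2 c t + t\<^sup>2\<close>; hence \<open>f R\<close> is constant.\<close>

lemma legendre_generating_function:
  assumes c: "\<bar>c\<bar> \<le> 1" and t: "\<bar>t\<bar> < 1"
  shows "(\<Sum>n. poly (legendre_poly n) c * t ^ n) = 1 / legendre_radius c t"
proof -
  define P where "P = (\<lambda>n. poly (legendre_poly n) c)"
  have P1: "\<bar>P n\<bar> \<le> 1" for n unfolding P_def by (rule abs_legendre_le_1[OF c])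
  define f where "f = (\<lambda>t. \<Sum>n. P n * t ^ n)"
  define f' where "f' = (\<lambda>t. \<Sum>n. diffs P n * t ^ n)"
  have df: "(f has_real_derivative f' s) (at s)" if "\<bar>s\<bar> < 1" for s
    unfolding f_def f'_def by (rule power_series_deriv(1)[OF P1 that])
  have ode: "(1 - 2 * c * s + s\<^sup>2) * f' s = (c - s) * f s" if s: "\<bar>s\<bar> < 1" for s
  proof -
    have sP: "(\<lambda>n. P n * s ^ n) sums f s"
      unfolding f_def using summable_bounded_power[OF P1 s] by (rule summable_sums)
    have sD: "(\<lambda>n. diffs P n * s ^ n) sums f' s"
      unfolding f'_def using power_series_deriv(2)[OF P1 s] by (rule summable_sums)
    have sP1: "(\<lambda>n. P (Suc n) * s ^ Suc n) sums (f s - 1)"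
      using sums_Suc_iff[of "\<lambda>n. P n * s ^ n" "f s - 1"] sP by (simp add: P_def legendre_0)
    have sD1: "(\<lambda>n. diffs P (Suc n) * s ^ Suc n) sums (f' s - c)"
      using sums_Suc_iff[of "\<lambda>n. diffs P n * s ^ n" "f' s - c"] sD by (simp add: diffs_def P_def legendre_1)
    have sD0: "(\<lambda>n. s * (diffs P n * s ^ n)) sums (s * f' s)" by (rule sums_mult[OF sD])
    have e0: "(\<lambda>n. real n * P n * s ^ n) sums (s * f' s)"
      using sums_Suc_iff[of "\<lambda>n. real n * P n * s ^ n" "s * f' s"] sD0
      by (simp add: diffs_def algebra_simps)
    have lhs: "(\<lambda>n. diffs P (Suc n) * s ^ Suc n) sums
       (c * (2 * (s * f' s) + (f s - 1)) - s * (s * f' s + f s))"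
    proof -
      have "(\<lambda>n. c * (2 * (s * (diffs P n * s ^ n)) + P (Suc n) * s ^ Suc n) - s * (real n * P n * s ^ n + P n * s ^ n))
        sums (c * (2 * (s * f' s) + (f s - 1)) - s * (s * f' s + f s))"
        by (intro sums_diff sums_mult sums_add sD0 sP1 e0 sP)
      also have "(\<lambda>n. c * (2 * (s * (diffs P n * s ^ n)) + P (Suc n) * s ^ Suc n) - s * (real n * P n * s ^ n + P n * s ^ n))
        = (\<lambda>n. diffs P (Suc n) * s ^ Suc n)"
      proof
        fix n
        have "diffs P (Suc n) * s ^ Suc n = ((2 * real n + 3) * c * P (Suc n) - (real n + 1) * P n) * s ^ Suc n"
        proof -
          have "diffs P (Suc n) = (real n + 2) * P (Suc (Suc n))" by (simp add: diffs_def)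
          then show ?thesis using legendre_recurrence[OF c, of n] by (simp add: P_def)
        qed
        then show "c * (2 * (s * (diffs P n * s ^ n)) + P (Suc n) * s ^ Suc n) - s * (real n * P n * s ^ n + P n * s ^ n)
            = diffs P (Suc n) * s ^ Suc n"
          by (simp add: diffs_def algebra_simps)
      qed
      finally show ?thesis .
    qed
    from sums_unique2[OF sD1 lhs] show ?thesis by (simp add: algebra_simps power2_eq_square)
  qed
  have "(\<lambda>t. f t * legendre_radius c t) t = (\<lambda>t. f t * legendre_radius c t) 0"
  proof (rule constant_on_unit_interval[OF _ t])
    fix s :: real assume s: "\<bar>s\<bar> < 1"
    let ?R = "legendre_radius c s"
    have R: "?R > 0" "?R * ?R = 1 - 2 * c * s + s\<^sup>2"
      using legendre_radius_pos[OF c s] by (auto simp: legendre_radius_def)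
    have "f' s * ?R + (s - c) / ?R * f s = 0"
    proof -
      have "(f' s * ?R + (s - c) / ?R * f s) * ?R = f' s * (?R * ?R) + (s - c) * f s"
        using R(1) by (simp add: field_simps)
      also have "\<dots> = 0" unfolding R(2) using ode[OF s] by (simp add: algebra_simps)
      finally show ?thesis using R(1) by simp
    qed
    then show "((\<lambda>t. f t * legendre_radius c t) has_real_derivative 0) (at s)"
      using DERIV_mult[OF df[OF s] legendre_radius_deriv[OF c s]] by (simp add: mult.commute)
  qed
  also have "f 0 * legendre_radius c 0 = 1"
    by (simp add: f_def legendre_radius_def P_def powser_zero legendre_0)
  finally show ?thesis
    using legendre_radius_pos(2)[OF c t] by (simp add: f_def P_def field_simps)
qed

text \<open>This series and the next one are the two parts of the Green function in the partial fractions of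
  \<open>1 / (l (l + 1))\<close>.  Both are logarithms, since their derivatives are algebraic in the generating function.\<close>

definition legendre_U :: "real \<Rightarrow> real \<Rightarrow> real" where
  "legendre_U c t = (\<Sum>n. poly (legendre_poly (Suc n)) c * t ^ Suc n / real (Suc n))"

definition legendre_V :: "real \<Rightarrow> real \<Rightarrow> real" where
  "legendre_V c t = (\<Sum>n. poly (legendre_poly n) c * t ^ Suc n / real (Suc n))"

text \<open>Both sides vanish at \<open>t = 0\<close> and have derivative \<open>1 / R\<close>.\<close>

lemma legendre_V_closed_form:
  assumes c: "- 1 \<le> c" "c < 1" and t: "\<bar>t\<bar> < 1"
  shows "legendre_V c t = ln (t - c + legendre_radius c t) - ln (1 - c)"
    and "t - c + legendre_radius c t > 0"
proof -
  have c': "\<bar>c\<bar> \<le> 1" using c by auto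
  have pos: "s - c + legendre_radius c s > 0" if "\<bar>s\<bar> < 1" for s
  proof -
    have "\<bar>s - c\<bar> < legendre_radius c s \<or> (c = - 1)"
    proof (cases "c = -1")
      case False
      have "c\<^sup>2 < 1" using c False by (auto simp: abs_square_less_1)
      then have "(s - c)\<^sup>2 < 1 - 2 * c * s + s\<^sup>2" by (simp add: power2_eq_square algebra_simps)
      then show ?thesis by (metis real_less_rsqrt legendre_radius_def power2_abs)
    qed auto
    moreover have "s - c + legendre_radius c s > 0" if "c = -1"
      using legendre_radius_pos(2)[OF c' \<open>\<bar>s\<bar> < 1\<close>] that \<open>\<bar>s\<bar> < 1\<close> by auto
    ultimately show ?thesis by auto
  qed
  then show "t - c + legendre_radius c t > 0" using t .
  let ?F = "\<lambda>t. ln (t - c + legendre_radius c t)"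
  have "(\<lambda>t. legendre_V c t - ?F t) t = (\<lambda>t. legendre_V c t - ?F t) 0"
  proof (rule constant_on_unit_interval[OF _ t])
    fix s :: real assume s: "\<bar>s\<bar> < 1"
    let ?R = "legendre_radius c s"
    have R: "?R > 0" by (rule legendre_radius_pos(2)[OF c' s])
    have "(?F has_real_derivative (1 + (s - c) / ?R) / (s - c + ?R)) (at s)"
      using pos[OF s] by (auto intro!: derivative_eq_intros legendre_radius_deriv[OF c' s])
    moreover have "(1 + (s - c) / ?R) / (s - c + ?R) = 1 / ?R"
      using R pos[OF s] by (simp add: divide_simps)
    moreover have "(legendre_V c has_real_derivative 1 / ?R) (at s)"
      using power_series_integral(1)[of "\<lambda>n. poly (legendre_poly n) c", OF abs_legendre_le_1[OF c'] s]
      unfolding legendre_V_def[abs_def] legendre_generating_function[OF c' s] .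
    ultimately show "((\<lambda>t. legendre_V c t - ?F t) has_real_derivative 0) (at s)"
      using DERIV_diff by fastforce
  qed
  also have "legendre_V c 0 = 0" by (simp add: legendre_V_def)
  finally show "legendre_V c t = ln (t - c + legendre_radius c t) - ln (1 - c)"
    by (simp add: legendre_radius_def)
qed

text \<open>Both sides vanish at \<open>t = 0\<close> and have derivative \<open>(1 / R - 1) / t\<close>, continuously
  extended to \<open>t = 0\<close>.\<close>

lemma legendre_U_closed_form:
  assumes c: "\<bar>c\<bar> \<le> 1" and t: "\<bar>t\<bar> < 1"
  shows "legendre_U c t = ln 2 - ln (1 - c * t + legendre_radius c t)"
    and "1 - c * t > 0"
proof -
  have ct: "1 - c * s > 0" if "\<bar>s\<bar> < 1" for s
  proof -
    have "\<bar>c * s\<bar> \<le> 1 * \<bar>s\<bar>" unfolding abs_mult using c by (intro mult_right_mono) auto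
    then show ?thesis using that by linarith
  qed
  then show "1 - c * t > 0" using t .
  have pos: "1 - c * s + legendre_radius c s > 0" if "\<bar>s\<bar> < 1" for s
    using ct[OF that] legendre_radius_pos(2)[OF c that] by linarith
  let ?F = "\<lambda>t. ln (1 - c * t + legendre_radius c t)"
  have "(\<lambda>t. legendre_U c t + ?F t) t = (\<lambda>t. legendre_U c t + ?F t) 0"
  proof (rule constant_on_unit_interval[OF _ t])
    fix s :: real assume s: "\<bar>s\<bar> < 1"
    let ?R = "legendre_radius c s"
    have R: "?R > 0" "?R * ?R = 1 - 2 * c * s + s\<^sup>2"
      using legendre_radius_pos[OF c s] by (auto simp: legendre_radius_def)
    define h where "h = (\<Sum>n. poly (legendre_poly (Suc n)) c * s ^ n)"
    have dU: "(legendre_U c has_real_derivative h) (at s)"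
      using power_series_integral(1)[of "\<lambda>n. poly (legendre_poly (Suc n)) c", OF abs_legendre_le_1[OF c] s]
      unfolding legendre_U_def[abs_def] h_def .
    have dF: "(?F has_real_derivative (- c + (s - c) / ?R) / (1 - c * s + ?R)) (at s)"
      using pos[OF s] by (auto intro!: derivative_eq_intros legendre_radius_deriv[OF c s])
    have "h = - ((- c + (s - c) / ?R) / (1 - c * s + ?R))"
    proof (cases "s = 0")
      case True
      have "h = c" unfolding h_def True by (simp add: powser_zero legendre_1)
      then show ?thesis by (simp add: True legendre_radius_def)
    next
      case False
      have "summable (\<lambda>n. poly (legendre_poly n) c * s ^ n)"
        by (rule summable_bounded_power[OF abs_legendre_le_1[OF c] s])
      from suminf_split_head[OF this]
      have "(\<Sum>n. poly (legendre_poly (Suc n)) c * s ^ Suc n) = 1 / ?R - 1"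
        unfolding legendre_generating_function[OF c s] by (simp add: legendre_0)
      also have "(\<Sum>n. poly (legendre_poly (Suc n)) c * s ^ Suc n) = (\<Sum>n. s * (poly (legendre_poly (Suc n)) c * s ^ n))"
        by (simp add: mult_ac)
      also have "\<dots> = s * h"
        unfolding h_def by (rule suminf_mult[OF summable_bounded_power[OF abs_legendre_le_1[OF c] s]])
      finally have h: "s * h = 1 / ?R - 1" .
      have "s * (c * ?R - (s - c)) = (1 - ?R) * (1 - c * s + ?R)"
        using R(2) by (simp add: algebra_simps power2_eq_square)
      then have "s * ((c * ?R - (s - c)) / (?R * (1 - c * s + ?R))) = (1 - ?R) / ?R"
        using R(1) pos[OF s] by simp
      also have "(1 - ?R) / ?R = s * h" using R(1) h by (simp add: field_simps)
      finally have "h = (c * ?R - (s - c)) / (?R * (1 - c * s + ?R))"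
        using False by (metis mult_left_cancel)
      also have "\<dots> = - ((- c + (s - c) / ?R) / (1 - c * s + ?R))"
        using R(1) pos[OF s] by (simp add: divide_simps)
      finally show ?thesis .
    qed
    then show "((\<lambda>t. legendre_U c t + ?F t) has_real_derivative 0) (at s)"
      using DERIV_add[OF dU dF] by simp
  qed
  also have "legendre_U c 0 = 0" by (simp add: legendre_U_def)
  finally show "legendre_U c t = ln 2 - ln (1 - c * t + legendre_radius c t)"
    by (simp add: legendre_radius_def)
qed

text \<open>The regularised Green function summed over all \<open>l \<ge> 1\<close>.  Its coefficients
  \<open>(2 l + 1) / (2 l (l + 1)) = (1 / l + 1 / (l + 1)) / 2\<close> split it into the two series above; the
  \<open>-1\<close> removes the term \<open>l = 0\<close> of the second.\<close>

definition green_lam :: "real \<Rightarrow> real \<Rightarrow> real" where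
  "green_lam lam c = (legendre_U c lam + legendre_V c lam / lam - 1) / 2"

lemma reg_green_zonal:
  fixes x y :: "real^3"
  assumes "x \<in> sphere 0 1" "y \<in> sphere 0 1"
  shows "reg_green lam L x y
    = (\<Sum>n<L. lam ^ Suc n * ((1 / real (Suc n) + 1 / real (Suc (Suc n))) / 2) * poly (legendre_poly (Suc n)) (x \<bullet> y))"
proof -
  have "reg_green lam L x y = (\<Sum>l=1..L. lam ^ l * (2 * pi / (real l * (real l + 1)))
      * (\<Sum>m=-int l..int l. sph_harm l m x * sph_harm l m y))"
    unfolding reg_green_def by (simp add: sum_distrib_left mult.assoc)
  also have "\<dots> = (\<Sum>l=1..L. lam ^ l * (2 * pi / (real l * (real l + 1)))
      * ((2 * real l + 1) / (4 * pi) * poly (legendre_poly l) (x \<bullet> y)))"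
    unfolding sph_harm_addition[OF assms] ..
  also have "\<dots> = (\<Sum>l=1..L. lam ^ l * ((1 / real l + 1 / (real l + 1)) / 2) * poly (legendre_poly l) (x \<bullet> y))"
  proof (intro sum.cong refl)
    fix l assume "l \<in> {1..L}"
    then have "2 * pi / (real l * (real l + 1)) * ((2 * real l + 1) / (4 * pi)) = (1 / real l + 1 / (real l + 1)) / 2"
      by (simp add: divide_simps) (simp add: algebra_simps)
    then show "lam ^ l * (2 * pi / (real l * (real l + 1))) * ((2 * real l + 1) / (4 * pi) * poly (legendre_poly l) (x \<bullet> y))
        = lam ^ l * ((1 / real l + 1 / (real l + 1)) / 2) * poly (legendre_poly l) (x \<bullet> y)"
      by (metis mult.assoc)
  qed
  also have "\<dots> = (\<Sum>n<L. lam ^ Suc n * ((1 / real (Suc n) + 1 / real (Suc (Suc n))) / 2) * poly (legendre_poly (Suc n)) (x \<bullet> y))"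
    by (simp add: sum.atLeast1_atMost_eq add.commute)
  finally show ?thesis .
qed

lemma abs_inner_sphere_le_1:
  fixes x y :: "'a::real_inner"
  assumes "x \<in> sphere 0 1" "y \<in> sphere 0 1"
  shows "\<bar>x \<bullet> y\<bar> \<le> 1"
  using Cauchy_Schwarz_ineq2[of x y] assms by simp

lemma abs_reg_green_le:
  fixes x y :: "real^3"
  assumes xy: "x \<in> sphere 0 1" "y \<in> sphere 0 1" and lam: "0 < lam" "lam < 1"
  shows "\<bar>reg_green lam L x y\<bar> \<le> 1 / (1 - lam)"
proof -
  have "\<bar>reg_green lam L x y\<bar> \<le> (\<Sum>n<L. lam ^ n)"
    unfolding reg_green_zonal[OF xy]
  proof (rule order.trans[OF sum_abs sum_mono])
    fix n
    have "1 / real (Suc n) \<le> 1" "1 / real (Suc (Suc n)) \<le> 1" by simp_all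
    moreover have "(p + q) / 2 \<le> 1" if "p \<le> 1" "q \<le> 1" for p q :: real using that by simp
    ultimately have "(1 / real (Suc n) + 1 / real (Suc (Suc n))) / 2 \<le> 1" by blast
    moreover have "\<bar>poly (legendre_poly (Suc n)) (x \<bullet> y)\<bar> \<le> 1"
      by (rule abs_legendre_le_1[OF abs_inner_sphere_le_1[OF xy]])
    ultimately have "(1 / real (Suc n) + 1 / real (Suc (Suc n))) / 2 * \<bar>poly (legendre_poly (Suc n)) (x \<bullet> y)\<bar> \<le> 1 * 1"
      by (intro mult_mono) auto
    then have "lam ^ Suc n * ((1 / real (Suc n) + 1 / real (Suc (Suc n))) / 2 * \<bar>poly (legendre_poly (Suc n)) (x \<bullet> y)\<bar>) \<le> lam ^ Suc n * 1"
      using lam by (intro mult_left_mono) auto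
    also have "\<dots> \<le> lam ^ n" using lam by (simp add: mult_left_le_one_le)
    finally show "\<bar>lam ^ Suc n * ((1 / real (Suc n) + 1 / real (Suc (Suc n))) / 2) * poly (legendre_poly (Suc n)) (x \<bullet> y)\<bar> \<le> lam ^ n"
      using lam by (simp add: abs_mult mult.assoc)
  qed
  also have "\<dots> = (1 - lam ^ L) / (1 - lam)" using lam by (simp add: sum_gp_strict)
  also have "\<dots> \<le> 1 / (1 - lam)" using lam by (intro divide_right_mono) auto
  finally show ?thesis .
qed

lemma reg_green_tendsto:
  fixes x y :: "real^3"
  assumes xy: "x \<in> sphere 0 1" "y \<in> sphere 0 1" and lam: "0 < lam" "lam < 1"
  shows "(\<lambda>L. reg_green lam L x y) \<longlonglongrightarrow> green_lam lam (x \<bullet> y)"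
proof -
  define c where "c = x \<bullet> y"
  have c: "\<bar>c\<bar> \<le> 1" unfolding c_def by (rule abs_inner_sphere_le_1[OF xy])
  have l: "\<bar>lam\<bar> < 1" using lam by simp
  have U: "(\<lambda>n. poly (legendre_poly (Suc n)) c * lam ^ Suc n / real (Suc n)) sums legendre_U c lam"
    unfolding legendre_U_def using abs_legendre_le_1[OF c]
    by (intro summable_sums power_series_integral(2)[of "\<lambda>n. poly (legendre_poly (Suc n)) c", OF _ l])
  have "(\<lambda>n. poly (legendre_poly n) c * lam ^ Suc n / real (Suc n)) sums legendre_V c lam"
    unfolding legendre_V_def using abs_legendre_le_1[OF c]
    by (intro summable_sums power_series_integral(2)[of "\<lambda>n. poly (legendre_poly n) c", OF _ l])
  then have V: "(\<lambda>n. poly (legendre_poly (Suc n)) c * lam ^ Suc (Suc n) / real (Suc (Suc n))) sums (legendre_V c lam - lam)"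
    by (subst sums_Suc_iff) (simp add: legendre_0)
  have "(\<lambda>n. 1 / 2 * (poly (legendre_poly (Suc n)) c * lam ^ Suc n / real (Suc n))
      + 1 / (2 * lam) * (poly (legendre_poly (Suc n)) c * lam ^ Suc (Suc n) / real (Suc (Suc n))))
      sums (1 / 2 * legendre_U c lam + 1 / (2 * lam) * (legendre_V c lam - lam))"
    by (intro sums_add sums_mult U V)
  also have "1 / 2 * legendre_U c lam + 1 / (2 * lam) * (legendre_V c lam - lam) = green_lam lam c"
    using lam by (simp add: green_lam_def field_simps)
  also have "(\<lambda>n. 1 / 2 * (poly (legendre_poly (Suc n)) c * lam ^ Suc n / real (Suc n))
      + 1 / (2 * lam) * (poly (legendre_poly (Suc n)) c * lam ^ Suc (Suc n) / real (Suc (Suc n))))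
     = (\<lambda>n. lam ^ Suc n * ((1 / real (Suc n) + 1 / real (Suc (Suc n))) / 2) * poly (legendre_poly (Suc n)) c)"
  proof
    fix n
    have "1 / 2 * (p * L / A) + 1 / (2 * lam) * (p * (lam * L) / B) = L * ((1 / A + 1 / B) / 2) * p" for p L A B
      using lam by (simp add: add_divide_distrib algebra_simps)
    then show "1 / 2 * (poly (legendre_poly (Suc n)) c * lam ^ Suc n / real (Suc n))
      + 1 / (2 * lam) * (poly (legendre_poly (Suc n)) c * lam ^ Suc (Suc n) / real (Suc (Suc n)))
      = lam ^ Suc n * ((1 / real (Suc n) + 1 / real (Suc (Suc n))) / 2) * poly (legendre_poly (Suc n)) c"
      unfolding power_Suc[of lam "Suc n"] .
  qed
  finally show ?thesis
    unfolding reg_green_zonal[OF xy] c_def sums_def .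
qed

lemma legendre_radius_ge:
  assumes "c \<le> 1" "0 \<le> t" "t < 1"
  shows "1 - t \<le> legendre_radius c t"
proof -
  have "t * c \<le> t" using assms by (simp add: mult_left_le)
  then have "(1 - t)\<^sup>2 \<le> (1 - t)\<^sup>2 + 2 * (t - t * c)" by simp
  also have "\<dots> = 1 - 2 * c * t + t\<^sup>2"
    by (simp add: power2_eq_square algebra_simps)
  finally have "(1 - t)\<^sup>2 \<le> 1 - 2 * c * t + t\<^sup>2" .
  then show ?thesis unfolding legendre_radius_def by (rule real_le_rsqrt)
qed

text \<open>A bound that is uniform in \<open>lam\<close>: the first series is at least \<open>- ln 2\<close> and the second one is
  non-negative.  The closed form of the second degenerates at \<open>c = 1\<close>, where
  all terms of both series are non-negative.\<close>

lemma green_lam_lower: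
  assumes c: "\<bar>c\<bar> \<le> 1" and lam: "0 < lam" "lam < 1"
  shows "green_lam lam c \<ge> - 1"
proof (cases "c = 1")
  case True
  have l: "\<bar>lam\<bar> < 1" using lam by simp
  have "legendre_U c lam \<ge> 0"
    unfolding legendre_U_def True legendre_at_1 using lam
    using power_series_integral(2)[of "\<lambda>n. 1", OF _ l] by (intro suminf_nonneg) auto
  moreover have "legendre_V c lam \<ge> 0"
    unfolding legendre_V_def True legendre_at_1 using lam
    using power_series_integral(2)[of "\<lambda>n. 1", OF _ l] by (intro suminf_nonneg) auto
  ultimately show ?thesis using lam by (simp add: green_lam_def)
next
  case False
  then have c1: "- 1 \<le> c" "c < 1" using c by auto
  have l: "\<bar>lam\<bar> < 1" using lam by simp
  have "1 - 2 * c * lam + lam\<^sup>2 \<le> 4"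
  proof -
    have "\<bar>c * lam\<bar> \<le> 1 * 1" unfolding abs_mult using c lam by (intro mult_mono) auto
    moreover have "lam\<^sup>2 \<le> 1" using lam by (simp add: abs_square_le_1)
    ultimately show ?thesis by (auto simp: abs_le_iff)
  qed
  then have R2: "legendre_radius c lam \<le> 2" unfolding legendre_radius_def by (intro real_le_lsqrt) auto
  have "\<bar>c * lam\<bar> \<le> 1 * 1" unfolding abs_mult using c lam by (intro mult_mono) auto
  then have "1 - c * lam + legendre_radius c lam \<le> 4" using R2 by linarith
  moreover have "1 - c * lam + legendre_radius c lam > 0"
    using legendre_U_closed_form(2)[OF c l] legendre_radius_pos(2)[OF c l] by simp
  ultimately have "ln (1 - c * lam + legendre_radius c lam) \<le> ln 4" by simp
  then have U: "legendre_U c lam \<ge> ln 2 - ln 4" using legendre_U_closed_form(1)[OF c l] by simp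
  have "ln (4::real) = 2 * ln 2" using ln_realpow[of 2 2] by simp
  moreover have "ln (2::real) \<le> 1" using ln_add_one_self_le_self[of 1] by simp
  ultimately have U1: "legendre_U c lam \<ge> - 1" using U by simp
  have "1 - c \<le> lam - c + legendre_radius c lam"
    using legendre_radius_ge[of c lam] c1 lam by simp
  then have "ln (1 - c) \<le> ln (lam - c + legendre_radius c lam)" using c1 by simp
  then have "legendre_V c lam \<ge> 0" using legendre_V_closed_form(1)[OF c1 l] by simp
  then have "legendre_V c lam / lam \<ge> 0" using lam by simp
  then show ?thesis using U1 by (simp add: green_lam_def)
qed

text \<open>A bound that is uniform in \<open>lam\<close> and has the singularity of the limit.  Each of the two series
  contributes half of the logarithm, because \<open>R \<ge> sqrt (1 - c)\<close> in the first and
  \<open>lam - c + R \<le> 6 sqrt (1 - c)\<close> in the second.\<close>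

lemma green_lam_upper:
  assumes c: "- 1 \<le> c" "c < 1" and lam: "1 / 2 \<le> lam" "lam < 1"
  shows "green_lam lam c \<le> (ln 12 - ln (1 - c)) / 2"
proof -
  have c': "\<bar>c\<bar> \<le> 1" and l: "\<bar>lam\<bar> < 1" using c lam by auto
  define R where "R = legendre_radius c lam"
  define s where "s = sqrt (1 - c)"
  have s: "s > 0" "s\<^sup>2 = 1 - c" using c by (auto simp: s_def)
  have lns: "ln s = ln (1 - c) / 2" using c by (simp add: s_def ln_sqrt)
  have R: "R > 0" "R\<^sup>2 = 1 - 2 * c * lam + lam\<^sup>2"
    using legendre_radius_pos[OF c' l] by (auto simp: R_def legendre_radius_def)
  have "s \<le> R"
  proof (rule power2_le_imp_le)
    have "R\<^sup>2 = (1 - lam)\<^sup>2 + 2 * lam * (1 - c)" unfolding R(2) by (simp add: power2_eq_square algebra_simps)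
    moreover have "2 * lam * (1 - c) \<ge> 1 * (1 - c)" using c lam by (intro mult_right_mono) auto
    moreover have "2 * lam * (1 - c) \<le> (1 - lam)\<^sup>2 + 2 * lam * (1 - c)" by simp
    ultimately show "s\<^sup>2 \<le> R\<^sup>2" unfolding s(2) by (metis mult_1 order.trans)
  qed (use R in simp)
  then have "s \<le> 1 - c * lam + R" using legendre_U_closed_form(2)[OF c' l] by simp
  then have "ln s \<le> ln (1 - c * lam + R)" using s by simp
  then have U: "legendre_U c lam \<le> ln 2 - ln (1 - c) / 2"
    using legendre_U_closed_form(1)[OF c' l] lns by (simp add: R_def)
  have "R \<le> \<bar>lam - c\<bar> + 2 * s"
  proof (rule power2_le_imp_le)
    have "R\<^sup>2 = (lam - c)\<^sup>2 + (1 + c) * s\<^sup>2" unfolding R(2) s(2) by (simp add: power2_eq_square algebra_simps)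
    also have "\<dots> \<le> (lam - c)\<^sup>2 + 4 * s\<^sup>2" using c by (intro add_left_mono mult_right_mono) auto
    also have "\<dots> \<le> (\<bar>lam - c\<bar> + 2 * s)\<^sup>2" using s(1) by (simp add: power2_sum)
    finally show "R\<^sup>2 \<le> (\<bar>lam - c\<bar> + 2 * s)\<^sup>2" .
  qed (use s in simp)
  moreover have "max (lam - c) 0 \<le> 2 * s"
  proof -
    have "s \<le> 2" unfolding s_def using c by (intro real_le_lsqrt) auto
    then have "s * s \<le> 2 * s" using s(1) by simp
    moreover have "s * s = 1 - c" using s(2) by (simp add: power2_eq_square)
    ultimately have "lam - c \<le> 2 * s" using lam by linarith
    then show ?thesis using s by simp
  qed
  ultimately have "lam - c + R \<le> 6 * s" by linarith
  then have "ln (lam - c + R) \<le> ln (6 * s)"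
    using legendre_V_closed_form(2)[OF c l] by (simp add: R_def)
  also have "\<dots> = ln 6 + ln s" using s by (simp add: ln_mult)
  finally have V: "legendre_V c lam \<le> ln 6 - ln (1 - c) / 2"
    using legendre_V_closed_form(1)[OF c l] lns by (simp add: R_def)
  \<comment> \<open>dividing by \<open>lam\<close> increases the second series by at most \<open>1\<close>, uniformly as \<open>lam\<close> tends to \<open>1\<close>\<close>
  have "legendre_V c lam \<le> lam / (1 - lam)"
  proof -
    have "legendre_V c lam \<le> (\<Sum>n. lam * lam ^ n)"
      unfolding legendre_V_def
    proof (rule suminf_le)
      fix n
      have "poly (legendre_poly n) c * lam ^ Suc n / real (Suc n) \<le> 1 * lam ^ Suc n / 1"
        using abs_legendre_le_1[OF c', of n] lam by (intro frac_le mult_right_mono mult_nonneg_nonneg) auto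
      then show "poly (legendre_poly n) c * lam ^ Suc n / real (Suc n) \<le> lam * lam ^ n" by simp
    next
      show "summable (\<lambda>n. poly (legendre_poly n) c * lam ^ Suc n / real (Suc n))"
        using abs_legendre_le_1[OF c'] by (intro power_series_integral(2) l)
      show "summable (\<lambda>n. lam * lam ^ n)" using l by (intro summable_mult summable_geometric) auto
    qed
    also have "\<dots> = lam / (1 - lam)"
      using l by (subst suminf_mult) (auto simp: suminf_geometric intro: summable_geometric)
    finally show ?thesis .
  qed
  then have "legendre_V c lam * (1 - lam) / lam \<le> 1" using lam by (simp add: field_simps)
  moreover have "legendre_V c lam / lam = legendre_V c lam + legendre_V c lam * (1 - lam) / lam"
    using lam by (simp add: field_simps)
  ultimately have "legendre_V c lam / lam \<le> legendre_V c lam + 1" by linarith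
  moreover have "ln (12::real) = ln 2 + ln 6" using ln_mult[of 2 6] by simp
  moreover have "(u + q - 1) / 2 \<le> (ln 12 - L) / 2"
    if "q \<le> v + 1" "u \<le> ln 2 - L / 2" "v \<le> ln 6 - L / 2" "ln (12::real) = ln 2 + ln 6" for u v q L :: real
    using that by simp
  ultimately show ?thesis using U V unfolding green_lam_def by blast
qed

lemma green_lam_tendsto:
  assumes c: "- 1 \<le> c" "c < 1"
  shows "((\<lambda>lam. green_lam lam c) \<longlongrightarrow> (ln 2 - ln (1 - c) - 1) / 2) (at_left 1)"
proof -
  have c': "\<bar>c\<bar> \<le> 1" using c by auto
  define s where "s = sqrt (1 - 2 * c * 1 + 1\<^sup>2)"
  have s: "s \<ge> 0" using c by (simp add: s_def)
  have R: "((\<lambda>lam. legendre_radius c lam) \<longlongrightarrow> s) (at_left 1)"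
    unfolding legendre_radius_def s_def by (intro tendsto_intros)
  have "((\<lambda>lam. ((ln 2 - ln (1 - c * lam + legendre_radius c lam))
      + (ln (lam - c + legendre_radius c lam) - ln (1 - c)) / lam - 1) / 2)
      \<longlongrightarrow> ((ln 2 - ln (1 - c * 1 + s)) + (ln (1 - c + s) - ln (1 - c)) / 1 - 1) / 2) (at_left 1)"
    using s c by (intro tendsto_intros R) auto
  moreover have "eventually (\<lambda>lam. ((ln 2 - ln (1 - c * lam + legendre_radius c lam))
      + (ln (lam - c + legendre_radius c lam) - ln (1 - c)) / lam - 1) / 2 = green_lam lam c) (at_left 1)"
  proof -
    have "eventually (\<lambda>lam. lam \<in> {0<..<1}) (at_left (1::real))"
      by (rule eventually_at_leftI[of 0]) auto
    then show ?thesis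
    proof eventually_elim
      case (elim lam)
      then show ?case
        using legendre_U_closed_form(1)[OF c', of lam] legendre_V_closed_form(1)[OF c, of lam]
        by (simp add: green_lam_def)
    qed
  qed
  ultimately have "((\<lambda>lam. green_lam lam c) \<longlongrightarrow> ((ln 2 - ln (1 - c * 1 + s)) + (ln (1 - c + s) - ln (1 - c)) / 1 - 1) / 2) (at_left 1)"
    by (rule Lim_transform_eventually)
  then show ?thesis by simp
qed

section \<open>The regularised correlation function as a series of Coulomb integrals\<close>

lemma sum_pairs:
  fixes f :: "nat \<Rightarrow> nat \<Rightarrow> 'a::comm_semiring_1"
  assumes "\<And>i j. f i j = f j i"
  shows "(\<Sum>i=1..k. \<Sum>j=1..k. f i j) = (\<Sum>i=1..k. f i i) + 2 * (\<Sum>i=1..k. \<Sum>j\<in>{i<..k}. f i j)"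
proof (induction k)
  case (Suc k)
  have "(\<Sum>i=1..Suc k. \<Sum>j=1..Suc k. f i j)
      = (\<Sum>i=1..k. \<Sum>j=1..k. f i j) + 2 * (\<Sum>i=1..k. f i (Suc k)) + f (Suc k) (Suc k)"
  proof -
    have "(\<Sum>j=1..k. f (Suc k) j) = (\<Sum>j=1..k. f j (Suc k))"
      by (intro sum.cong refl assms)
    then show ?thesis by (simp add: sum.distrib mult_2 add_ac)
  qed
  moreover have "(\<Sum>i=1..k. \<Sum>j\<in>{i<..Suc k}. f i j) = (\<Sum>i=1..k. (\<Sum>j\<in>{i<..k}. f i j) + f i (Suc k))"
  proof (intro sum.cong refl)
    fix i assume "i \<in> {1..k}"
    then have "{i<..Suc k} = insert (Suc k) {i<..k}" by auto
    then show "(\<Sum>j\<in>{i<..Suc k}. f i j) = (\<Sum>j\<in>{i<..k}. f i j) + f i (Suc k)" by (simp add: add.commute)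
  qed
  ultimately show ?case using Suc by (simp add: sum.distrib algebra_simps)
qed simp

text \<open>The coefficient of \<open>X\<^sub>l\<^sub>m\<close> in the field at \<open>x\<close>.  It is zero for \<open>l = 0\<close>, where the field has no term,
  so that field and zero mode are linear forms in one family of variables.\<close>

definition mode_coeff :: "real \<Rightarrow> nat \<times> int \<Rightarrow> real^3 \<Rightarrow> real" where
  "mode_coeff lam i x = (if fst i = 0 then 0
     else lam powr (real (fst i) / 2) * sqrt (2 * pi / (real (fst i) * (real (fst i) + 1))) * sph_harm (fst i) (snd i) x)"

lemma mode_set_eq_Sigma: "mode_set L = Sigma {..L} (\<lambda>l. {- int l..int l})"
  by (auto simp: mode_set_def)

lemma finite_mode_set: "finite (mode_set L)"
  unfolding mode_set_eq_Sigma by auto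

lemma zero_in_mode_set: "(0, 0) \<in> mode_set L"
  by (simp add: mode_set_def)

lemma sum_mode_set:
  fixes f :: "nat \<times> int \<Rightarrow> 'a::comm_monoid_add"
  shows "(\<Sum>i\<in>mode_set L. f i) = f (0, 0) + (\<Sum>l=1..L. \<Sum>m=-int l..int l. f (l, m))"
proof -
  have "(\<Sum>i\<in>mode_set L. f i) = (\<Sum>l\<in>{..L}. \<Sum>m=-int l..int l. f (l, m))"
    unfolding mode_set_eq_Sigma by (subst sum.Sigma) auto
  also have "{..L} = insert 0 {1..L}" by auto
  finally show ?thesis by simp
qed

lemma reg_field_eq_sum_modes: "reg_field lam L X x = (\<Sum>i\<in>mode_set L. mode_coeff lam i x * X i)"
proof -
  have "lam powr (real l / 2) * sqrt (2 * pi / (real l * (real l + 1))) * X (l, m) * sph_harm l m x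
      = mode_coeff lam (l, m) x * X (l, m)" if "l \<in> {1..L}" for l m
    using that by (simp add: mode_coeff_def)
  then have "reg_field lam L X x = (\<Sum>l=1..L. \<Sum>m=-int l..int l. mode_coeff lam (l, m) x * X (l, m))"
    unfolding reg_field_def by (intro sum.cong refl)
  also have "\<dots> = (\<Sum>i\<in>mode_set L. mode_coeff lam i x * X i)"
    unfolding sum_mode_set by (simp add: mode_coeff_def)
  finally show ?thesis .
qed

lemma reg_green_eq_sum_modes:
  assumes "lam > 0"
  shows "reg_green lam L x y = (\<Sum>i\<in>mode_set L. mode_coeff lam i x * mode_coeff lam i y)"
proof -
  have *: "lam ^ l * c * p * q = (lam powr (real l / 2) * sqrt c * p) * (lam powr (real l / 2) * sqrt c * q)"
    if "c \<ge> 0" for l c p q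
  proof -
    have "lam powr (real l / 2) * lam powr (real l / 2) = lam ^ l"
      using assms by (simp add: powr_add[symmetric] powr_realpow)
    moreover have "sqrt c * sqrt c = c" using that by simp
    ultimately show ?thesis by (metis (no_types, lifting) mult.assoc mult.left_commute)
  qed
  have "lam ^ l * (2 * pi / (real l * (real l + 1))) * sph_harm l m x * sph_harm l m y
      = mode_coeff lam (l, m) x * mode_coeff lam (l, m) y" if "l \<in> {1..L}" for l m
    by (subst *) (use that in \<open>auto simp: mode_coeff_def\<close>)
  then have "reg_green lam L x y = (\<Sum>l=1..L. \<Sum>m=-int l..int l. mode_coeff lam (l, m) x * mode_coeff lam (l, m) y)"
    unfolding reg_green_def by (intro sum.cong refl) auto
  also have "\<dots> = (\<Sum>i\<in>mode_set L. mode_coeff lam i x * mode_coeff lam i y)"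
    unfolding sum_mode_set by (simp add: mode_coeff_def)
  finally show ?thesis .
qed

lemma measurable_sph_harm: "sph_harm l m \<in> borel_measurable borel"
proof -
  have "continuous_on UNIV (\<lambda>x::real^3. poly ((pderiv ^^ n) (legendre_poly l)) (x$3))" for n
    by (intro continuous_intros)
  moreover have "continuous_on UNIV (\<lambda>x::real^3. Re ((complex_of_real (x$1) + \<i> * complex_of_real (x$2)) ^ n))" for n
    by (intro continuous_intros)
  moreover have "continuous_on UNIV (\<lambda>x::real^3. Im ((complex_of_real (x$1) + \<i> * complex_of_real (x$2)) ^ n))" for n
    by (intro continuous_intros)
  ultimately have "continuous_on UNIV (sph_harm l m)"
    unfolding sph_harm_def[abs_def] Let_def
    by (cases "m = 0"; cases "m > 0"; simp; intro continuous_intros; simp)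
  then show ?thesis by (rule borel_measurable_continuous_onI)
qed

lemma measurable_mode_coeff: "mode_coeff lam i \<in> borel_measurable borel"
proof (cases "fst i = 0")
  case False
  then have "mode_coeff lam i = (\<lambda>x. lam powr (real (fst i) / 2) * sqrt (2 * pi / (real (fst i) * (real (fst i) + 1)))
      * sph_harm (fst i) (snd i) x)"
    by (simp add: mode_coeff_def fun_eq_iff)
  then show ?thesis using measurable_sph_harm[of "fst i" "snd i"] by simp
next
  case True
  then have "mode_coeff lam i = (\<lambda>x. 0)" by (simp add: mode_coeff_def fun_eq_iff)
  then show ?thesis by simp
qed

text \<open>The square of the coefficient is one of the summands of the Green function on the diagonal.\<close>

lemma abs_mode_coeff_le:
  assumes x: "x \<in> sphere 0 1" and lam: "0 < lam" "lam < 1" and i: "i \<in> mode_set L"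
  shows "\<bar>mode_coeff lam i x\<bar> \<le> sqrt (1 / (1 - lam))"
proof -
  have "(mode_coeff lam i x)\<^sup>2 \<le> (\<Sum>i\<in>mode_set L. (mode_coeff lam i x)\<^sup>2)"
    using i by (intro member_le_sum finite_mode_set) auto
  also have "\<dots> = reg_green lam L x x"
    unfolding reg_green_eq_sum_modes[OF lam(1)] by (simp add: power2_eq_square)
  also have "\<dots> \<le> 1 / (1 - lam)" using abs_reg_green_le[OF x x lam, of L] by simp
  finally show ?thesis by (intro real_le_rsqrt) simp
qed

text \<open>The negative of the interaction energy of charges \<open>\<alpha>\<^sub>j\<close> at \<open>x\<^sub>j\<close> and \<open>n\<close> charges \<open>b\<close> at \<open>y\<^sub>l\<close>, where a
  pair of charges \<open>q\<close>, \<open>q'\<close> has energy \<open>4 q q' G\<close> and no charge interacts with itself.\<close>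

definition coulomb_exponent ::
    "(real^3 \<Rightarrow> real^3 \<Rightarrow> real) \<Rightarrow> nat \<Rightarrow> nat \<Rightarrow> (nat \<Rightarrow> complex) \<Rightarrow> (nat \<Rightarrow> real^3) \<Rightarrow> real \<Rightarrow> (nat \<Rightarrow> real^3) \<Rightarrow> complex" where
  "coulomb_exponent G n k \<alpha> x b y =
     - 4 * (\<Sum>j=1..k. \<Sum>j'\<in>{j<..k}. \<alpha> j * \<alpha> j' * complex_of_real (G (x j) (x j')))
     - 4 * complex_of_real b * (\<Sum>j=1..k. \<Sum>l=1..n. \<alpha> j * complex_of_real (G (x j) (y l)))
     - complex_of_real (4 * b\<^sup>2 * (\<Sum>l=1..n. \<Sum>l'\<in>{l<..n}. G (y l) (y l')))"

abbreviation coulomb_weight ::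
    "(real^3 \<Rightarrow> real^3 \<Rightarrow> real) \<Rightarrow> nat \<Rightarrow> nat \<Rightarrow> (nat \<Rightarrow> complex) \<Rightarrow> (nat \<Rightarrow> real^3) \<Rightarrow> real \<Rightarrow> (nat \<Rightarrow> complex) \<Rightarrow> complex" where
  "coulomb_weight G n k \<alpha> x b t \<equiv> complex_of_real (\<Prod>l=1..n. sphere_metric (t l))
     * exp (coulomb_exponent G n k \<alpha> x b (\<lambda>l. stereo_inv (t l)))"

text \<open>The square of the sum over all charges is the sum over pairs plus the diagonal, and the diagonal is
  cancelled by the normal ordering terms \<open>2 \<alpha>\<^sup>2 G(x, x)\<close> and \<open>2 b\<^sup>2 G(y, y)\<close>.\<close>

lemma complete_square_exponent:
  fixes m :: "'i \<Rightarrow> real^3 \<Rightarrow> real"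
  assumes G: "\<And>x y. G x y = (\<Sum>i\<in>I. m i x * m i y)"
  shows "(\<Sum>j=1..k. 2 * (\<alpha> j)\<^sup>2 * complex_of_real (G (x j) (x j)))
      + complex_of_real (\<Sum>l=1..n. 2 * b\<^sup>2 * G (y l) (y l))
      - (\<Sum>i\<in>I. ((\<Sum>j=1..k. 2 * \<alpha> j * complex_of_real (m i (x j))) + complex_of_real (\<Sum>l=1..n. 2 * b * m i (y l)))\<^sup>2) / 2
    = coulomb_exponent G n k \<alpha> x b y"
proof -
  define a where "a = (\<lambda>i. \<Sum>j=1..k. \<alpha> j * complex_of_real (m i (x j)))"
  define e where "e = (\<lambda>i. \<Sum>l=1..n. m i (y l))"
  have sym: "G u v = G v u" for u v by (simp add: G mult.commute)
  have sq: "((\<Sum>j=1..k. 2 * \<alpha> j * complex_of_real (m i (x j))) + complex_of_real (\<Sum>l=1..n. 2 * b * m i (y l)))\<^sup>2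
      = 4 * (a i * a i) + 8 * complex_of_real b * (a i * complex_of_real (e i)) + complex_of_real (4 * b\<^sup>2 * (e i * e i))" for i
  proof -
    have "(\<Sum>j=1..k. 2 * \<alpha> j * complex_of_real (m i (x j))) = 2 * a i"
      by (simp add: a_def sum_distrib_left mult.assoc)
    moreover have "(\<Sum>l=1..n. 2 * b * m i (y l)) = 2 * b * e i"
      by (simp add: e_def sum_distrib_left)
    ultimately show ?thesis by (simp add: power2_eq_square algebra_simps)
  qed
  have aa: "(\<Sum>i\<in>I. a i * a i) = (\<Sum>j=1..k. \<Sum>j'=1..k. \<alpha> j * \<alpha> j' * complex_of_real (G (x j) (x j')))"
  proof -
    have "(\<Sum>i\<in>I. a i * a i) = (\<Sum>i\<in>I. \<Sum>j=1..k. \<Sum>j'=1..k. \<alpha> j * \<alpha> j' * complex_of_real (m i (x j) * m i (x j')))"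
      unfolding a_def sum_product by (simp add: mult_ac)
    also have "\<dots> = (\<Sum>j=1..k. \<Sum>j'=1..k. \<Sum>i\<in>I. \<alpha> j * \<alpha> j' * complex_of_real (m i (x j) * m i (x j')))"
      by (subst sum.swap, intro sum.cong refl, rule sum.swap)
    finally show ?thesis by (simp add: G sum_distrib_left)
  qed
  have ae: "(\<Sum>i\<in>I. a i * complex_of_real (e i)) = (\<Sum>j=1..k. \<Sum>l=1..n. \<alpha> j * complex_of_real (G (x j) (y l)))"
  proof -
    have "(\<Sum>i\<in>I. a i * complex_of_real (e i)) = (\<Sum>i\<in>I. \<Sum>j=1..k. \<Sum>l=1..n. \<alpha> j * complex_of_real (m i (x j) * m i (y l)))"
      unfolding a_def e_def of_real_sum sum_product by (simp add: mult_ac)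
    also have "\<dots> = (\<Sum>j=1..k. \<Sum>l=1..n. \<Sum>i\<in>I. \<alpha> j * complex_of_real (m i (x j) * m i (y l)))"
      by (subst sum.swap, intro sum.cong refl, rule sum.swap)
    finally show ?thesis by (simp add: G sum_distrib_left)
  qed
  have ee: "(\<Sum>i\<in>I. e i * e i) = (\<Sum>l=1..n. \<Sum>l'=1..n. G (y l) (y l'))"
  proof -
    have "(\<Sum>i\<in>I. e i * e i) = (\<Sum>i\<in>I. \<Sum>l=1..n. \<Sum>l'=1..n. m i (y l) * m i (y l'))"
      unfolding e_def sum_product ..
    also have "\<dots> = (\<Sum>l=1..n. \<Sum>l'=1..n. \<Sum>i\<in>I. m i (y l) * m i (y l'))"
      by (subst sum.swap, intro sum.cong refl, rule sum.swap)
    finally show ?thesis by (simp add: G)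
  qed
  have "(\<Sum>i\<in>I. ((\<Sum>j=1..k. 2 * \<alpha> j * complex_of_real (m i (x j))) + complex_of_real (\<Sum>l=1..n. 2 * b * m i (y l)))\<^sup>2)
      = 4 * (\<Sum>i\<in>I. a i * a i) + 8 * complex_of_real b * (\<Sum>i\<in>I. a i * complex_of_real (e i))
        + complex_of_real (4 * b\<^sup>2 * (\<Sum>i\<in>I. e i * e i))"
    unfolding sq by (simp add: sum.distrib sum_distrib_left)
  also have "(\<Sum>i\<in>I. a i * a i) = (\<Sum>j=1..k. (\<alpha> j)\<^sup>2 * complex_of_real (G (x j) (x j)))
      + 2 * (\<Sum>j=1..k. \<Sum>j'\<in>{j<..k}. \<alpha> j * \<alpha> j' * complex_of_real (G (x j) (x j')))"
    unfolding aa by (subst sum_pairs) (auto simp: sym power2_eq_square)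
  also have "(\<Sum>i\<in>I. e i * e i) = (\<Sum>l=1..n. G (y l) (y l)) + 2 * (\<Sum>l=1..n. \<Sum>l'\<in>{l<..n}. G (y l) (y l'))"
    unfolding ee by (subst sum_pairs) (auto simp: sym)
  finally show ?thesis
    unfolding coulomb_exponent_def ae
    by (simp add: sum_distrib_left[symmetric] mult.assoc) (simp add: field_simps)
qed

lemma wrong_sign_expectation_eq:
  assumes "\<And>c. has_wrong_sign_expectation I h c \<longleftrightarrow> c = v"
  shows "wrong_sign_expectation I h = v" and "\<exists>!c. has_wrong_sign_expectation I h c"
  using assms by (auto simp: wrong_sign_expectation_def)

text \<open>The total area is finite because the chordal distance is bounded, so that its powers with a negative exponent
  are bounded below.\<close>

lemma integrable_sphere_metric: "integrable lborel sphere_metric"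
proof (rule Bochner_Integration.integrable_bound)
  have "integrable lborel (\<lambda>t. 2 powr (1 / 2) * (sphere_metric t * (1 - stereo_inv 0 \<bullet> stereo_inv t) powr (- 1 / 2)))"
    using integrable_chordal_power[of 1 0] by simp
  then show "integrable lborel (\<lambda>t. 2 powr (1 / 2) * (sphere_metric t * (1 - stereo_inv 0 \<bullet> stereo_inv t) powr (- 1 / 2)))" .
  have "AE t in lborel. t \<noteq> (0::complex)" by (rule AE_lborel_singleton)
  then show "AE t in lborel. norm (sphere_metric t) \<le> norm (2 powr (1 / 2) * (sphere_metric t * (1 - stereo_inv 0 \<bullet> stereo_inv t) powr (- 1 / 2)))"
  proof eventually_elim
    fix t :: complex assume t: "t \<noteq> 0"
    define c where "c = stereo_inv 0 \<bullet> stereo_inv t"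
    have "\<bar>c\<bar> \<le> 1" unfolding c_def by (rule abs_inner_sphere_le_1[OF stereo_inv_in_sphere stereo_inv_in_sphere])
    moreover have "1 - c > 0" unfolding c_def stereo_inv_inner
      using t one_plus_cmod2_pos[of t] by simp
    ultimately have "(1 - c) powr (- 1 / 2) \<ge> 2 powr (- 1 / 2)" by (intro powr_mono2') auto
    then have "2 powr (1 / 2) * (1 - c) powr (- 1 / 2) \<ge> 2 powr (1 / 2) * 2 powr (- 1 / 2)"
      by (intro mult_left_mono) auto
    then have "2 powr (1 / 2) * (1 - c) powr (- 1 / 2) \<ge> 1" by (simp add: powr_add[symmetric])
    then have "sphere_metric t * 1 \<le> sphere_metric t * (2 powr (1 / 2) * (1 - c) powr (- 1 / 2))"
      using sphere_metric_pos[of t] by (intro mult_left_mono) auto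
    then show "norm (sphere_metric t) \<le> norm (2 powr (1 / 2) * (sphere_metric t * (1 - stereo_inv 0 \<bullet> stereo_inv t) powr (- 1 / 2)))"
      using sphere_metric_pos[of t] by (simp add: c_def mult_ac)
  qed
qed measurable

lemma measurable_reg_green:
  assumes "lam > 0" and [measurable]: "f \<in> borel_measurable M" "g \<in> borel_measurable M"
  shows "(\<lambda>t. reg_green lam L (f t) (g t)) \<in> borel_measurable M"
proof -
  note [measurable] = measurable_mode_coeff
  show ?thesis unfolding reg_green_eq_sum_modes[OF assms(1)] by measurable
qed

lemma measurable_reg_field: "reg_field lam L X \<in> borel_measurable borel"
proof -
  note [measurable] = measurable_mode_coeff
  show ?thesis unfolding reg_field_eq_sum_modes[abs_def] by measurable
qed

text \<open>The assumption \<open>screening\<close> says that \<open>\<Sum> \<alpha>\<^sub>j + b w = Q\<close>: the inserted charges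
  and \<open>w\<close> further charges \<open>b\<close> balance the background charge \<open>Q\<close>.\<close>

locale correlation_setting =
  fixes b \<mu> :: real and k w :: nat and \<alpha> :: "nat \<Rightarrow> complex" and x :: "nat \<Rightarrow> real^3"
  assumes b_pos: "b > 0"
    and alpha_gt: "\<And>j. j \<in> {1..k} \<Longrightarrow> Re (\<alpha> j) > - 1 / (2 * b)"
    and screening: "w_param k \<alpha> b = of_nat w"
    and x_sphere: "\<And>j. j \<in> {1..k} \<Longrightarrow> x j \<in> sphere 0 1 - {north_pole}"
    and x_inj: "inj_on x {1..k}"
begin

definition vertex_const :: complex where
  "vertex_const = (\<Prod>j=1..k. exp (complex_of_real chi_const * \<alpha> j * (complex_of_real b - \<alpha> j))
     * complex_of_real (sphere_metric (stereo (x j))) powr (- conf_weight b (\<alpha> j)))"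

definition coulomb_integral :: "(real^3 \<Rightarrow> real^3 \<Rightarrow> real) \<Rightarrow> nat \<Rightarrow> complex" where
  "coulomb_integral G n = (LINT t|PiM {1..n} (\<lambda>_. lborel). coulomb_weight G n k \<alpha> x b t)"

text \<open>The coefficient of \<open>X\<^sub>i\<close> in the exponent that comes from the vertex operators.\<close>

definition source :: "real \<Rightarrow> nat \<times> int \<Rightarrow> complex" where
  "source lam i = (\<Sum>j=1..k. 2 * \<alpha> j * complex_of_real (mode_coeff lam i (x j)))"

text \<open>The coefficient of \<open>X\<^sub>0\<^sub>0\<close> in \<open>2 b D\<close>.\<close>

definition zero_charge :: "real \<Rightarrow> real" where
  "zero_charge \<epsilon> = 2 * b / sqrt (8 * pi * \<epsilon>)"

definition reg_weight :: "real \<Rightarrow> nat \<Rightarrow> complex \<Rightarrow> real" where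
  "reg_weight lam L t = sphere_metric t * exp (2 * b\<^sup>2 * reg_green lam L (stereo_inv t) (stereo_inv t))"

definition reg_const :: "real \<Rightarrow> nat \<Rightarrow> complex" where
  "reg_const lam L = vertex_const * exp (\<Sum>j=1..k. 2 * (\<alpha> j)\<^sup>2 * complex_of_real (reg_green lam L (x j) (x j)))"

lemma reg_area_eq:
  assumes lam: "lam > 0"
  shows "exp (2 * b * zero_mode \<epsilon> X) * reg_area lam L b X
    = (LINT t|lborel. reg_weight lam L t * exp (\<Sum>i\<in>mode_set L.
         (2 * b * mode_coeff lam i (stereo_inv t) + (if i = (0, 0) then zero_charge \<epsilon> else 0)) * X i))"
proof -
  have m: "(\<lambda>x. exp (2 * b * reg_field lam L X x + 2 * b\<^sup>2 * reg_green lam L x x)) \<in> borel_measurable borel"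
    using measurable_reg_field[of lam L X] measurable_reg_green[OF lam, of "\<lambda>x. x" borel "\<lambda>x. x" L] by measurable
  have s: "(\<Sum>i\<in>mode_set L. (2 * b * mode_coeff lam i y + (if i = (0, 0) then zero_charge \<epsilon> else 0)) * X i)
      = 2 * b * reg_field lam L X y + 2 * b * zero_mode \<epsilon> X" for y
  proof -
    have "(\<Sum>i\<in>mode_set L. (2 * b * mode_coeff lam i y + (if i = (0, 0) then zero_charge \<epsilon> else 0)) * X i)
      = (\<Sum>i\<in>mode_set L. 2 * b * (mode_coeff lam i y * X i) + (if i = (0, 0) then zero_charge \<epsilon> * X (0, 0) else 0))"
      by (intro sum.cong refl) (auto simp: algebra_simps)
    also have "\<dots> = 2 * b * reg_field lam L X y + zero_charge \<epsilon> * X (0, 0)"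
      using zero_in_mode_set[of L] finite_mode_set[of L]
      by (simp add: sum.distrib sum_distrib_left[symmetric] reg_field_eq_sum_modes)
    finally show ?thesis by (simp add: zero_charge_def zero_mode_def)
  qed
  have "exp (2 * b * zero_mode \<epsilon> X) * reg_area lam L b X = exp (2 * b * zero_mode \<epsilon> X) *
     (LINT t|lborel. sphere_metric t * exp (2 * b * reg_field lam L X (stereo_inv t) + 2 * b\<^sup>2 * reg_green lam L (stereo_inv t) (stereo_inv t)))"
    unfolding reg_area_def integral_sphere_area[OF m] ..
  also have "\<dots> = (LINT t|lborel. exp (2 * b * zero_mode \<epsilon> X) *
     (sphere_metric t * exp (2 * b * reg_field lam L X (stereo_inv t) + 2 * b\<^sup>2 * reg_green lam L (stereo_inv t) (stereo_inv t))))"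
    by (simp only: integral_mult_right_zero)
  also have "\<dots> = (LINT t|lborel. reg_weight lam L t * exp (\<Sum>i\<in>mode_set L.
         (2 * b * mode_coeff lam i (stereo_inv t) + (if i = (0, 0) then zero_charge \<epsilon> else 0)) * X i))"
    unfolding s reg_weight_def by (intro Bochner_Integration.integral_cong refl) (simp add: exp_add mult_ac)
  finally show ?thesis .
qed

text \<open>Puts the integrand into the form of \<open>wrong_sign_expectation_exp_exp\<close>; the condition on \<open>w\<close> makes the
  insertion \<open>- 2 b w D\<close> equal to \<open>- w\<close> times the zero mode part of the area exponent.\<close>

lemma reg_integrand_eq:
  assumes lam: "lam > 0"
  shows "reg_integrand \<epsilon> lam L k \<alpha> x b \<mu> X = reg_const lam L *
    exp ((\<Sum>i\<in>mode_set L. (source lam i + (if i = (0, 0) then - complex_of_real (real w * zero_charge \<epsilon>) else 0)) * complex_of_real (X i))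
      - complex_of_real (\<mu> * (LINT t|lborel. reg_weight lam L t * exp (\<Sum>i\<in>mode_set L.
         (2 * b * mode_coeff lam i (stereo_inv t) + (if i = (0, 0) then zero_charge \<epsilon> else 0)) * X i))))"
proof -
  define E where "E = (\<Sum>j=1..k. 2 * (\<alpha> j)\<^sup>2 * complex_of_real (reg_green lam L (x j) (x j)))"
  define S where "S = (\<Sum>j=1..k. 2 * \<alpha> j * complex_of_real (reg_field lam L X (x j)))"
  have "(\<Prod>j=1..k. reg_vertex lam L b X (\<alpha> j) (x j)) = vertex_const *
      (\<Prod>j=1..k. exp (2 * \<alpha> j * complex_of_real (reg_field lam L X (x j)) + 2 * (\<alpha> j)\<^sup>2 * complex_of_real (reg_green lam L (x j) (x j))))"
    unfolding vertex_const_def reg_vertex_def by (simp only: prod.distrib)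
  also have "(\<Prod>j=1..k. exp (2 * \<alpha> j * complex_of_real (reg_field lam L X (x j)) + 2 * (\<alpha> j)\<^sup>2 * complex_of_real (reg_green lam L (x j) (x j))))
      = exp (S + E)"
    unfolding S_def E_def by (simp only: exp_sum[symmetric] finite_atLeastAtMost sum.distrib)
  finally have 1: "(\<Prod>j=1..k. reg_vertex lam L b X (\<alpha> j) (x j)) = vertex_const * exp (S + E)" .
  have S: "S = (\<Sum>i\<in>mode_set L. source lam i * complex_of_real (X i))"
    unfolding S_def source_def reg_field_eq_sum_modes of_real_sum sum_distrib_left sum_distrib_right
    by (subst sum.swap) (simp add: mult_ac)
  have 2: "(\<Sum>i\<in>mode_set L. (source lam i + (if i = (0, 0) then - complex_of_real (real w * zero_charge \<epsilon>) else 0)) * complex_of_real (X i))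
      = S - complex_of_real (real w * zero_charge \<epsilon>) * complex_of_real (X (0, 0))"
  proof -
    have "(\<Sum>i\<in>mode_set L. (source lam i + (if i = (0, 0) then - complex_of_real (real w * zero_charge \<epsilon>) else 0)) * complex_of_real (X i))
        = (\<Sum>i\<in>mode_set L. source lam i * complex_of_real (X i)
            + (if i = (0, 0) then - complex_of_real (real w * zero_charge \<epsilon>) * complex_of_real (X (0, 0)) else 0))"
      by (intro sum.cong refl) (auto simp: algebra_simps)
    then show ?thesis
      using zero_in_mode_set[of L] finite_mode_set[of L] by (simp add: sum.distrib S)
  qed
  have 3: "- 2 * complex_of_real b * w_param k \<alpha> b * complex_of_real (zero_mode \<epsilon> X)
      = - complex_of_real (real w * zero_charge \<epsilon>) * complex_of_real (X (0, 0))"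
    unfolding screening by (simp add: zero_mode_def zero_charge_def)
  have 4: "\<mu> * exp (2 * b * zero_mode \<epsilon> X) * reg_area lam L b X
      = \<mu> * (LINT t|lborel. reg_weight lam L t * exp (\<Sum>i\<in>mode_set L.
         (2 * b * mode_coeff lam i (stereo_inv t) + (if i = (0, 0) then zero_charge \<epsilon> else 0)) * X i))"
    unfolding reg_area_eq[OF lam, symmetric] by (rule mult.assoc)
  have 5: "vertex_const * exp (S + E) * exp (- z * y - M) = vertex_const * exp E * exp (S - z * y - M)" for z y M
    by (simp add: mult_exp_exp mult.assoc add_ac) (simp add: algebra_simps)
  show ?thesis
    unfolding reg_integrand_def 1 2 3 4 reg_const_def E_def[symmetric] by (rule 5)
qed

lemma reg_weight_pos: "reg_weight lam L t > 0"
  using sphere_metric_pos by (simp add: reg_weight_def)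

lemma measurable_reg_weight: "lam > 0 \<Longrightarrow> reg_weight lam L \<in> borel_measurable borel"
  unfolding reg_weight_def[abs_def]
  by (intro borel_measurable_times measurable_sphere_metric borel_measurable_exp[THEN measurable_compose[rotated]] borel_measurable_const measurable_reg_green) measurable

lemma integrable_reg_weight:
  assumes lam: "0 < lam" "lam < 1"
  shows "integrable lborel (reg_weight lam L)"
proof (rule Bochner_Integration.integrable_bound)
  show "integrable lborel (\<lambda>t. exp (2 * b\<^sup>2 * (1 / (1 - lam))) * sphere_metric t)"
    using integrable_sphere_metric by simp
  show "reg_weight lam L \<in> borel_measurable lborel" using measurable_reg_weight[OF lam(1)] by simp
  show "AE t in lborel. norm (reg_weight lam L t) \<le> norm (exp (2 * b\<^sup>2 * (1 / (1 - lam))) * sphere_metric t)"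
  proof (rule AE_I2)
    fix t
    have "reg_green lam L (stereo_inv t) (stereo_inv t) \<le> 1 / (1 - lam)"
      using abs_reg_green_le[OF stereo_inv_in_sphere stereo_inv_in_sphere lam, of L t t] by simp
    then have "2 * b\<^sup>2 * reg_green lam L (stereo_inv t) (stereo_inv t) \<le> 2 * b\<^sup>2 * (1 / (1 - lam))"
      by (intro mult_left_mono) auto
    then show "norm (reg_weight lam L t) \<le> norm (exp (2 * b\<^sup>2 * (1 / (1 - lam))) * sphere_metric t)"
      using sphere_metric_pos[of t] by (simp add: reg_weight_def)
  qed
qed

definition gaussian_moment :: "real \<Rightarrow> nat \<Rightarrow> nat \<Rightarrow> complex" where
  "gaussian_moment lam L n = (LINT t|PiM {1..n} (\<lambda>_. lborel). complex_of_real (\<Prod>l=1..n. reg_weight lam L (t l)) *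
     exp (- (\<Sum>i\<in>mode_set L. (source lam i + complex_of_real (\<Sum>l=1..n. 2 * b * mode_coeff lam i (stereo_inv (t l))))\<^sup>2) / 2))"

text \<open>In the \<open>n\<close>-th term the zero mode has coefficient \<open>(n - w)\<close> times \<open>zero_charge \<epsilon>\<close>.  It decouples from the
  other modes, which do not depend on \<open>\<epsilon>\<close>.\<close>

lemma reg_correlation_series:
  assumes lam: "0 < lam" "lam < 1" and eps: "\<epsilon> > 0"
  shows "has_wrong_sign_expectation (mode_set L) (reg_integrand \<epsilon> lam L k \<alpha> x b \<mu>) c \<longleftrightarrow>
    c = reg_const lam L * (\<Sum>n. (- complex_of_real \<mu>) ^ n / fact n *
          (complex_of_real (exp (- ((zero_charge \<epsilon>)\<^sup>2 * (real n - real w)\<^sup>2) / 2)) * gaussian_moment lam L n))"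
proof -
  define q where "q = (\<lambda>i t. 2 * b * mode_coeff lam i (stereo_inv t) + (if i = (0::nat, 0::int) then zero_charge \<epsilon> else 0))"
  define p where "p = (\<lambda>i. source lam i + (if i = (0::nat, 0::int) then - complex_of_real (real w * zero_charge \<epsilon>) else 0))"
  have W: "has_wrong_sign_expectation (mode_set L) (reg_integrand \<epsilon> lam L k \<alpha> x b \<mu>) c \<longleftrightarrow>
    c = reg_const lam L * (\<Sum>n. (- complex_of_real \<mu>) ^ n / fact n *
      (LINT t|PiM {1..n} (\<lambda>_. lborel). complex_of_real (\<Prod>l=1..n. reg_weight lam L (t l)) *
         exp (- (\<Sum>i\<in>mode_set L. (p i + complex_of_real (\<Sum>l=1..n. q i (t l)))\<^sup>2) / 2)))"
  proof (rule wrong_sign_expectation_exp_exp[where B = "2 * b * sqrt (1 / (1 - lam)) + \<bar>zero_charge \<epsilon>\<bar>"])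
    show "finite (mode_set L)" by (rule finite_mode_set)
    show "sigma_finite_measure (lborel :: complex measure)" by (rule lborel.sigma_finite_measure_axioms)
    show "integrable lborel (reg_weight lam L)" by (rule integrable_reg_weight[OF lam])
    show "reg_weight lam L t \<ge> 0" for t using reg_weight_pos[of lam L t] by simp
    show "q i \<in> borel_measurable lborel" for i
      unfolding q_def using measurable_compose[OF measurable_stereo_inv measurable_mode_coeff[of lam i]] by simp
    show "\<bar>q i t\<bar> \<le> 2 * b * sqrt (1 / (1 - lam)) + \<bar>zero_charge \<epsilon>\<bar>" if "i \<in> mode_set L" for i t
    proof -
      have "\<bar>2 * b * mode_coeff lam i (stereo_inv t)\<bar> \<le> 2 * b * sqrt (1 / (1 - lam))"
        using abs_mode_coeff_le[OF stereo_inv_in_sphere lam that, of t] b_pos by (simp add: abs_mult)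
      moreover have "\<bar>if i = (0::nat, 0::int) then zero_charge \<epsilon> else 0\<bar> \<le> \<bar>zero_charge \<epsilon>\<bar>" by simp
      ultimately show ?thesis unfolding q_def by (intro order.trans[OF abs_triangle_ineq] add_mono)
    qed
    show "reg_integrand \<epsilon> lam L k \<alpha> x b \<mu> X = reg_const lam L * exp ((\<Sum>i\<in>mode_set L. p i * complex_of_real (X i))
              - complex_of_real (\<mu> * (LINT t|lborel. reg_weight lam L t * exp (\<Sum>i\<in>mode_set L. q i t * X i))))" for X
      unfolding p_def q_def by (rule reg_integrand_eq[OF lam(1)])
  qed
  have "(LINT t|PiM {1..n} (\<lambda>_. lborel). complex_of_real (\<Prod>l=1..n. reg_weight lam L (t l)) *
         exp (- (\<Sum>i\<in>mode_set L. (p i + complex_of_real (\<Sum>l=1..n. q i (t l)))\<^sup>2) / 2))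
      = complex_of_real (exp (- ((zero_charge \<epsilon>)\<^sup>2 * (real n - real w)\<^sup>2) / 2)) * gaussian_moment lam L n" for n
  proof -
    define base where "base = (\<lambda>i t. source lam i + complex_of_real (\<Sum>l=1..n. 2 * b * mode_coeff lam i (stereo_inv (t l))))"
    \<comment> \<open>only the zero mode variable sees \<open>w\<close> and \<open>\<epsilon>\<close>, and its coefficient depends neither on the \<open>x\<^sub>j\<close> nor on the \<open>t\<^sub>l\<close>\<close>
    have base0: "base (0, 0) t = 0" for t by (simp add: base_def source_def mode_coeff_def)
    have "p i + complex_of_real (\<Sum>l=1..n. q i (t l))
        = base i t + (if i = (0, 0) then complex_of_real (zero_charge \<epsilon> * (real n - real w)) else 0)" for i t
      unfolding p_def q_def base_def by (simp add: sum.distrib algebra_simps)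
    then have "(p i + complex_of_real (\<Sum>l=1..n. q i (t l)))\<^sup>2
        = (base i t)\<^sup>2 + (if i = (0, 0) then complex_of_real ((zero_charge \<epsilon>)\<^sup>2 * (real n - real w)\<^sup>2) else 0)" for i t
      using base0[of t] by (simp add: power_mult_distrib)
    then have tot: "(\<Sum>i\<in>mode_set L. (p i + complex_of_real (\<Sum>l=1..n. q i (t l)))\<^sup>2)
        = (\<Sum>i\<in>mode_set L. (base i t)\<^sup>2) + complex_of_real ((zero_charge \<epsilon>)\<^sup>2 * (real n - real w)\<^sup>2)" for t
      using zero_in_mode_set[of L] finite_mode_set[of L] by (simp add: sum.distrib)
    have "exp (- (\<Sum>i\<in>mode_set L. (p i + complex_of_real (\<Sum>l=1..n. q i (t l)))\<^sup>2) / 2)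
        = complex_of_real (exp (- ((zero_charge \<epsilon>)\<^sup>2 * (real n - real w)\<^sup>2) / 2)) * exp (- (\<Sum>i\<in>mode_set L. (base i t)\<^sup>2) / 2)" for t
    proof -
      have "exp (- (B + complex_of_real r) / 2) = complex_of_real (exp (- r / 2)) * exp (- B / 2)" for B r
      proof -
        have "- (B + complex_of_real r) / 2 = complex_of_real (- r / 2) + (- B / 2)" by (simp add: field_simps)
        then show ?thesis by (simp only: exp_add exp_of_real)
      qed
      then show ?thesis unfolding tot .
    qed
    then have "(\<lambda>t. complex_of_real (\<Prod>l=1..n. reg_weight lam L (t l)) *
         exp (- (\<Sum>i\<in>mode_set L. (p i + complex_of_real (\<Sum>l=1..n. q i (t l)))\<^sup>2) / 2))
      = (\<lambda>t. complex_of_real (exp (- ((zero_charge \<epsilon>)\<^sup>2 * (real n - real w)\<^sup>2) / 2)) *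
         (complex_of_real (\<Prod>l=1..n. reg_weight lam L (t l)) * exp (- (\<Sum>i\<in>mode_set L. (base i t)\<^sup>2) / 2)))"
      by (simp add: mult_ac)
    then show ?thesis unfolding gaussian_moment_def by (simp only: integral_mult_right_zero base_def)
  qed
  then show ?thesis using W by simp
qed

text \<open>The real part of \<open>- (z + r)\<^sup>2\<close> is at most \<open>(Im z)\<^sup>2\<close> for real \<open>r\<close>, so the Gaussian factor is bounded
  independently of the integration variables and of their number; what remains is the \<open>n\<close>-th power of the
  mass of the weight.\<close>

lemma gaussian_moment_bound:
  assumes lam: "0 < lam" "lam < 1"
  obtains K R where "K \<ge> 0" "R \<ge> 0" "\<And>n. cmod (gaussian_moment lam L n) \<le> K * R ^ n"
proof
  define K where "K = exp ((\<Sum>i\<in>mode_set L. (Im (source lam i))\<^sup>2) / 2)"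
  define R where "R = (LINT t|lborel. reg_weight lam L t)"
  interpret N: product_sigma_finite "\<lambda>_::nat. lborel :: complex measure"
    by (rule product_sigma_finite.intro) (rule lborel.sigma_finite_measure_axioms)
  show "K \<ge> 0" by (simp add: K_def)
  show "R \<ge> 0" unfolding R_def by (intro integral_nonneg_AE AE_I2 less_imp_le reg_weight_pos)
  fix n :: nat
  let ?P = "PiM {1..n} (\<lambda>_. lborel :: complex measure)"
  have int: "integrable ?P (\<lambda>t. (\<Prod>l=1..n. reg_weight lam L (t l)))"
    by (rule N.product_integrable_prod) (auto intro: integrable_reg_weight[OF lam])
  have "cmod (gaussian_moment lam L n) \<le> (LINT t|?P. cmod (complex_of_real (\<Prod>l=1..n. reg_weight lam L (t l)) *
     exp (- (\<Sum>i\<in>mode_set L. (source lam i + complex_of_real (\<Sum>l=1..n. 2 * b * mode_coeff lam i (stereo_inv (t l))))\<^sup>2) / 2)))"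
    unfolding gaussian_moment_def by (rule integral_norm_bound)
  also have "\<dots> \<le> (LINT t|?P. K * (\<Prod>l=1..n. reg_weight lam L (t l)))"
  proof (rule integral_mono')
    show "integrable ?P (\<lambda>t. K * (\<Prod>l=1..n. reg_weight lam L (t l)))" using int by simp
    fix t
    have pos: "(\<Prod>l=1..n. reg_weight lam L (t l)) \<ge> 0"
      by (intro prod_nonneg) (auto intro: less_imp_le reg_weight_pos)
    then show "0 \<le> K * (\<Prod>l=1..n. reg_weight lam L (t l))" by (simp add: K_def)
    have "Re (- ((z + complex_of_real r)\<^sup>2)) \<le> (Im z)\<^sup>2" for z r
      by (simp add: power2_eq_square)
    then have "(\<Sum>i\<in>mode_set L. Re (- ((source lam i + complex_of_real (\<Sum>l=1..n. 2 * b * mode_coeff lam i (stereo_inv (t l))))\<^sup>2)))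
        \<le> (\<Sum>i\<in>mode_set L. (Im (source lam i))\<^sup>2)" by (intro sum_mono)
    then have "cmod (exp (- (\<Sum>i\<in>mode_set L. (source lam i + complex_of_real (\<Sum>l=1..n. 2 * b * mode_coeff lam i (stereo_inv (t l))))\<^sup>2) / 2)) \<le> K"
      unfolding K_def by (simp add: sum_negf)
    moreover have "cmod (complex_of_real P * z) \<le> K * P" if "cmod z \<le> K" "P \<ge> 0" for P z
      using mult_right_mono[OF that] that(2) by (simp add: norm_mult mult.commute)
    ultimately show "cmod (complex_of_real (\<Prod>l=1..n. reg_weight lam L (t l)) *
       exp (- (\<Sum>i\<in>mode_set L. (source lam i + complex_of_real (\<Sum>l=1..n. 2 * b * mode_coeff lam i (stereo_inv (t l))))\<^sup>2) / 2))
       \<le> K * (\<Prod>l=1..n. reg_weight lam L (t l))"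
      using pos by blast
  qed
  also have "\<dots> = K * (\<Prod>l\<in>{1..n}. LINT t|lborel. reg_weight lam L t)"
    by (subst integral_mult_right_zero, subst N.product_integral_prod) (auto intro: integrable_reg_weight[OF lam])
  finally show "cmod (gaussian_moment lam L n) \<le> K * R ^ n" by (simp add: R_def)
qed

lemma gaussian_moment_coulomb:
  assumes lam: "0 < lam"
  shows "reg_const lam L * gaussian_moment lam L n = vertex_const * coulomb_integral (reg_green lam L) n"
proof -
  define E where "E = exp (\<Sum>j=1..k. 2 * (\<alpha> j)\<^sup>2 * complex_of_real (reg_green lam L (x j) (x j)))"
  have "E * (complex_of_real (\<Prod>l=1..n. reg_weight lam L (t l)) *
       exp (- (\<Sum>i\<in>mode_set L. (source lam i + complex_of_real (\<Sum>l=1..n. 2 * b * mode_coeff lam i (stereo_inv (t l))))\<^sup>2) / 2))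
     = coulomb_weight (reg_green lam L) n k \<alpha> x b t" for t
  proof -
    have "(\<Prod>l=1..n. reg_weight lam L (t l)) = (\<Prod>l=1..n. sphere_metric (t l))
        * exp (\<Sum>l=1..n. 2 * b\<^sup>2 * reg_green lam L (stereo_inv (t l)) (stereo_inv (t l)))"
      unfolding reg_weight_def prod.distrib by (simp add: exp_sum)
    moreover have "exp A * (complex_of_real (P * exp r) * exp (- Q / 2)) = complex_of_real P * exp (A + complex_of_real r - Q / 2)"
      for A P r Q
    proof -
      have "A + complex_of_real r - Q / 2 = A + complex_of_real r + - Q / 2" by simp
      then show ?thesis by (simp only: exp_add exp_of_real of_real_mult mult_ac)
    qed
    ultimately show ?thesis
      unfolding complete_square_exponent[OF reg_green_eq_sum_modes[OF lam], symmetric] source_def[symmetric] E_def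
      by (simp only:)
  qed
  then have "E * gaussian_moment lam L n = coulomb_integral (reg_green lam L) n"
    unfolding gaussian_moment_def coulomb_integral_def by (simp only: integral_mult_right_zero[symmetric])
  then show ?thesis unfolding reg_const_def E_def[symmetric] by (simp add: mult.assoc)
qed

lemma reg_correlation_unique:
  assumes "0 < lam" "lam < 1" "\<epsilon> > 0"
  shows "\<exists>!c. has_wrong_sign_expectation (mode_set L) (reg_integrand \<epsilon> lam L k \<alpha> x b \<mu>) c"
  using wrong_sign_expectation_eq(2)[OF reg_correlation_series[OF assms]] .

lemma zero_charge_limit:
  assumes "n \<noteq> w"
  shows "((\<lambda>\<epsilon>. exp (- ((zero_charge \<epsilon>)\<^sup>2 * (real n - real w)\<^sup>2) / 2)) \<longlongrightarrow> 0) (at_right 0)"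
proof -
  define c where "c = b\<^sup>2 * (real n - real w)\<^sup>2 / (4 * pi)"
  have c: "c > 0" using assms b_pos by (simp add: c_def)
  have "((\<lambda>\<epsilon>. exp (- (c * inverse \<epsilon>))) \<longlongrightarrow> 0) (at_right 0)"
    by (intro filterlim_compose[OF exp_at_bot] filterlim_uminus_at_bot_at_top[THEN filterlim_compose]
        filterlim_tendsto_pos_mult_at_top[OF tendsto_const c] filterlim_inverse_at_top_right)
  moreover have "eventually (\<lambda>\<epsilon>. exp (- (c * inverse \<epsilon>)) = exp (- ((zero_charge \<epsilon>)\<^sup>2 * (real n - real w)\<^sup>2) / 2)) (at_right 0)"
    unfolding eventually_at_right_field
    by (intro exI[of _ 1]) (auto simp: c_def zero_charge_def power_divide power_mult_distrib field_simps)
  ultimately show ?thesis by (rule Lim_transform_eventually)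
qed

text \<open>Tannery's theorem for the series in \<open>n\<close>: every term with \<open>n \<noteq> w\<close> tends to zero, the term with \<open>n = w\<close> is
  constant in \<open>\<epsilon>\<close>, and the exponential series dominates.\<close>

theorem reg_correlation_tendsto:
  assumes lam: "0 < lam" "lam < 1"
  shows "((\<lambda>\<epsilon>. reg_correlation \<epsilon> lam L k \<alpha> x b \<mu>) \<longlongrightarrow>
    (- complex_of_real \<mu>) ^ w / fact w * (vertex_const * coulomb_integral (reg_green lam L) w)) (at_right 0)"
proof -
  obtain K R where KR: "K \<ge> 0" "R \<ge> 0" "\<And>n. cmod (gaussian_moment lam L n) \<le> K * R ^ n"
    using gaussian_moment_bound[OF lam] by metis
  define a where "a = (\<lambda>n \<epsilon>. (- complex_of_real \<mu>) ^ n / fact n *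
          (complex_of_real (exp (- ((zero_charge \<epsilon>)\<^sup>2 * (real n - real w)\<^sup>2) / 2)) * gaussian_moment lam L n))"
  define l where "l = (\<lambda>n. if n = w then (- complex_of_real \<mu>) ^ w / fact w * gaussian_moment lam L w else 0)"
  define M where "M = (\<lambda>n. K * ((\<bar>\<mu>\<bar> * R) ^ n / fact n))"
  have "((\<lambda>\<epsilon>. \<Sum>n. a n \<epsilon>) \<longlongrightarrow> suminf l) (at_right 0)"
  proof (rule tannerys_theorem[THEN conjunct2, THEN conjunct2])
    show "((\<lambda>\<epsilon>. a n \<epsilon>) \<longlongrightarrow> l n) (at_right 0)" for n
    proof (cases "n = w")
      case True
      then show ?thesis by (simp add: a_def l_def)
    next
      case False
      have "((\<lambda>\<epsilon>. a n \<epsilon>) \<longlongrightarrow> (- complex_of_real \<mu>) ^ n / fact n * (complex_of_real 0 * gaussian_moment lam L n)) (at_right 0)"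
        unfolding a_def by (intro tendsto_intros zero_charge_limit False)
      then show ?thesis using False by (simp add: l_def)
    qed
    have "cmod (a n \<epsilon>) \<le> M n" for n \<epsilon>
    proof -
      have "exp (- ((zero_charge \<epsilon>)\<^sup>2 * (real n - real w)\<^sup>2) / 2) * cmod (gaussian_moment lam L n) \<le> 1 * (K * R ^ n)"
        using KR by (intro mult_mono) auto
      then have "\<bar>\<mu>\<bar> ^ n / fact n * (exp (- ((zero_charge \<epsilon>)\<^sup>2 * (real n - real w)\<^sup>2) / 2) * cmod (gaussian_moment lam L n))
          \<le> \<bar>\<mu>\<bar> ^ n / fact n * (1 * (K * R ^ n))"
        by (intro mult_left_mono) auto
      then show ?thesis by (simp add: a_def M_def norm_mult norm_divide norm_power power_mult_distrib mult_ac)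
    qed
    then show "\<forall>\<^sub>F (n, \<epsilon>) in sequentially \<times>\<^sub>F at_right 0. norm (a n \<epsilon>) \<le> M n"
      by (intro always_eventually) auto
    show "summable M"
      unfolding M_def using exp_converges[of "\<bar>\<mu>\<bar> * R"] by (intro summable_mult) (simp add: sums_iff divide_inverse mult.commute)
    show "at_right (0::real) \<noteq> bot" by simp
  qed
  also have "suminf l = (- complex_of_real \<mu>) ^ w / fact w * gaussian_moment lam L w"
    unfolding l_def using sums_single[of w "\<lambda>_. (- complex_of_real \<mu>) ^ w / fact w * gaussian_moment lam L w"]
    by (simp add: sums_iff)
  finally have L1: "((\<lambda>\<epsilon>. reg_const lam L * (\<Sum>n. a n \<epsilon>)) \<longlongrightarrow>
      reg_const lam L * ((- complex_of_real \<mu>) ^ w / fact w * gaussian_moment lam L w)) (at_right 0)"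
    by (intro tendsto_intros)
  have L2: "reg_const lam L * ((- complex_of_real \<mu>) ^ w / fact w * gaussian_moment lam L w)
      = (- complex_of_real \<mu>) ^ w / fact w * (vertex_const * coulomb_integral (reg_green lam L) w)"
    unfolding gaussian_moment_coulomb[OF lam(1), symmetric] by (simp add: mult_ac)
  have L3: "eventually (\<lambda>\<epsilon>. reg_const lam L * (\<Sum>n. a n \<epsilon>) = reg_correlation \<epsilon> lam L k \<alpha> x b \<mu>) (at_right 0)"
  proof -
    have "reg_const lam L * (\<Sum>n. a n \<epsilon>) = reg_correlation \<epsilon> lam L k \<alpha> x b \<mu>" if "\<epsilon> > 0" for \<epsilon>
      unfolding reg_correlation_def a_def
      by (rule wrong_sign_expectation_eq(1)[OF reg_correlation_series[OF lam that], symmetric])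
    then show ?thesis unfolding eventually_at_right_field by (intro exI[of _ 1]) auto
  qed
  show ?thesis using Lim_transform_eventually[OF L1 L3] unfolding L2 .
qed

lemma correlation_lam_L_eq:
  assumes "0 < lam" "lam < 1"
  shows "correlation_lam_L lam L k \<alpha> x b \<mu>
    = (- complex_of_real \<mu>) ^ w / fact w * (vertex_const * coulomb_integral (reg_green lam L) w)"
  unfolding correlation_lam_L_def by (rule tendsto_Lim[OF _ reg_correlation_tendsto[OF assms]]) simp

end

section \<open>Removing the cutoffs\<close>

text \<open>The graph of a function of the other coordinates is a null set, by Fubini's theorem.\<close>

lemma AE_PiM_lborel_neq:
  fixes \<phi> :: "('i \<Rightarrow> complex) \<Rightarrow> complex"
  assumes fin: "finite I" and l: "l \<in> I"
    and \<phi>: "\<phi> \<in> borel_measurable (PiM I (\<lambda>_. lborel))" "\<And>t y. \<phi> (t(l := y)) = \<phi> t"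
  shows "AE t in PiM I (\<lambda>_. lborel). t l \<noteq> \<phi> t"
proof -
  interpret N: product_sigma_finite "\<lambda>_::'i. lborel :: complex measure"
    by (rule product_sigma_finite.intro) (rule lborel.sigma_finite_measure_axioms)
  define f where "f = (\<lambda>t. if t l = \<phi> t then 1 else 0 :: ennreal)"
  have [measurable]: "\<phi> \<in> borel_measurable (PiM I (\<lambda>_. lborel))" by (rule \<phi>(1))
  have [measurable]: "(\<lambda>t. t l) \<in> borel_measurable (PiM I (\<lambda>_. lborel :: complex measure))"
    using measurable_component_singleton[OF l, of "\<lambda>_. lborel :: complex measure"] by simp
  have fm: "f \<in> borel_measurable (PiM I (\<lambda>_. lborel))" unfolding f_def by measurable
  have I: "insert l (I - {l}) = I" using l by auto
  have "integral\<^sup>N (PiM I (\<lambda>_. lborel)) f = (\<integral>\<^sup>+t. (\<integral>\<^sup>+y. f (t(l := y)) \<partial>lborel) \<partial>PiM (I - {l}) (\<lambda>_. lborel))"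
    using N.product_nn_integral_insert[of "I - {l}" l f] fin fm unfolding I by simp
  also have "\<dots> = (\<integral>\<^sup>+t. 0 \<partial>PiM (I - {l}) (\<lambda>_. lborel :: complex measure))"
  proof (rule nn_integral_cong)
    fix t
    have "(\<integral>\<^sup>+y. f (t(l := y)) \<partial>lborel) = (\<integral>\<^sup>+y. indicator {\<phi> t} y \<partial>lborel)"
      by (intro nn_integral_cong) (auto simp: f_def \<phi>(2) indicator_def)
    then show "(\<integral>\<^sup>+y. f (t(l := y)) \<partial>lborel) = 0" by simp
  qed
  finally have "integral\<^sup>N (PiM I (\<lambda>_. lborel)) f = 0" by simp
  then have "AE t in PiM I (\<lambda>_. lborel). f t = 0" using fm by (simp add: nn_integral_0_iff_AE)
  then show ?thesis by eventually_elim (auto simp: f_def split: if_splits)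
qed

lemma measurable_stereo_component:
  "l \<in> I \<Longrightarrow> (\<lambda>t. stereo_inv (t l)) \<in> borel_measurable (PiM I (\<lambda>_. lborel))"
  using measurable_compose[OF measurable_component_singleton[of l I "\<lambda>_. lborel :: complex measure"], of stereo_inv borel] by simp

lemma measurable_metric_component:
  "l \<in> I \<Longrightarrow> (\<lambda>t. sphere_metric (t l)) \<in> borel_measurable (PiM I (\<lambda>_. lborel))"
  using measurable_compose[OF measurable_component_singleton[of l I "\<lambda>_. lborel :: complex measure"], of sphere_metric borel] by simp

lemma measurable_green_lam: "green_lam lam \<in> borel_measurable borel"
proof -
  have [measurable]: "poly p \<in> borel_measurable borel" for p :: "real poly"
    by (intro borel_measurable_continuous_onI continuous_intros)
  show ?thesis unfolding green_lam_def[abs_def] legendre_U_def legendre_V_def by measurable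
qed

text \<open>The limit of \<open>reg_green\<close> as the number of modes grows.\<close>

definition green_kernel :: "real \<Rightarrow> real^3 \<Rightarrow> real^3 \<Rightarrow> real" where
  "green_kernel lam u v = green_lam lam (u \<bullet> v)"

text \<open>The limit of \<open>green_kernel lam\<close> as \<open>lam\<close> tends to \<open>1\<close>: the Green function of the Laplacian on the
  sphere, up to a factor, with mean value zero.\<close>

definition log_kernel :: "real^3 \<Rightarrow> real^3 \<Rightarrow> real" where
  "log_kernel u v = (ln 2 - ln (1 - u \<bullet> v) - 1) / 2"

lemma measurable_green_kernel:
  assumes [measurable]: "f \<in> borel_measurable M" "g \<in> borel_measurable M"
  shows "(\<lambda>t. green_kernel lam (f t) (g t)) \<in> borel_measurable M"
proof -
  have "(\<lambda>t. f t \<bullet> g t) \<in> borel_measurable M" by measurable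
  from measurable_compose[OF this measurable_green_lam] show ?thesis unfolding green_kernel_def .
qed

lemma measurable_log_kernel:
  assumes [measurable]: "f \<in> borel_measurable M" "g \<in> borel_measurable M"
  shows "(\<lambda>t. log_kernel (f t) (g t)) \<in> borel_measurable M"
  unfolding log_kernel_def by measurable

lemma coulomb_exponent_tendsto:
  assumes "\<And>j j'. j \<in> {1..k} \<Longrightarrow> j' \<in> {j<..k} \<Longrightarrow> ((\<lambda>i. Gs i (x j) (x j')) \<longlongrightarrow> G (x j) (x j')) F"
    and "\<And>j l. j \<in> {1..k} \<Longrightarrow> l \<in> {1..n} \<Longrightarrow> ((\<lambda>i. Gs i (x j) (y l)) \<longlongrightarrow> G (x j) (y l)) F"
    and "\<And>l l'. l \<in> {1..n} \<Longrightarrow> l' \<in> {l<..n} \<Longrightarrow> ((\<lambda>i. Gs i (y l) (y l')) \<longlongrightarrow> G (y l) (y l')) F"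
  shows "((\<lambda>i. coulomb_exponent (Gs i) n k \<alpha> x b y) \<longlongrightarrow> coulomb_exponent G n k \<alpha> x b y) F"
  unfolding coulomb_exponent_def using assms
  by (intro tendsto_diff tendsto_mult tendsto_const tendsto_sum tendsto_of_real)

lemma measurable_coulomb_exponent:
  fixes M :: "(nat \<Rightarrow> complex) measure"
  assumes G: "\<And>f g. f \<in> borel_measurable M \<Longrightarrow> g \<in> borel_measurable M \<Longrightarrow> (\<lambda>t. G (f t) (g t)) \<in> borel_measurable M"
    and y: "\<And>l. l \<in> {1..n} \<Longrightarrow> y l \<in> borel_measurable M"
  shows "(\<lambda>t. coulomb_exponent G n k \<alpha> x b (\<lambda>l. y l t)) \<in> borel_measurable M"
proof -
  have 1: "(\<lambda>t. \<Sum>j=1..k. \<Sum>l=1..n. \<alpha> j * complex_of_real (G (x j) (y l t))) \<in> borel_measurable M"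
  proof (intro borel_measurable_sum)
    fix j l assume "l \<in> {1..n}"
    then have [measurable]: "(\<lambda>t. G (x j) (y l t)) \<in> borel_measurable M" by (intro G y) auto
    show "(\<lambda>t. \<alpha> j * complex_of_real (G (x j) (y l t))) \<in> borel_measurable M" by measurable
  qed
  have 2: "(\<lambda>t. \<Sum>l=1..n. \<Sum>l'\<in>{l<..n}. G (y l t) (y l' t)) \<in> borel_measurable M"
    by (intro borel_measurable_sum G y) auto
  show ?thesis unfolding coulomb_exponent_def using 1 2 by measurable
qed

lemma measurable_coulomb_weight:
  assumes G: "\<And>f g. f \<in> borel_measurable (PiM {1..n} (\<lambda>_. lborel :: complex measure))
       \<Longrightarrow> g \<in> borel_measurable (PiM {1..n} (\<lambda>_. lborel :: complex measure))
       \<Longrightarrow> (\<lambda>t. G (f t) (g t)) \<in> borel_measurable (PiM {1..n} (\<lambda>_. lborel :: complex measure))"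
  shows "(\<lambda>t. coulomb_weight G n k \<alpha> x b t)
    \<in> borel_measurable (PiM {1..n} (\<lambda>_. lborel :: complex measure))"
proof -
  let ?M = "PiM {1..n} (\<lambda>_. lborel :: complex measure)"
  have "(\<lambda>t. coulomb_exponent G n k \<alpha> x b (\<lambda>l. stereo_inv (t l))) \<in> borel_measurable ?M"
  proof (rule measurable_coulomb_exponent[where y = "\<lambda>l t. stereo_inv (t l)"])
    show "(\<lambda>t. G (f t) (g t)) \<in> borel_measurable ?M"
      if "f \<in> borel_measurable ?M" "g \<in> borel_measurable ?M" for f g by (rule G[OF that])
    show "(\<lambda>t. stereo_inv (t l)) \<in> borel_measurable ?M" if "l \<in> {1..n}" for l
      by (rule measurable_stereo_component[OF that])
  qed
  moreover have "(\<lambda>t. \<Prod>l=1..n. sphere_metric (t l)) \<in> borel_measurable ?M"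
    by (intro borel_measurable_prod measurable_metric_component)
  ultimately show ?thesis by measurable
qed

lemma norm_coulomb_exponent_le:
  assumes C: "\<And>j j'. j \<in> {1..k} \<Longrightarrow> j' \<in> {1..k} \<Longrightarrow> \<bar>G (x j) (x j')\<bar> \<le> C"
      "\<And>j l. j \<in> {1..k} \<Longrightarrow> \<bar>G (x j) (y l)\<bar> \<le> C" "\<And>l l'. \<bar>G (y l) (y l')\<bar> \<le> C"
    and b: "b > 0"
  shows "cmod (coulomb_exponent G n k \<alpha> x b y) \<le>
    4 * (\<Sum>j=1..k. \<Sum>j'\<in>{j<..k}. cmod (\<alpha> j * \<alpha> j') * C)
    + 4 * b * (\<Sum>j=1..k. \<Sum>l=1..n. cmod (\<alpha> j) * C) + 4 * b\<^sup>2 * (\<Sum>l=1..n. \<Sum>l'\<in>{l<..n}. C)"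
proof -
  have 1: "cmod (4 * (\<Sum>j=1..k. \<Sum>j'\<in>{j<..k}. \<alpha> j * \<alpha> j' * complex_of_real (G (x j) (x j'))))
      \<le> 4 * (\<Sum>j=1..k. \<Sum>j'\<in>{j<..k}. cmod (\<alpha> j * \<alpha> j') * C)"
  proof -
    have "cmod (\<Sum>j=1..k. \<Sum>j'\<in>{j<..k}. \<alpha> j * \<alpha> j' * complex_of_real (G (x j) (x j')))
        \<le> (\<Sum>j=1..k. \<Sum>j'\<in>{j<..k}. cmod (\<alpha> j * \<alpha> j' * complex_of_real (G (x j) (x j'))))"
      by (intro order.trans[OF norm_sum] sum_mono norm_sum)
    also have "\<dots> \<le> (\<Sum>j=1..k. \<Sum>j'\<in>{j<..k}. cmod (\<alpha> j * \<alpha> j') * C)"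
      unfolding norm_mult[of "_ * _"] norm_of_real using C(1) by (intro sum_mono mult_left_mono) auto
    finally show ?thesis by (simp add: norm_mult)
  qed
  have 2: "cmod (4 * complex_of_real b * (\<Sum>j=1..k. \<Sum>l=1..n. \<alpha> j * complex_of_real (G (x j) (y l))))
      \<le> 4 * b * (\<Sum>j=1..k. \<Sum>l=1..n. cmod (\<alpha> j) * C)"
  proof -
    have "cmod (\<Sum>j=1..k. \<Sum>l=1..n. \<alpha> j * complex_of_real (G (x j) (y l)))
        \<le> (\<Sum>j=1..k. \<Sum>l=1..n. cmod (\<alpha> j * complex_of_real (G (x j) (y l))))"
      by (intro order.trans[OF norm_sum] sum_mono norm_sum)
    also have "\<dots> \<le> (\<Sum>j=1..k. \<Sum>l=1..n. cmod (\<alpha> j) * C)"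
      unfolding norm_mult norm_of_real using C(2) by (intro sum_mono mult_left_mono) auto
    finally have *: "cmod (\<Sum>j=1..k. \<Sum>l=1..n. \<alpha> j * complex_of_real (G (x j) (y l))) \<le> (\<Sum>j=1..k. \<Sum>l=1..n. cmod (\<alpha> j) * C)" .
    have "4 * b * cmod (\<Sum>j=1..k. \<Sum>l=1..n. \<alpha> j * complex_of_real (G (x j) (y l))) \<le> 4 * b * (\<Sum>j=1..k. \<Sum>l=1..n. cmod (\<alpha> j) * C)"
      using b by (intro mult_left_mono[OF *]) auto
    then show ?thesis using b unfolding norm_mult[of "4 * complex_of_real b"] by (simp add: norm_mult)
  qed
  have 3: "cmod (complex_of_real (4 * b\<^sup>2 * (\<Sum>l=1..n. \<Sum>l'\<in>{l<..n}. G (y l) (y l')))) \<le> 4 * b\<^sup>2 * (\<Sum>l=1..n. \<Sum>l'\<in>{l<..n}. C)"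
  proof -
    have "\<bar>\<Sum>l=1..n. \<Sum>l'\<in>{l<..n}. G (y l) (y l')\<bar> \<le> (\<Sum>l=1..n. \<Sum>l'\<in>{l<..n}. C)"
      using C(3) by (intro order.trans[OF sum_abs] sum_mono)
    then have "4 * b\<^sup>2 * \<bar>\<Sum>l=1..n. \<Sum>l'\<in>{l<..n}. G (y l) (y l')\<bar> \<le> 4 * b\<^sup>2 * (\<Sum>l=1..n. \<Sum>l'\<in>{l<..n}. C)"
      by (intro mult_left_mono) auto
    then show ?thesis unfolding norm_of_real by (simp add: abs_mult)
  qed
  have "cmod (- 4 * A - B - D) \<le> cmod (4 * A) + cmod B + cmod D" for A B D
    using norm_triangle_ineq4[of "- 4 * A - B" D] norm_triangle_ineq4[of "- 4 * A" B] by (simp add: norm_mult)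
  from order.trans[OF this add_mono[OF add_mono[OF 1 2] 3]] show ?thesis
    unfolding coulomb_exponent_def .
qed

lemma integrable_prod_sphere_metric:
  "integrable (PiM {1..n::nat} (\<lambda>_. lborel)) (\<lambda>t. (\<Prod>l=1..n. sphere_metric (t l)))"
proof -
  interpret N: product_sigma_finite "\<lambda>_::nat. lborel :: complex measure"
    by (rule product_sigma_finite.intro) (rule lborel.sigma_finite_measure_axioms)
  show ?thesis by (rule N.product_integrable_prod) (auto intro: integrable_sphere_metric)
qed

text \<open>For \<open>a \<le> 0\<close> the lower bound on \<open>G\<close> enters, for \<open>a > 0\<close> the upper one.\<close>

lemma exp_green_bound:
  fixes a p c G :: real
  assumes a: "a \<le> p" and p: "p > 0" and c: "- 1 \<le> c" "c < 1"
    and G: "- 1 \<le> G" "G \<le> (ln 12 - ln (1 - c)) / 2"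
  shows "exp (a * G) \<le> exp \<bar>a\<bar> * 12 powr (p / 2) * (1 - c) powr (- p / 2)"
proof -
  define u where "u = ln 12 - ln (1 - c)"
  have "ln (1 - c) \<le> ln 12" using c by simp
  then have u: "u \<ge> 0" by (simp add: u_def)
  have "a * G \<le> \<bar>a\<bar> + p * (u / 2)"
  proof (cases "a \<le> 0")
    case True
    then have "a * G \<le> a * (- 1)" using G(1) by (intro mult_left_mono_neg) auto
    moreover have "p * (u / 2) \<ge> 0" using p u by simp
    ultimately show ?thesis using True by linarith
  next
    case False
    then have "a * G \<le> a * (u / 2)" using G(2) unfolding u_def by (intro mult_left_mono) auto
    also have "\<dots> \<le> p * (u / 2)" using a u by (intro mult_right_mono) auto
    finally show ?thesis by simp
  qed
  then have "exp (a * G) \<le> exp (\<bar>a\<bar> + p * (u / 2))" by simp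
  also have "\<dots> = exp \<bar>a\<bar> * 12 powr (p / 2) * (1 - c) powr (- p / 2)"
    using c by (simp add: powr_def u_def exp_add[symmetric] field_simps)
  finally show ?thesis .
qed

lemma dist_sphere_sqr:
  fixes u v :: "'a::real_inner"
  assumes "u \<in> sphere 0 1" "v \<in> sphere 0 1"
  shows "(dist u v)\<^sup>2 = 2 * (1 - u \<bullet> v)"
  using assms by (simp add: dist_norm power2_norm_eq_inner inner_diff_left inner_diff_right inner_commute norm_eq_1)

lemma inner_sphere_less_1:
  fixes u v :: "'a::real_inner"
  assumes "u \<in> sphere 0 1" "v \<in> sphere 0 1" "u \<noteq> v"
  shows "- 1 \<le> u \<bullet> v" "u \<bullet> v < 1"
proof -
  show "- 1 \<le> u \<bullet> v" using abs_inner_sphere_le_1[OF assms(1,2)] by simp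
  have "(dist u v)\<^sup>2 > 0" using assms(3) by simp
  then show "u \<bullet> v < 1" unfolding dist_sphere_sqr[OF assms(1,2)] by simp
qed

lemma prod_le_single_times_power:
  fixes f :: "'i \<Rightarrow> real"
  assumes fin: "finite A" and i: "i \<in> A" and f: "\<And>j. j \<in> A \<Longrightarrow> f j \<ge> 0"
    and M: "\<And>j. j \<in> A \<Longrightarrow> j \<noteq> i \<Longrightarrow> f j \<le> M" "M \<ge> 1"
  shows "(\<Prod>j\<in>A. f j) \<le> M ^ card A * (\<Sum>j\<in>A. f j)"
proof -
  have "(\<Prod>j\<in>A. f j) = f i * (\<Prod>j\<in>A - {i}. f j)" by (rule prod.remove[OF fin i])
  also have "\<dots> \<le> f i * (\<Prod>j\<in>A - {i}. M)"
    using f i M by (intro mult_left_mono prod_mono) auto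
  also have "(\<Prod>j\<in>A - {i}. M) = M ^ card (A - {i})" by simp
  also have "f i * M ^ card (A - {i}) \<le> (\<Sum>j\<in>A. f j) * M ^ card A"
    using f i M fin by (intro mult_mono member_le_sum power_increasing card_mono sum_nonneg) auto
  finally show ?thesis by (simp add: mult.commute)
qed

context correlation_setting
begin

lemma x_neq: "i \<in> {1..k} \<Longrightarrow> j \<in> {1..k} \<Longrightarrow> i \<noteq> j \<Longrightarrow> x i \<noteq> x j"
  using inj_onD[OF x_inj] by blast

lemma coulomb_weight_tendsto:
  assumes "\<And>j j'. j \<in> {1..k} \<Longrightarrow> j' \<in> {j<..k} \<Longrightarrow> ((\<lambda>i. Gs i (x j) (x j')) \<longlongrightarrow> G (x j) (x j')) F"
    and "\<And>j l. j \<in> {1..k} \<Longrightarrow> l \<in> {1..n} \<Longrightarrow> ((\<lambda>i. Gs i (x j) (stereo_inv (t l))) \<longlongrightarrow> G (x j) (stereo_inv (t l))) F"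
    and "\<And>l l'. l \<in> {1..n} \<Longrightarrow> l' \<in> {l<..n} \<Longrightarrow> ((\<lambda>i. Gs i (stereo_inv (t l)) (stereo_inv (t l'))) \<longlongrightarrow> G (stereo_inv (t l)) (stereo_inv (t l'))) F"
  shows "((\<lambda>i. coulomb_weight (Gs i) n k \<alpha> x b t)
    \<longlongrightarrow> coulomb_weight G n k \<alpha> x b t) F"
  by (intro tendsto_mult tendsto_const tendsto_exp coulomb_exponent_tendsto assms)

text \<open>For fixed \<open>lam < 1\<close> the Green functions are bounded uniformly in \<open>L\<close>, so a multiple of the product of the
  conformal factors dominates.\<close>

theorem coulomb_integral_tendsto_L:
  assumes lam: "0 < lam" "lam < 1"
  shows "(\<lambda>L. coulomb_integral (reg_green lam L) n) \<longlonglongrightarrow> coulomb_integral (green_kernel lam) n"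
  unfolding coulomb_integral_def
proof (rule integral_dominated_convergence)
  let ?P = "PiM {1..n} (\<lambda>_. lborel :: complex measure)"
  define C where "C = 1 / (1 - lam)"
  define K where "K = 4 * (\<Sum>j=1..k. \<Sum>j'\<in>{j<..k}. cmod (\<alpha> j * \<alpha> j') * C)
    + 4 * b * (\<Sum>j=1..k. \<Sum>l=1..n. cmod (\<alpha> j) * C) + 4 * b\<^sup>2 * (\<Sum>l=1..n. \<Sum>l'\<in>{l<..n}. C)"
  have xs: "x j \<in> sphere 0 1" if "j \<in> {1..k}" for j using x_sphere[OF that] by simp
  show "(\<lambda>t. coulomb_weight (green_kernel lam) n k \<alpha> x b t) \<in> borel_measurable ?P"
    by (intro measurable_coulomb_weight measurable_green_kernel)
  show "(\<lambda>t. coulomb_weight (reg_green lam L) n k \<alpha> x b t) \<in> borel_measurable ?P" for L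
    by (intro measurable_coulomb_weight measurable_reg_green lam)
  show "integrable ?P (\<lambda>t. exp K * (\<Prod>l=1..n. sphere_metric (t l)))"
    using integrable_prod_sphere_metric by simp
  show "AE t in ?P. (\<lambda>L. coulomb_weight (reg_green lam L) n k \<alpha> x b t)
      \<longlonglongrightarrow> coulomb_weight (green_kernel lam) n k \<alpha> x b t"
    by (intro AE_I2 coulomb_weight_tendsto; unfold green_kernel_def; intro reg_green_tendsto lam stereo_inv_in_sphere xs; simp)
  fix L
  show "AE t in ?P. norm (coulomb_weight (reg_green lam L) n k \<alpha> x b t)
      \<le> exp K * (\<Prod>l=1..n. sphere_metric (t l))"
  proof (rule AE_I2)
    fix t
    have pos: "(\<Prod>l=1..n. sphere_metric (t l)) \<ge> 0"
      by (intro prod_nonneg) (auto intro: less_imp_le sphere_metric_pos)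
    have "cmod (exp (coulomb_exponent (reg_green lam L) n k \<alpha> x b (\<lambda>l. stereo_inv (t l)))) \<le> exp K"
    proof (rule order.trans[OF norm_exp_le])
      have "cmod (coulomb_exponent (reg_green lam L) n k \<alpha> x b (\<lambda>l. stereo_inv (t l))) \<le> K"
        unfolding K_def C_def
        by (rule norm_coulomb_exponent_le) (assumption | rule abs_reg_green_le lam stereo_inv_in_sphere xs b_pos)+
      then show "exp (cmod (coulomb_exponent (reg_green lam L) n k \<alpha> x b (\<lambda>l. stereo_inv (t l)))) \<le> exp K" by simp
    qed
    then have "cmod (exp (coulomb_exponent (reg_green lam L) n k \<alpha> x b (\<lambda>l. stereo_inv (t l)))) * (\<Prod>l=1..n. sphere_metric (t l))
        \<le> exp K * (\<Prod>l=1..n. sphere_metric (t l))"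
      by (rule mult_right_mono[OF _ pos])
    then show "norm (coulomb_weight (reg_green lam L) n k \<alpha> x b t)
      \<le> exp K * (\<Prod>l=1..n. sphere_metric (t l))"
      unfolding norm_mult norm_of_real using pos by (simp add: mult.commute)
  qed
qed

text \<open>A common exponent below \<open>2\<close>, the threshold of \<open>integrable_chordal_power\<close>, for the singularities at all
  \<open>x\<^sub>j\<close>.\<close>

lemma charge_bound:
  obtains p where "0 < p" "p < 2" "\<And>j. j \<in> {1..k} \<Longrightarrow> - 4 * b * Re (\<alpha> j) \<le> p"
proof -
  define p where "p = Max (insert 1 ((\<lambda>j. - 4 * b * Re (\<alpha> j)) ` {1..k}))"
  have fin: "finite (insert 1 ((\<lambda>j. - 4 * b * Re (\<alpha> j)) ` {1..k}))" by simp
  have lt: "- 4 * b * Re (\<alpha> j) < 2" if "j \<in> {1..k}" for j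
    using alpha_gt[OF that] b_pos by (simp add: field_simps)
  have "1 \<le> p" unfolding p_def using fin by (intro Max_ge) auto
  moreover have "p < 2" unfolding p_def using fin lt by (subst Max_less_iff) auto
  moreover have "- 4 * b * Re (\<alpha> j) \<le> p" if "j \<in> {1..k}" for j
    unfolding p_def using fin that by (intro Max_ge) auto
  ultimately show ?thesis using that[of p] by auto
qed

text \<open>A point of the sphere is far from all \<open>x\<^sub>j\<close> except the nearest one, at a distance of at least half the
  minimal distance between the \<open>x\<^sub>j\<close>.  So, up to a constant, the product of the singular factors is no
  worse than their sum.\<close>

lemma chordal_product_bound:
  assumes p: "p > 0" and k: "k \<ge> 1"
  obtains M where "M \<ge> 0" "\<And>y. y \<in> sphere 0 1 \<Longrightarrow>
    (\<Prod>j=1..k. (1 - x j \<bullet> y) powr (- p / 2)) \<le> M * (\<Sum>j=1..k. (1 - x j \<bullet> y) powr (- p / 2))"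
proof -
  have xs: "x j \<in> sphere 0 1" if "j \<in> {1..k}" for j using x_sphere[OF that] by simp
  define D where "D = insert 1 {d. \<exists>i j. i \<in> {1..k} \<and> j \<in> {1..k} \<and> i \<noteq> j \<and> d = dist (x i) (x j)}"
  have "{d. \<exists>i j. i \<in> {1..k} \<and> j \<in> {1..k} \<and> i \<noteq> j \<and> d = dist (x i) (x j)}
      \<subseteq> (\<lambda>p. dist (x (fst p)) (x (snd p))) ` ({1..k} \<times> {1..k})" by force
  then have finD: "finite D" unfolding D_def by (meson finite_SigmaI finite_atLeastAtMost finite_imageI finite_insert finite_subset)
  define \<delta> where "\<delta> = Min D"
  have D0: "d > 0" if d: "d \<in> D" for d
  proof -
    consider "d = 1" | i j where "i \<in> {1..k}" "j \<in> {1..k}" "i \<noteq> j" "d = dist (x i) (x j)"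
      using d unfolding D_def by blast
    then show ?thesis
    proof cases
      case 2
      then show ?thesis using x_neq[OF 2(1,2,3)] by simp
    qed simp
  qed
  have "D \<noteq> {}" by (simp add: D_def)
  then have d0: "\<delta> > 0" unfolding \<delta>_def using D0 Min_in[OF finD] by blast
  have dle: "\<delta> \<le> dist (x i) (x j)" if "i \<in> {1..k}" "j \<in> {1..k}" "i \<noteq> j" for i j
    unfolding \<delta>_def by (rule Min_le[OF finD]) (use that in \<open>unfold D_def, blast\<close>)
  \<comment> \<open>at a distance of at least \<open>\<delta> / 2\<close> one has \<open>1 - x j \<bullet> y \<ge> \<delta>\<^sup>2 / 8\<close>\<close>
  define M where "M = max 1 ((\<delta>\<^sup>2 / 8) powr (- p / 2))"
  show ?thesis
  proof (rule that)
    show "M ^ k \<ge> 0" by (simp add: M_def)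
    fix y :: "real^3" assume y: "y \<in> sphere 0 1"
    obtain i where i: "i \<in> {1..k}" "\<And>j. j \<in> {1..k} \<Longrightarrow> dist (x i) y \<le> dist (x j) y"
    proof -
      have fin: "finite ((\<lambda>j. dist (x j) y) ` {1..k})" "(\<lambda>j. dist (x j) y) ` {1..k} \<noteq> {}" using k by auto
      obtain i where i: "i \<in> {1..k}" "Min ((\<lambda>j. dist (x j) y) ` {1..k}) = dist (x i) y"
        using Min_in[OF fin] by blast
      have "dist (x i) y \<le> dist (x j) y" if "j \<in> {1..k}" for j
        unfolding i(2)[symmetric] by (rule Min_le[OF fin(1)]) (use that in blast)
      then show ?thesis using that[OF i(1)] by blast
    qed
    have "(1 - x j \<bullet> y) powr (- p / 2) \<le> M" if j: "j \<in> {1..k}" "j \<noteq> i" for j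
    proof -
      have "\<delta> \<le> dist (x j) (x i)" by (rule dle[OF j(1) i(1) j(2)])
      also have "\<dots> \<le> dist (x j) y + dist (x i) y" by (rule dist_triangle2)
      finally have "\<delta> \<le> 2 * dist (x j) y" using i(2)[OF j(1)] by simp
      then have "\<delta>\<^sup>2 \<le> (2 * dist (x j) y)\<^sup>2" using d0 by (intro power_mono) auto
      then have "\<delta>\<^sup>2 / 8 \<le> 1 - x j \<bullet> y"
        unfolding power_mult_distrib dist_sphere_sqr[OF xs[OF j(1)] y] by simp
      then have "(1 - x j \<bullet> y) powr (- p / 2) \<le> (\<delta>\<^sup>2 / 8) powr (- p / 2)"
        using d0 p by (intro powr_mono2') auto
      then show ?thesis by (simp add: M_def)
    qed
    then have "(\<Prod>j\<in>{1..k}. (1 - x j \<bullet> y) powr (- p / 2)) \<le> M ^ card {1..k} * (\<Sum>j\<in>{1..k}. (1 - x j \<bullet> y) powr (- p / 2))"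
      by (intro prod_le_single_times_power[OF _ i(1)]) (auto simp: M_def)
    then show "(\<Prod>j=1..k. (1 - x j \<bullet> y) powr (- p / 2)) \<le> M ^ k * (\<Sum>j=1..k. (1 - x j \<bullet> y) powr (- p / 2))" by simp
  qed
qed

text \<open>A dominating function that is uniform in \<open>lam\<close> and a product over the integration variables.  The
  interaction of the \<open>x\<^sub>j\<close> among themselves is bounded because they are distinct, that of the integration variables
  because the exponent contains \<open>- 4 b\<^sup>2\<close> times the kernel and the kernel is at least \<open>- 1\<close>; the
  mixed terms give the factors of \<open>chordal_product_bound\<close>.\<close>

lemma coulomb_weight_domination:
  assumes k: "k \<ge> 1"
  obtains D :: "complex \<Rightarrow> real" and K where "integrable lborel D" "K \<ge> 0"
    "\<And>lam t. 1 / 2 \<le> lam \<Longrightarrow> lam < 1 \<Longrightarrow> (\<And>j l. j \<in> {1..k} \<Longrightarrow> l \<in> {1..n} \<Longrightarrow> stereo_inv (t l) \<noteq> x j) \<Longrightarrow>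
      cmod (coulomb_weight (green_kernel lam) n k \<alpha> x b t)
      \<le> K * (\<Prod>l=1..n. D (t l))"
proof -
  obtain p where p: "0 < p" "p < 2" "\<And>j. j \<in> {1..k} \<Longrightarrow> - 4 * b * Re (\<alpha> j) \<le> p" by (rule charge_bound) blast
  obtain M where M: "M \<ge> 0" "\<And>y. y \<in> sphere 0 1 \<Longrightarrow>
    (\<Prod>j=1..k. (1 - x j \<bullet> y) powr (- p / 2)) \<le> M * (\<Sum>j=1..k. (1 - x j \<bullet> y) powr (- p / 2))"
    using chordal_product_bound[OF p(1) k] by blast
  have xs: "x j \<in> sphere 0 1" if "j \<in> {1..k}" for j using x_sphere[OF that] by simp
  define E where "E = (\<lambda>j. exp \<bar>- 4 * b * Re (\<alpha> j)\<bar> * 12 powr (p / 2))"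
  have E: "E j \<ge> 0" for j by (simp add: E_def)
  define D where "D = (\<lambda>t. sphere_metric t * (\<Prod>j=1..k. E j * (1 - x j \<bullet> stereo_inv t) powr (- p / 2)))"
  define B where "B = (\<lambda>j j'. 1 + \<bar>(ln 12 - ln (1 - x j \<bullet> x j')) / 2\<bar>)"
  define K where "K = exp (4 * (\<Sum>j=1..k. \<Sum>j'\<in>{j<..k}. cmod (\<alpha> j * \<alpha> j') * B j j') + 4 * b\<^sup>2 * (\<Sum>l=1..n. \<Sum>l'\<in>{l<..n}. 1))"
  show ?thesis
  proof (rule that)
    show "K \<ge> 0" by (simp add: K_def)
    show "integrable lborel D"
    proof (rule Bochner_Integration.integrable_bound)
      have "integrable lborel (\<lambda>t. \<Sum>j=1..k. (\<Prod>j=1..k. E j) * M * (sphere_metric t * (1 - x j \<bullet> stereo_inv t) powr (- p / 2)))"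
      proof (intro Bochner_Integration.integrable_sum integrable_mult_right)
        fix j assume "j \<in> {1..k}"
        then show "integrable lborel (\<lambda>t. sphere_metric t * (1 - x j \<bullet> stereo_inv t) powr (- p / 2))"
          using integrable_chordal_power[OF p(1,2), of "stereo (x j)"] stereo_inv_stereo[OF x_sphere] by simp
      qed
      then show "integrable lborel (\<lambda>t. \<Sum>j=1..k. (\<Prod>j=1..k. E j) * M * (sphere_metric t * (1 - x j \<bullet> stereo_inv t) powr (- p / 2)))" .
      show "D \<in> borel_measurable lborel" unfolding D_def by measurable
      show "AE t in lborel. norm (D t) \<le> norm (\<Sum>j=1..k. (\<Prod>j=1..k. E j) * M * (sphere_metric t * (1 - x j \<bullet> stereo_inv t) powr (- p / 2)))"
      proof (rule AE_I2)
        fix t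
        have D0: "D t \<ge> 0" unfolding D_def
          using E by (intro mult_nonneg_nonneg prod_nonneg less_imp_le[OF sphere_metric_pos]) auto
        have "D t = sphere_metric t * ((\<Prod>j=1..k. E j) * (\<Prod>j=1..k. (1 - x j \<bullet> stereo_inv t) powr (- p / 2)))"
          unfolding D_def by (simp only: prod.distrib)
        also have "\<dots> \<le> sphere_metric t * ((\<Prod>j=1..k. E j) * (M * (\<Sum>j=1..k. (1 - x j \<bullet> stereo_inv t) powr (- p / 2))))"
          using E by (intro mult_left_mono M(2) stereo_inv_in_sphere prod_nonneg less_imp_le[OF sphere_metric_pos]) auto
        also have "\<dots> = (\<Sum>j=1..k. (\<Prod>j=1..k. E j) * M * (sphere_metric t * (1 - x j \<bullet> stereo_inv t) powr (- p / 2)))"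
          by (simp add: sum_distrib_left mult_ac)
        finally show "norm (D t) \<le> norm (\<Sum>j=1..k. (\<Prod>j=1..k. E j) * M * (sphere_metric t * (1 - x j \<bullet> stereo_inv t) powr (- p / 2)))"
          using D0 by simp
      qed
    qed
    fix lam :: real and t :: "nat \<Rightarrow> complex"
    assume lam: "1 / 2 \<le> lam" "lam < 1" and neq: "\<And>j l. j \<in> {1..k} \<Longrightarrow> l \<in> {1..n} \<Longrightarrow> stereo_inv (t l) \<noteq> x j"
    define y where "y = (\<lambda>l. stereo_inv (t l))"
    have lam0: "0 < lam" using lam by simp
    have lower: "- 1 \<le> green_kernel lam u v" if "u \<in> sphere 0 1" "v \<in> sphere 0 1" for u v
      unfolding green_kernel_def by (rule green_lam_lower[OF abs_inner_sphere_le_1[OF that] lam0 lam(2)])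
    have upper: "green_kernel lam u v \<le> (ln 12 - ln (1 - u \<bullet> v)) / 2" if "u \<in> sphere 0 1" "v \<in> sphere 0 1" "u \<noteq> v" for u v
      unfolding green_kernel_def by (rule green_lam_upper[OF inner_sphere_less_1[OF that] lam])
    have ys: "y l \<in> sphere 0 1" for l unfolding y_def by (rule stereo_inv_in_sphere)
    have 1: "(\<Sum>j=1..k. \<Sum>j'\<in>{j<..k}. Re (- 4 * (\<alpha> j * \<alpha> j' * complex_of_real (green_kernel lam (x j) (x j')))))
        \<le> (\<Sum>j=1..k. \<Sum>j'\<in>{j<..k}. 4 * (cmod (\<alpha> j * \<alpha> j') * B j j'))"
    proof (intro sum_mono)
      fix j j' assume j: "j \<in> {1..k}" "j' \<in> {j<..k}"
      then have j'1: "j' \<in> {1..k}" "j \<noteq> j'" by simp_all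
      note j' = j'1(1) x_neq[OF j(1) j'1]
      have "\<bar>green_kernel lam (x j) (x j')\<bar> \<le> B j j'"
        unfolding B_def using lower[OF xs[OF j(1)] xs[OF j'(1)]] upper[OF xs[OF j(1)] xs[OF j'(1)] j'(2)] by linarith
      then have "cmod (\<alpha> j * \<alpha> j') * \<bar>green_kernel lam (x j) (x j')\<bar> \<le> cmod (\<alpha> j * \<alpha> j') * B j j'"
        by (intro mult_left_mono) auto
      moreover have "Re (- 4 * z) \<le> 4 * cmod z" for z using abs_Re_le_cmod[of z] by simp
      from this[of "\<alpha> j * \<alpha> j' * complex_of_real (green_kernel lam (x j) (x j'))"]
      have "Re (- 4 * (\<alpha> j * \<alpha> j' * complex_of_real (green_kernel lam (x j) (x j')))) \<le> 4 * (cmod (\<alpha> j * \<alpha> j') * \<bar>green_kernel lam (x j) (x j')\<bar>)"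
        unfolding norm_mult norm_of_real .
      ultimately show "Re (- 4 * (\<alpha> j * \<alpha> j' * complex_of_real (green_kernel lam (x j) (x j')))) \<le> 4 * (cmod (\<alpha> j * \<alpha> j') * B j j')"
        by linarith
    qed
    have 2: "exp (\<Sum>j=1..k. \<Sum>l=1..n. - 4 * b * Re (\<alpha> j) * green_kernel lam (x j) (y l))
        \<le> (\<Prod>l=1..n. \<Prod>j=1..k. E j * (1 - x j \<bullet> y l) powr (- p / 2))"
    proof -
      have "exp (\<Sum>j=1..k. \<Sum>l=1..n. - 4 * b * Re (\<alpha> j) * green_kernel lam (x j) (y l))
          = (\<Prod>l=1..n. \<Prod>j=1..k. exp (- 4 * b * Re (\<alpha> j) * green_kernel lam (x j) (y l)))"
        by (subst sum.swap) (simp add: exp_sum)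
      also have "\<dots> \<le> (\<Prod>l=1..n. \<Prod>j=1..k. E j * (1 - x j \<bullet> y l) powr (- p / 2))"
      proof (intro prod_mono conjI)
        fix l j assume l: "l \<in> {1..n}" and j: "j \<in> {1..k}"
        have ne: "x j \<noteq> y l" using neq[OF j l] by (auto simp: y_def)
        show "exp (- 4 * b * Re (\<alpha> j) * green_kernel lam (x j) (y l)) \<le> E j * (1 - x j \<bullet> y l) powr (- p / 2)"
          unfolding E_def
          by (rule exp_green_bound[OF p(3)[OF j] p(1) inner_sphere_less_1[OF xs[OF j] ys ne] lower[OF xs[OF j] ys] upper[OF xs[OF j] ys ne]])
      qed (auto intro!: prod_nonneg)
      finally show ?thesis .
    qed
    have 3: "- (4 * b\<^sup>2 * (\<Sum>l=1..n. \<Sum>l'\<in>{l<..n}. green_kernel lam (y l) (y l'))) \<le> 4 * b\<^sup>2 * (\<Sum>l=1..n. \<Sum>l'\<in>{l<..n}. 1)"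
    proof -
      have "(\<Sum>l=1..n. \<Sum>l'\<in>{l<..n}. - 1) \<le> (\<Sum>l=1..n. \<Sum>l'\<in>{l<..n}. green_kernel lam (y l) (y l'))"
        by (intro sum_mono lower ys)
      moreover have "(\<Sum>l=1..n. \<Sum>l'\<in>{l<..n}. - 1 :: real) = - (\<Sum>l=1..n. \<Sum>l'\<in>{l<..n}. 1)"
        by (simp only: sum_negf)
      ultimately have "- (\<Sum>l=1..n. \<Sum>l'\<in>{l<..n}. green_kernel lam (y l) (y l')) \<le> (\<Sum>l=1..n. \<Sum>l'\<in>{l<..n}. 1)"
        by linarith
      then have "4 * b\<^sup>2 * - (\<Sum>l=1..n. \<Sum>l'\<in>{l<..n}. green_kernel lam (y l) (y l')) \<le> 4 * b\<^sup>2 * (\<Sum>l=1..n. \<Sum>l'\<in>{l<..n}. 1)"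
        by (intro mult_left_mono) auto
      then show ?thesis by simp
    qed
    have re: "Re (coulomb_exponent (green_kernel lam) n k \<alpha> x b y)
      = (\<Sum>j=1..k. \<Sum>j'\<in>{j<..k}. Re (- 4 * (\<alpha> j * \<alpha> j' * complex_of_real (green_kernel lam (x j) (x j')))))
        + (\<Sum>j=1..k. \<Sum>l=1..n. - 4 * b * Re (\<alpha> j) * green_kernel lam (x j) (y l))
        + - (4 * b\<^sup>2 * (\<Sum>l=1..n. \<Sum>l'\<in>{l<..n}. green_kernel lam (y l) (y l')))"
    proof -
      have "Re (- 4 * (\<Sum>j=1..k. \<Sum>j'\<in>{j<..k}. \<alpha> j * \<alpha> j' * complex_of_real (green_kernel lam (x j) (x j'))))
          = (\<Sum>j=1..k. \<Sum>j'\<in>{j<..k}. Re (- 4 * (\<alpha> j * \<alpha> j' * complex_of_real (green_kernel lam (x j) (x j')))))"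
        by (simp only: sum_distrib_left Re_sum)
      moreover have "Re (4 * complex_of_real b * (\<Sum>j=1..k. \<Sum>l=1..n. \<alpha> j * complex_of_real (green_kernel lam (x j) (y l))))
          = - (\<Sum>j=1..k. \<Sum>l=1..n. - 4 * b * Re (\<alpha> j) * green_kernel lam (x j) (y l))"
        by (simp add: sum_distrib_left sum_negf mult.assoc)
      ultimately show ?thesis unfolding coulomb_exponent_def minus_complex.sel Re_complex_of_real by linarith
    qed
    have "exp (Re (coulomb_exponent (green_kernel lam) n k \<alpha> x b y)) \<le> K * (\<Prod>l=1..n. \<Prod>j=1..k. E j * (1 - x j \<bullet> y l) powr (- p / 2))"
    proof -
      have "exp (a + c + d) \<le> exp (a' + d') * P" if "a \<le> a'" "exp c \<le> P" "d \<le> d'" for a c d a' d' P :: real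
      proof -
        have "exp (a + c + d) = exp (a + d) * exp c" by (simp add: exp_add mult_ac)
        also have "\<dots> \<le> exp (a' + d') * P" using that by (intro mult_mono) auto
        finally show ?thesis .
      qed
      from this[OF 1 2 3] show ?thesis unfolding re K_def by (simp add: sum_distrib_left)
    qed
    moreover have "(\<Prod>l=1..n. sphere_metric (t l)) \<ge> 0"
      by (intro prod_nonneg) (auto intro: less_imp_le sphere_metric_pos)
    ultimately have "(\<Prod>l=1..n. sphere_metric (t l)) * exp (Re (coulomb_exponent (green_kernel lam) n k \<alpha> x b y))
        \<le> (\<Prod>l=1..n. sphere_metric (t l)) * (K * (\<Prod>l=1..n. \<Prod>j=1..k. E j * (1 - x j \<bullet> y l) powr (- p / 2)))"
      by (intro mult_left_mono)
    also have "\<dots> = K * (\<Prod>l=1..n. D (t l))"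
      unfolding D_def y_def by (simp add: prod.distrib mult_ac)
    finally show "cmod (coulomb_weight (green_kernel lam) n k \<alpha> x b t)
      \<le> K * (\<Prod>l=1..n. D (t l))"
      unfolding y_def[symmetric] norm_mult norm_of_real norm_exp_eq_Re
      using \<open>(\<Prod>l=1..n. sphere_metric (t l)) \<ge> 0\<close> by simp
  qed
qed

end

section \<open>The Coulomb gas on the plane\<close>

lemma green_kernel_tendsto:
  assumes "u \<in> sphere 0 1" "v \<in> sphere 0 1" "u \<noteq> v"
  shows "((\<lambda>lam. green_kernel lam u v) \<longlongrightarrow> log_kernel u v) (at_left 1)"
  unfolding green_kernel_def log_kernel_def by (rule green_lam_tendsto[OF inner_sphere_less_1[OF assms]])

text \<open>The logarithm of \<open>stereo_inv_inner\<close>.\<close>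

lemma log_kernel_stereo:
  assumes "u \<noteq> v"
  shows "log_kernel (stereo_inv u) (stereo_inv v)
    = chi_const / 2 - ln (cmod (u - v)) - ln (sphere_metric u) / 4 - ln (sphere_metric v) / 4"
proof -
  define A where "A = 1 + (cmod u)\<^sup>2"
  define B where "B = 1 + (cmod v)\<^sup>2"
  have AB: "A > 0" "B > 0" unfolding A_def B_def by (rule one_plus_cmod2_pos)+
  have d: "cmod (u - v) > 0" using assms by simp
  have "ln (1 - stereo_inv u \<bullet> stereo_inv v) = ln 2 + 2 * ln (cmod (u - v)) - (ln A + ln B)"
    unfolding stereo_inv_inner A_def[symmetric] B_def[symmetric]
    using AB d by (simp add: ln_div ln_mult ln_realpow)
  moreover have "ln (sphere_metric u) = ln 4 - 2 * ln A" "ln (sphere_metric v) = ln 4 - 2 * ln B"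
    unfolding sphere_metric_def A_def[symmetric] B_def[symmetric] using AB by (simp_all add: ln_div ln_realpow)
  moreover have "ln (4::real) = 2 * ln 2" using ln_realpow[of 2 2] by simp
  ultimately show ?thesis unfolding log_kernel_def chi_const_def by (simp add: field_simps)
qed

lemma of_real_powr_complex:
  "r > 0 \<Longrightarrow> complex_of_real r powr a = exp (a * complex_of_real (ln r))"
  by (simp add: powr_def Ln_of_real)

lemma measurable_cmod_powr:
  assumes [measurable]: "f \<in> borel_measurable M"
  shows "(\<lambda>t. complex_of_real (cmod (f t)) powr a) \<in> borel_measurable M"
proof -
  have "complex_of_real (cmod z) powr a = (if z = 0 then 0 else exp (a * complex_of_real (ln (cmod z))))" for z
    by (simp add: of_real_powr_complex)
  then show ?thesis by (simp only:) measurable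
qed

lemma measurable_coulomb_integrand:
  "coulomb_integrand w k \<alpha> z b \<in> borel_measurable (PiM {1..w} (\<lambda>_. lborel))"
proof -
  let ?M = "PiM {1..w} (\<lambda>_. lborel :: complex measure)"
  have c: "(\<lambda>t. t l) \<in> borel_measurable ?M" if "l \<in> {1..w}" for l
    using measurable_component_singleton[OF that, of "\<lambda>_. lborel :: complex measure"] by simp
  have 1: "(\<lambda>t. \<Prod>j=1..k. \<Prod>l=1..w. complex_of_real (cmod (z j - t l)) powr (4 * complex_of_real b * \<alpha> j)) \<in> borel_measurable ?M"
    by (intro borel_measurable_prod measurable_cmod_powr borel_measurable_diff borel_measurable_const c)
  have 2: "(\<lambda>t. \<Prod>l=1..w. \<Prod>l'\<in>{l<..w}. complex_of_real (cmod (t l - t l') powr (4 * b\<^sup>2))) \<in> borel_measurable ?M"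
  proof (intro borel_measurable_prod)
    fix l l' assume "l \<in> {1..w}" "l' \<in> {l<..w}"
    then have [measurable]: "(\<lambda>t. t l) \<in> borel_measurable ?M" "(\<lambda>t. t l') \<in> borel_measurable ?M" by (auto intro: c simp del: One_nat_def)
    show "(\<lambda>t. complex_of_real (cmod (t l - t l') powr (4 * b\<^sup>2))) \<in> borel_measurable ?M" by measurable
  qed
  show ?thesis unfolding coulomb_integrand_def[abs_def] using 1 2 by (rule borel_measurable_times)
qed

lemma AE_points_distinct:
  fixes z :: "nat \<Rightarrow> complex" and w k :: nat
  shows "AE t in PiM {1..w} (\<lambda>_. lborel). (\<forall>j\<in>{1..k}. \<forall>l\<in>{1..w}. t l \<noteq> z j) \<and> (\<forall>l\<in>{1..w}. \<forall>l'\<in>{l<..w}. t l \<noteq> t l')"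
proof -
  let ?M = "PiM {1..w} (\<lambda>_. lborel :: complex measure)"
  have 1: "AE t in ?M. t l \<noteq> z j" if "l \<in> {1..w}" for l j
    by (rule AE_PiM_lborel_neq[OF _ that]) auto
  have 2: "AE t in ?M. t l \<noteq> t l'" if l: "l \<in> {1..w}" "l' \<in> {l<..w}" for l l'
  proof (rule AE_PiM_lborel_neq[OF _ l(1)])
    have "l' \<in> {1..w}" using l by simp
    then show "(\<lambda>t. t l') \<in> borel_measurable ?M"
      using measurable_component_singleton[of l' "{1..w}" "\<lambda>_. lborel :: complex measure"] by simp
    show "(t(l := y)) l' = t l'" for t :: "nat \<Rightarrow> complex" and y using l by auto
  qed simp
  have "AE t in ?M. \<forall>j\<in>{1..k}. \<forall>l\<in>{1..w}. t l \<noteq> z j" using 1 by (intro AE_finite_allI) auto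
  moreover have "AE t in ?M. \<forall>l\<in>{1..w}. \<forall>l'\<in>{l<..w}. t l \<noteq> t l'" using 2 by (intro AE_finite_allI) auto
  ultimately show ?thesis by eventually_elim blast
qed

lemma sum_pairs_product:
  fixes a :: "nat \<Rightarrow> complex"
  shows "2 * (\<Sum>i=1..k. \<Sum>j\<in>{i<..k}. a i * a j) = (\<Sum>i=1..k. a i)\<^sup>2 - (\<Sum>i=1..k. (a i)\<^sup>2)"
  using sum_pairs[of "\<lambda>i j. a i * a j" k] by (simp add: mult.commute power2_eq_square sum_product)

text \<open>Sums over pairs of the \<open>ln g\<close> terms of \<open>log_kernel_stereo\<close>, which are additive in the two points.\<close>

lemma sum_pairs_weighted:
  fixes a h :: "nat \<Rightarrow> complex"
  shows "(\<Sum>i=1..k. \<Sum>j\<in>{i<..k}. a i * a j * (h i + h j))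
    = (\<Sum>i=1..k. a i) * (\<Sum>i=1..k. a i * h i) - (\<Sum>i=1..k. (a i)\<^sup>2 * h i)"
proof -
  have "(\<Sum>i=1..k. \<Sum>j=1..k. a i * a j * (h i + h j))
      = (\<Sum>i=1..k. \<Sum>j=1..k. (a i * h i) * a j) + (\<Sum>i=1..k. \<Sum>j=1..k. a i * (a j * h j))"
    by (simp add: sum.distrib[symmetric] algebra_simps)
  also have "\<dots> = 2 * ((\<Sum>i=1..k. a i) * (\<Sum>i=1..k. a i * h i))"
    unfolding sum_product[symmetric] by simp
  finally have 1: "(\<Sum>i=1..k. \<Sum>j=1..k. a i * a j * (h i + h j)) = 2 * ((\<Sum>i=1..k. a i) * (\<Sum>i=1..k. a i * h i))" .
  have "(\<Sum>i=1..k. \<Sum>j=1..k. a i * a j * (h i + h j))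
      = 2 * (\<Sum>i=1..k. (a i)\<^sup>2 * h i) + 2 * (\<Sum>i=1..k. \<Sum>j\<in>{i<..k}. a i * a j * (h i + h j))"
    by (subst sum_pairs) (auto simp: power2_eq_square algebra_simps sum_distrib_left)
  then have "2 * (\<Sum>i=1..k. \<Sum>j\<in>{i<..k}. a i * a j * (h i + h j))
      = 2 * ((\<Sum>i=1..k. a i) * (\<Sum>i=1..k. a i * h i) - (\<Sum>i=1..k. (a i)\<^sup>2 * h i))"
    unfolding 1 by (simp add: algebra_simps)
  then show ?thesis by (rule mult_left_cancel[THEN iffD1, rotated]) simp
qed

context correlation_setting
begin

definition z_pt :: "nat \<Rightarrow> complex" where
  "z_pt j = stereo (x j)"

lemma stereo_inv_z_pt: "j \<in> {1..k} \<Longrightarrow> stereo_inv (z_pt j) = x j"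
  unfolding z_pt_def by (rule stereo_inv_stereo[OF x_sphere])

lemma z_pt_neq: "i \<in> {1..k} \<Longrightarrow> j \<in> {1..k} \<Longrightarrow> i \<noteq> j \<Longrightarrow> z_pt i \<noteq> z_pt j"
  using x_neq stereo_inv_z_pt by metis

lemma stereo_inv_neq: "u \<noteq> v \<Longrightarrow> stereo_inv u \<noteq> stereo_inv v"
  by (metis stereo_stereo_inv)

text \<open>Dominated convergence off the null set where points collide; the integrability of the limit comes with
  it.\<close>

theorem coulomb_integral_tendsto_lam:
  assumes k: "k \<ge> 1"
  shows "((\<lambda>lam. coulomb_integral (green_kernel lam) w) \<longlongrightarrow> coulomb_integral log_kernel w) (at_left 1)"
    and "integrable (PiM {1..w} (\<lambda>_. lborel)) (\<lambda>t. coulomb_weight log_kernel w k \<alpha> x b t)"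
proof -
  let ?P = "PiM {1..w} (\<lambda>_. lborel :: complex measure)"
  let ?F = "\<lambda>G t. coulomb_weight G w k \<alpha> x b t"
  obtain D :: "complex \<Rightarrow> real" and K where D: "integrable lborel D" "K \<ge> 0"
    "\<And>lam t. 1 / 2 \<le> lam \<Longrightarrow> lam < 1 \<Longrightarrow> (\<And>j l. j \<in> {1..k} \<Longrightarrow> l \<in> {1..w} \<Longrightarrow> stereo_inv (t l) \<noteq> x j) \<Longrightarrow>
      cmod (?F (green_kernel lam) t) \<le> K * (\<Prod>l=1..w. D (t l))"
    using coulomb_weight_domination[OF k, of w] by blast
  interpret N: product_sigma_finite "\<lambda>_::nat. lborel :: complex measure"
    by (rule product_sigma_finite.intro) (rule lborel.sigma_finite_measure_axioms)
  have xs: "x j \<in> sphere 0 1" if "j \<in> {1..k}" for j using x_sphere[OF that] by simp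
  have intD: "integrable ?P (\<lambda>t. K * (\<Prod>l=1..w. D (t l)))"
    using N.product_integrable_prod[of "{1..w}" "\<lambda>_. D"] D(1) by simp
  have mlog: "?F log_kernel \<in> borel_measurable ?P" by (intro measurable_coulomb_weight measurable_log_kernel)
  have mgr: "?F (green_kernel lam) \<in> borel_measurable ?P" for lam by (intro measurable_coulomb_weight measurable_green_kernel)
  have lim: "AE t in ?P. (\<lambda>i. ?F (green_kernel (S i)) t) \<longlonglongrightarrow> ?F log_kernel t"
    if S: "filterlim S (at_left 1) sequentially" for S
    using AE_points_distinct[where z = z_pt and k = k and w = w]
  proof eventually_elim
    fix t assume t: "(\<forall>j\<in>{1..k}. \<forall>l\<in>{1..w}. t l \<noteq> z_pt j) \<and> (\<forall>l\<in>{1..w}. \<forall>l'\<in>{l<..w}. t l \<noteq> t l')"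
    show "(\<lambda>i. ?F (green_kernel (S i)) t) \<longlonglongrightarrow> ?F log_kernel t"
    proof (rule coulomb_weight_tendsto)
      fix j j' assume j: "j \<in> {1..k}" "j' \<in> {j<..k}"
      then have j': "j' \<in> {1..k}" "j \<noteq> j'" by simp_all
      show "(\<lambda>i. green_kernel (S i) (x j) (x j')) \<longlonglongrightarrow> log_kernel (x j) (x j')"
        by (rule filterlim_compose[OF green_kernel_tendsto[OF xs[OF j(1)] xs[OF j'(1)] x_neq[OF j(1) j']] S])
    next
      fix j l assume jl: "j \<in> {1..k}" "l \<in> {1..w}"
      then have "x j \<noteq> stereo_inv (t l)" using t stereo_inv_z_pt stereo_stereo_inv by metis
      from filterlim_compose[OF green_kernel_tendsto[OF xs[OF jl(1)] stereo_inv_in_sphere this] S]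
      show "(\<lambda>i. green_kernel (S i) (x j) (stereo_inv (t l))) \<longlonglongrightarrow> log_kernel (x j) (stereo_inv (t l))" .
    next
      fix l l' assume "l \<in> {1..w}" "l' \<in> {l<..w}"
      then have "stereo_inv (t l) \<noteq> stereo_inv (t l')" using t stereo_inv_neq by blast
      from filterlim_compose[OF green_kernel_tendsto[OF stereo_inv_in_sphere stereo_inv_in_sphere this] S]
      show "(\<lambda>i. green_kernel (S i) (stereo_inv (t l)) (stereo_inv (t l'))) \<longlonglongrightarrow> log_kernel (stereo_inv (t l)) (stereo_inv (t l'))" .
    qed
  qed
  have bnd: "AE t in ?P. norm (?F (green_kernel lam) t) \<le> K * (\<Prod>l=1..w. D (t l))" if lam: "1 / 2 \<le> lam" "lam < 1" for lam
    using AE_points_distinct[where z = z_pt and k = k and w = w]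
  proof eventually_elim
    fix t assume t: "(\<forall>j\<in>{1..k}. \<forall>l\<in>{1..w}. t l \<noteq> z_pt j) \<and> (\<forall>l\<in>{1..w}. \<forall>l'\<in>{l<..w}. t l \<noteq> t l')"
    show "norm (?F (green_kernel lam) t) \<le> K * (\<Prod>l=1..w. D (t l))"
    proof (rule D(3)[OF lam])
      fix j l assume "j \<in> {1..k}" "l \<in> {1..w}"
      then show "stereo_inv (t l) \<noteq> x j" using t stereo_inv_z_pt stereo_stereo_inv by metis
    qed
  qed
  show "((\<lambda>lam. coulomb_integral (green_kernel lam) w) \<longlongrightarrow> coulomb_integral log_kernel w) (at_left 1)"
  proof (rule tendsto_at_left_sequentially)
    show "(1 / 2 :: real) < 1" by simp
    fix S :: "nat \<Rightarrow> real"
    assume S: "\<And>n. S n < 1" "\<And>n. 1 / 2 < S n" "incseq S" "S \<longlonglongrightarrow> 1"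
    have "filterlim S (at_left 1) sequentially"
      unfolding filterlim_at using S(1,4) by (auto simp: less_imp_neq)
    from integral_dominated_convergence[OF mlog mgr intD lim[OF this] bnd[OF less_imp_le[OF S(2)] S(1)]]
    show "(\<lambda>n. coulomb_integral (green_kernel (S n)) w) \<longlonglongrightarrow> coulomb_integral log_kernel w"
      unfolding coulomb_integral_def .
  qed
  \<comment> \<open>any sequence approaching \<open>1\<close> from within the range of the domination will do\<close>
  define S where "S = (\<lambda>n. 1 - 1 / (real n + 2))"
  have S: "1 / 2 \<le> S n" "S n < 1" for n by (auto simp: S_def field_simps)
  have "S \<longlonglongrightarrow> 1"
  proof -
    have "(\<lambda>n. 1 / real (n + 2)) \<longlonglongrightarrow> 0" using LIMSEQ_ignore_initial_segment[OF lim_1_over_n, of 2] by simp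
    from tendsto_diff[OF tendsto_const this, of 1] show ?thesis by (simp add: S_def add.commute)
  qed
  then have "filterlim S (at_left 1) sequentially"
    unfolding filterlim_at using S(2) by (auto simp: less_imp_neq)
  from integrable_dominated_convergence[OF mlog mgr intD lim[OF this] bnd[OF S]]
  show "integrable ?P (?F log_kernel)" .
qed

text \<open>The neutrality condition \<open>\<Sum> \<alpha>\<^sub>j + b w = Q\<close>.\<close>

lemma sum_alpha: "(\<Sum>j=1..k. \<alpha> j) = complex_of_real b - 1 / complex_of_real b - complex_of_real b * of_nat w"
  using screening b_pos by (simp add: w_param_def Q_const_def field_simps)

text \<open>The left-hand side is the logarithm of vertex operator prefactors, area measure and interaction.  In
  terms of \<open>A = \<Sum> \<alpha>\<^sub>j\<close>, the coefficient of \<open>\<alpha>\<^sub>j ln g(z\<^sub>j)\<close> is \<open>A + b w - Q\<close>, the coefficient of each \<open>ln g(t\<^sub>l)\<close>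
  is \<open>1 + b A + b\<^sup>2 w - b\<^sup>2\<close>, and the coefficient of \<open>\<chi>\<close> is
  \<open>b A - A\<^sup>2 - 2 b w A - b\<^sup>2 (w\<^sup>2 - w)\<close>.  By neutrality the first two vanish and the third is
  \<open>1 - 1/b\<^sup>2\<close>.\<close>

lemma coulomb_exponent_log_kernel:
  assumes t: "\<forall>j\<in>{1..k}. \<forall>l\<in>{1..w}. t l \<noteq> z_pt j" "\<forall>l\<in>{1..w}. \<forall>l'\<in>{l<..w}. t l \<noteq> t l'"
  shows "(\<Sum>j=1..k. complex_of_real chi_const * \<alpha> j * (complex_of_real b - \<alpha> j)
        - conf_weight b (\<alpha> j) * complex_of_real (ln (sphere_metric (z_pt j))))
      + complex_of_real (\<Sum>l=1..w. ln (sphere_metric (t l)))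
      + coulomb_exponent log_kernel w k \<alpha> x b (\<lambda>l. stereo_inv (t l))
    = complex_of_real (chi_const * (1 - 1 / b\<^sup>2))
      + (\<Sum>j=1..k. \<Sum>j'\<in>{j<..k}. 4 * \<alpha> j * \<alpha> j' * complex_of_real (ln (cmod (z_pt j - z_pt j'))))
      + (\<Sum>j=1..k. \<Sum>l=1..w. 4 * complex_of_real b * \<alpha> j * complex_of_real (ln (cmod (z_pt j - t l))))
      + complex_of_real (\<Sum>l=1..w. \<Sum>l'\<in>{l<..w}. 4 * b\<^sup>2 * ln (cmod (t l - t l')))"
proof -
  define c0 where "c0 = complex_of_real chi_const"
  define B where "B = complex_of_real b"
  define W where "W = (of_nat w :: complex)"
  define h where "h = (\<lambda>j. complex_of_real (ln (sphere_metric (z_pt j))))"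
  define g where "g = (\<lambda>l. complex_of_real (ln (sphere_metric (t l))))"
  define A where "A = (\<Sum>j=1..k. \<alpha> j)"
  define A2 where "A2 = (\<Sum>j=1..k. (\<alpha> j)\<^sup>2)"
  define H where "H = (\<Sum>j=1..k. \<alpha> j * h j)"
  define H2 where "H2 = (\<Sum>j=1..k. (\<alpha> j)\<^sup>2 * h j)"
  define T where "T = (\<Sum>l=1..w. g l)"
  define L1 where "L1 = (\<Sum>j=1..k. \<Sum>j'\<in>{j<..k}. \<alpha> j * \<alpha> j' * complex_of_real (ln (cmod (z_pt j - z_pt j'))))"
  define L2 where "L2 = (\<Sum>j=1..k. \<Sum>l=1..w. \<alpha> j * complex_of_real (ln (cmod (z_pt j - t l))))"
  define L3 where "L3 = (\<Sum>l=1..w. \<Sum>l'\<in>{l<..w}. complex_of_real (ln (cmod (t l - t l'))))"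
  have B0: "B \<noteq> 0" using b_pos by (simp add: B_def)
  have Aval: "A = B - 1 / B - B * W" unfolding A_def B_def W_def by (rule sum_alpha)
  have 1: "(\<Sum>j=1..k. \<Sum>j'\<in>{j<..k}. \<alpha> j * \<alpha> j' * complex_of_real (log_kernel (x j) (x j')))
      = c0 / 4 * (A\<^sup>2 - A2) - L1 - (A * H - H2) / 4"
  proof -
    have "(\<Sum>j=1..k. \<Sum>j'\<in>{j<..k}. \<alpha> j * \<alpha> j' * complex_of_real (log_kernel (x j) (x j')))
        = (\<Sum>j=1..k. \<Sum>j'\<in>{j<..k}. c0 / 2 * (\<alpha> j * \<alpha> j') - \<alpha> j * \<alpha> j' * complex_of_real (ln (cmod (z_pt j - z_pt j')))
            - 1 / 4 * (\<alpha> j * \<alpha> j' * (h j + h j')))"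
    proof (intro sum.cong refl)
      fix j j' assume j: "j \<in> {1..k}" "j' \<in> {j<..k}"
      then have j': "j' \<in> {1..k}" "j \<noteq> j'" by simp_all
      have eq: "log_kernel (x j) (x j') = chi_const / 2 - ln (cmod (z_pt j - z_pt j')) - ln (sphere_metric (z_pt j)) / 4 - ln (sphere_metric (z_pt j')) / 4"
        using log_kernel_stereo[OF z_pt_neq[OF j(1) j']] unfolding stereo_inv_z_pt[OF j(1)] stereo_inv_z_pt[OF j'(1)] .
      show "\<alpha> j * \<alpha> j' * complex_of_real (log_kernel (x j) (x j'))
        = c0 / 2 * (\<alpha> j * \<alpha> j') - \<alpha> j * \<alpha> j' * complex_of_real (ln (cmod (z_pt j - z_pt j'))) - 1 / 4 * (\<alpha> j * \<alpha> j' * (h j + h j'))"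
        unfolding eq c0_def h_def by (simp add: field_simps)
    qed
    also have "\<dots> = c0 / 2 * (\<Sum>j=1..k. \<Sum>j'\<in>{j<..k}. \<alpha> j * \<alpha> j') - L1
        - 1 / 4 * (\<Sum>j=1..k. \<Sum>j'\<in>{j<..k}. \<alpha> j * \<alpha> j' * (h j + h j'))"
      unfolding L1_def by (simp only: sum_subtractf sum_distrib_left)
    also have "(\<Sum>j=1..k. \<Sum>j'\<in>{j<..k}. \<alpha> j * \<alpha> j') = (A\<^sup>2 - A2) / 2"
      unfolding A_def A2_def sum_pairs_product[symmetric] by simp
    also have "(\<Sum>j=1..k. \<Sum>j'\<in>{j<..k}. \<alpha> j * \<alpha> j' * (h j + h j')) = A * H - H2"
      using sum_pairs_weighted[of \<alpha> h k] by (simp add: A_def H_def H2_def)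
    finally show ?thesis by (simp add: field_simps)
  qed
  have 2: "(\<Sum>j=1..k. \<Sum>l=1..w. \<alpha> j * complex_of_real (log_kernel (x j) (stereo_inv (t l))))
      = c0 / 2 * (W * A) - L2 - (W * H + A * T) / 4"
  proof -
    have "(\<Sum>j=1..k. \<Sum>l=1..w. \<alpha> j * complex_of_real (log_kernel (x j) (stereo_inv (t l))))
        = (\<Sum>j=1..k. \<Sum>l=1..w. c0 / 2 * \<alpha> j - \<alpha> j * complex_of_real (ln (cmod (z_pt j - t l)))
            - 1 / 4 * (\<alpha> j * h j) - 1 / 4 * (\<alpha> j * g l))"
    proof (intro sum.cong refl)
      fix j l assume jl: "j \<in> {1..k}" "l \<in> {1..w}"
      then have "z_pt j \<noteq> t l" using t(1) by metis
      from log_kernel_stereo[OF this]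
      have eq: "log_kernel (x j) (stereo_inv (t l)) = chi_const / 2 - ln (cmod (z_pt j - t l)) - ln (sphere_metric (z_pt j)) / 4 - ln (sphere_metric (t l)) / 4"
        unfolding stereo_inv_z_pt[OF jl(1)] .
      show "\<alpha> j * complex_of_real (log_kernel (x j) (stereo_inv (t l)))
        = c0 / 2 * \<alpha> j - \<alpha> j * complex_of_real (ln (cmod (z_pt j - t l))) - 1 / 4 * (\<alpha> j * h j) - 1 / 4 * (\<alpha> j * g l)"
        unfolding eq c0_def h_def g_def by (simp add: field_simps)
    qed
    also have "\<dots> = c0 / 2 * (\<Sum>j=1..k. \<Sum>l=1..w. \<alpha> j) - L2 - 1 / 4 * (\<Sum>j=1..k. \<Sum>l=1..w. \<alpha> j * h j)
        - 1 / 4 * (\<Sum>j=1..k. \<Sum>l=1..w. \<alpha> j * g l)"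
      unfolding L2_def by (simp only: sum_subtractf sum_distrib_left)
    also have "(\<Sum>j=1..k. \<Sum>l=1..w. \<alpha> j) = W * A" by (simp add: W_def A_def sum_distrib_left)
    also have "(\<Sum>j=1..k. \<Sum>l=1..w. \<alpha> j * h j) = W * H" by (simp add: W_def H_def sum_distrib_left)
    also have "(\<Sum>j=1..k. \<Sum>l=1..w. \<alpha> j * g l) = A * T" by (simp add: A_def T_def sum_product)
    finally show ?thesis by (simp add: add_divide_distrib diff_diff_add)
  qed
  have 3: "complex_of_real (\<Sum>l=1..w. \<Sum>l'\<in>{l<..w}. log_kernel (stereo_inv (t l)) (stereo_inv (t l')))
      = c0 / 4 * (W\<^sup>2 - W) - L3 - (W * T - T) / 4"
  proof -
    have "complex_of_real (\<Sum>l=1..w. \<Sum>l'\<in>{l<..w}. log_kernel (stereo_inv (t l)) (stereo_inv (t l')))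
        = (\<Sum>l=1..w. \<Sum>l'\<in>{l<..w}. c0 / 2 * (1 * 1) - complex_of_real (ln (cmod (t l - t l'))) - 1 / 4 * (1 * 1 * (g l + g l')))"
      unfolding of_real_sum
    proof (intro sum.cong refl)
      fix l l' assume "l \<in> {1..w}" "l' \<in> {l<..w}"
      then have "t l \<noteq> t l'" using t(2) by blast
      note eq = log_kernel_stereo[OF this]
      show "complex_of_real (log_kernel (stereo_inv (t l)) (stereo_inv (t l')))
        = c0 / 2 * (1 * 1) - complex_of_real (ln (cmod (t l - t l'))) - 1 / 4 * (1 * 1 * (g l + g l'))"
        unfolding eq c0_def g_def by (simp add: field_simps)
    qed
    also have "\<dots> = c0 / 2 * (\<Sum>l=1..w. \<Sum>l'\<in>{l<..w}. 1 * 1) - L3 - 1 / 4 * (\<Sum>l=1..w. \<Sum>l'\<in>{l<..w}. 1 * 1 * (g l + g l'))"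
      unfolding L3_def by (simp only: sum_subtractf sum_distrib_left)
    also have "(\<Sum>l=1..w. \<Sum>l'\<in>{l<..w}. 1 * 1 * (g l + g l')) = W * T - T"
      using sum_pairs_weighted[of "\<lambda>_. 1" g w] by (simp add: W_def T_def)
    also have "(\<Sum>l=1..w. \<Sum>l'\<in>{l<..w}. 1 * 1 :: complex) = (W\<^sup>2 - W) / 2"
      using sum_pairs_product[of "\<lambda>_. 1" w] by (simp add: W_def mult.commute)
    finally show ?thesis by (simp add: field_simps)
  qed
  have 4: "(\<Sum>j=1..k. complex_of_real chi_const * \<alpha> j * (complex_of_real b - \<alpha> j)
        - conf_weight b (\<alpha> j) * complex_of_real (ln (sphere_metric (z_pt j))))
      = c0 * (B * A - A2) - ((B - 1 / B) * H - H2)"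
  proof -
    have "(\<Sum>j=1..k. complex_of_real chi_const * \<alpha> j * (complex_of_real b - \<alpha> j)
        - conf_weight b (\<alpha> j) * complex_of_real (ln (sphere_metric (z_pt j))))
      = (\<Sum>j=1..k. c0 * (B * \<alpha> j - (\<alpha> j)\<^sup>2) - ((B - 1 / B) * (\<alpha> j * h j) - (\<alpha> j)\<^sup>2 * h j))"
      by (intro sum.cong refl) (simp add: conf_weight_def Q_const_def c0_def B_def h_def power2_eq_square algebra_simps)
    then show ?thesis by (simp add: sum_subtractf sum_distrib_left[symmetric] A_def A2_def H_def H2_def)
  qed
  have 5: "complex_of_real (\<Sum>l=1..w. ln (sphere_metric (t l))) = T" by (simp add: T_def g_def)
  have 6: "(\<Sum>j=1..k. \<Sum>j'\<in>{j<..k}. 4 * \<alpha> j * \<alpha> j' * complex_of_real (ln (cmod (z_pt j - z_pt j')))) = 4 * L1"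
    by (simp add: L1_def sum_distrib_left mult.assoc)
  have 7: "(\<Sum>j=1..k. \<Sum>l=1..w. 4 * complex_of_real b * \<alpha> j * complex_of_real (ln (cmod (z_pt j - t l)))) = 4 * B * L2"
    by (simp add: L2_def B_def sum_distrib_left mult.assoc)
  have 8: "complex_of_real (\<Sum>l=1..w. \<Sum>l'\<in>{l<..w}. 4 * b\<^sup>2 * ln (cmod (t l - t l'))) = 4 * B\<^sup>2 * L3"
    by (simp add: L3_def B_def sum_distrib_left mult.assoc)
  have 9: "complex_of_real (chi_const * (1 - 1 / b\<^sup>2)) = c0 * (1 - 1 / B\<^sup>2)" by (simp add: c0_def B_def)
  have 10: "complex_of_real (4 * b\<^sup>2 * r) = 4 * B\<^sup>2 * complex_of_real r" for r by (simp add: B_def)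
  have chi: "B * A - A\<^sup>2 - 2 * B * W * A - B\<^sup>2 * (W\<^sup>2 - W) = 1 - 1 / B\<^sup>2"
    unfolding Aval using B0 by (simp add: field_simps power2_eq_square)
  have hh: "A + B * W = B - 1 / B" unfolding Aval by simp
  have tt: "1 + B * A + B\<^sup>2 * W - B\<^sup>2 = 0"
    unfolding Aval using B0 by (simp add: field_simps power2_eq_square)
  have "c0 * (B * A - A2) - ((B - 1 / B) * H - H2) + T
      + (- 4 * (c0 / 4 * (A\<^sup>2 - A2) - L1 - (A * H - H2) / 4)
         - 4 * B * (c0 / 2 * (W * A) - L2 - (W * H + A * T) / 4)
         - 4 * B\<^sup>2 * (c0 / 4 * (W\<^sup>2 - W) - L3 - (W * T - T) / 4))
    = c0 * (B * A - A\<^sup>2 - 2 * B * W * A - B\<^sup>2 * (W\<^sup>2 - W)) + 4 * L1 + 4 * B * L2 + 4 * B\<^sup>2 * L3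
      + H * (A + B * W - (B - 1 / B)) + T * (1 + B * A + B\<^sup>2 * W - B\<^sup>2)"
    by (simp add: algebra_simps add_divide_distrib diff_divide_distrib)
  also have "\<dots> = c0 * (1 - 1 / B\<^sup>2) + 4 * L1 + 4 * B * L2 + 4 * B\<^sup>2 * L3"
    unfolding chi hh tt by simp
  finally show ?thesis
    unfolding coulomb_exponent_def 10 1 2 3 4 5 6 7 8 9 unfolding B_def[symmetric] .
qed

definition plane_const :: complex where
  "plane_const = complex_of_real ((4 / exp 1) powr (1 - 1 / b\<^sup>2))
     * (\<Prod>j=1..k. \<Prod>j'\<in>{j<..k}. complex_of_real (cmod (z_pt j - z_pt j')) powr (4 * \<alpha> j * \<alpha> j'))"

lemma plane_const_neq_0: "plane_const \<noteq> 0"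
proof -
  have "complex_of_real (cmod (z_pt j - z_pt j')) powr (4 * \<alpha> j * \<alpha> j') \<noteq> 0" if "j \<in> {1..k}" "j' \<in> {j<..k}" for j j'
  proof -
    have "j' \<in> {1..k}" "j \<noteq> j'" using that by simp_all
    from z_pt_neq[OF that(1) this] show ?thesis by simp
  qed
  then show ?thesis unfolding plane_const_def by simp
qed

lemma coulomb_weight_log_kernel:
  assumes t: "\<forall>j\<in>{1..k}. \<forall>l\<in>{1..w}. t l \<noteq> z_pt j" "\<forall>l\<in>{1..w}. \<forall>l'\<in>{l<..w}. t l \<noteq> t l'"
  shows "vertex_const * (coulomb_weight log_kernel w k \<alpha> x b t)
      = plane_const * coulomb_integrand w k \<alpha> z_pt b t"
proof -
  have v: "vertex_const = exp (\<Sum>j=1..k. complex_of_real chi_const * \<alpha> j * (complex_of_real b - \<alpha> j)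
        - conf_weight b (\<alpha> j) * complex_of_real (ln (sphere_metric (z_pt j))))"
    unfolding vertex_const_def z_pt_def[symmetric]
    by (simp add: exp_sum of_real_powr_complex[OF sphere_metric_pos] exp_diff exp_minus divide_inverse)
  have g: "complex_of_real (\<Prod>l=1..w. sphere_metric (t l)) = exp (complex_of_real (\<Sum>l=1..w. ln (sphere_metric (t l))))"
    by (simp add: exp_of_real exp_sum sphere_metric_pos flip: of_real_sum)
  have c: "complex_of_real ((4 / exp 1) powr (1 - 1 / b\<^sup>2)) = exp (complex_of_real (chi_const * (1 - 1 / b\<^sup>2)))"
    by (simp add: powr_def chi_const_def ln_div exp_of_real[symmetric] mult.commute)
  have p1: "(\<Prod>j=1..k. \<Prod>j'\<in>{j<..k}. complex_of_real (cmod (z_pt j - z_pt j')) powr (4 * \<alpha> j * \<alpha> j'))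
      = exp (\<Sum>j=1..k. \<Sum>j'\<in>{j<..k}. 4 * \<alpha> j * \<alpha> j' * complex_of_real (ln (cmod (z_pt j - z_pt j'))))"
    unfolding exp_sum[OF finite_atLeastAtMost] exp_sum[OF finite_greaterThanAtMost]
  proof (intro prod.cong refl of_real_powr_complex)
    fix j j' assume j: "j \<in> {1..k}" "j' \<in> {j<..k}"
    then have "j' \<in> {1..k}" "j \<noteq> j'" by simp_all
    from z_pt_neq[OF j(1) this] show "cmod (z_pt j - z_pt j') > 0" by simp
  qed
  have p2: "(\<Prod>j=1..k. \<Prod>l=1..w. complex_of_real (cmod (z_pt j - t l)) powr (4 * complex_of_real b * \<alpha> j))
      = exp (\<Sum>j=1..k. \<Sum>l=1..w. 4 * complex_of_real b * \<alpha> j * complex_of_real (ln (cmod (z_pt j - t l))))"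
    unfolding exp_sum[OF finite_atLeastAtMost]
  proof (intro prod.cong refl of_real_powr_complex)
    fix j l assume jl: "j \<in> {1..k}" "l \<in> {1..w}"
    then have "z_pt j \<noteq> t l" using t(1) by metis
    then show "cmod (z_pt j - t l) > 0" by simp
  qed
  have p3: "(\<Prod>l=1..w. \<Prod>l'\<in>{l<..w}. complex_of_real (cmod (t l - t l') powr (4 * b\<^sup>2)))
      = exp (complex_of_real (\<Sum>l=1..w. \<Sum>l'\<in>{l<..w}. 4 * b\<^sup>2 * ln (cmod (t l - t l'))))"
    unfolding of_real_sum exp_sum[OF finite_atLeastAtMost] exp_sum[OF finite_greaterThanAtMost]
  proof (intro prod.cong refl)
    fix l l' assume "l \<in> {1..w}" "l' \<in> {l<..w}"
    then have "t l \<noteq> t l'" using t(2) by blast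
    then show "complex_of_real (cmod (t l - t l') powr (4 * b\<^sup>2)) = exp (complex_of_real (4 * b\<^sup>2 * ln (cmod (t l - t l'))))"
      by (simp add: powr_def exp_of_real[symmetric])
  qed
  show ?thesis
    unfolding plane_const_def coulomb_integrand_def v g c p1 p2 p3 mult_exp_exp
    using coulomb_exponent_log_kernel[OF t] by (simp only: add.assoc)
qed

text \<open>Since \<open>plane_const\<close> is not zero, integrability transfers from the sphere to the plane.\<close>

theorem coulomb_integral_log_kernel:
  assumes k: "k \<ge> 1"
  shows "integrable (PiM {1..w} (\<lambda>_. lborel)) (coulomb_integrand w k \<alpha> z_pt b)"
    and "vertex_const * coulomb_integral log_kernel w
      = plane_const * (LINT t|PiM {1..w} (\<lambda>_. lborel). coulomb_integrand w k \<alpha> z_pt b t)"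
proof -
  let ?P = "PiM {1..w} (\<lambda>_. lborel :: complex measure)"
  let ?F = "\<lambda>t. coulomb_weight log_kernel w k \<alpha> x b t"
  have ae: "AE t in ?P. vertex_const * ?F t = plane_const * coulomb_integrand w k \<alpha> z_pt b t"
    using AE_points_distinct[where z = z_pt and k = k and w = w] by eventually_elim (rule coulomb_weight_log_kernel, blast+)
  note int = coulomb_integral_tendsto_lam(2)[OF k]
  have m1: "(\<lambda>t. vertex_const * ?F t) \<in> borel_measurable ?P" using int by simp
  have m2: "(\<lambda>t. plane_const * coulomb_integrand w k \<alpha> z_pt b t) \<in> borel_measurable ?P"
    using measurable_coulomb_integrand by simp
  have "integrable ?P (\<lambda>t. vertex_const * ?F t)" using int by simp
  then have "integrable ?P (\<lambda>t. plane_const * coulomb_integrand w k \<alpha> z_pt b t)"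
    using integrable_cong_AE[OF m1 m2 ae] by blast
  then have "integrable ?P (\<lambda>t. inverse plane_const * (plane_const * coulomb_integrand w k \<alpha> z_pt b t))"
    by (rule integrable_mult_right)
  then show "integrable ?P (coulomb_integrand w k \<alpha> z_pt b)"
    using plane_const_neq_0 by (simp add: mult.assoc[symmetric])
  have "vertex_const * coulomb_integral log_kernel w = (LINT t|?P. vertex_const * ?F t)"
    unfolding coulomb_integral_def by (simp only: integral_mult_right_zero)
  also have "\<dots> = (LINT t|?P. plane_const * coulomb_integrand w k \<alpha> z_pt b t)"
    by (rule integral_cong_AE[OF m1 m2 ae])
  finally show "vertex_const * coulomb_integral log_kernel w = plane_const * (LINT t|?P. coulomb_integrand w k \<alpha> z_pt b t)"
    by (simp only: integral_mult_right_zero)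
qed

lemma correlation_lam_L_tendsto:
  assumes lam: "0 < lam" "lam < 1"
  shows "(\<lambda>L. correlation_lam_L lam L k \<alpha> x b \<mu>) \<longlonglongrightarrow>
    (- complex_of_real \<mu>) ^ w / fact w * (vertex_const * coulomb_integral (green_kernel lam) w)"
  unfolding correlation_lam_L_eq[OF lam] by (intro tendsto_intros coulomb_integral_tendsto_L lam)

lemma correlation_lam_tendsto:
  assumes k: "k \<ge> 1"
  shows "((\<lambda>lam. correlation_lam lam k \<alpha> x b \<mu>) \<longlongrightarrow>
    (- complex_of_real \<mu>) ^ w / fact w * (vertex_const * coulomb_integral log_kernel w)) (at_left 1)"
proof -
  have "((\<lambda>lam. (- complex_of_real \<mu>) ^ w / fact w * (vertex_const * coulomb_integral (green_kernel lam) w)) \<longlongrightarrow>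
    (- complex_of_real \<mu>) ^ w / fact w * (vertex_const * coulomb_integral log_kernel w)) (at_left 1)"
    by (intro tendsto_intros coulomb_integral_tendsto_lam(1) k)
  moreover have "eventually (\<lambda>lam. (- complex_of_real \<mu>) ^ w / fact w * (vertex_const * coulomb_integral (green_kernel lam) w)
      = correlation_lam lam k \<alpha> x b \<mu>) (at_left 1)"
  proof (rule eventually_at_leftI[of 0])
    fix lam :: real assume "lam \<in> {0<..<1}"
    then show "(- complex_of_real \<mu>) ^ w / fact w * (vertex_const * coulomb_integral (green_kernel lam) w)
      = correlation_lam lam k \<alpha> x b \<mu>"
      unfolding correlation_lam_def by (intro limI[symmetric] correlation_lam_L_tendsto) auto
  qed simp
  ultimately show ?thesis by (rule Lim_transform_eventually)
qed

lemma correlation_sphere_eq: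
  assumes k: "k \<ge> 1"
  shows "correlation_sphere k \<alpha> x b \<mu>
    = (- complex_of_real \<mu>) ^ w / fact w * (vertex_const * coulomb_integral log_kernel w)"
  unfolding correlation_sphere_def by (rule tendsto_Lim[OF _ correlation_lam_tendsto[OF k]]) simp

lemma correlation_well_defined:
  assumes k: "k \<ge> 1"
  shows "correlation_well_defined k \<alpha> x b \<mu>"
  unfolding correlation_well_defined_def
proof (intro conjI ballI allI impI)
  fix lam :: real and L :: nat and \<epsilon> :: real
  assume "lam \<in> {0<..<1}" "\<epsilon> > 0"
  then show "\<exists>!c. has_wrong_sign_expectation (mode_set L) (reg_integrand \<epsilon> lam L k \<alpha> x b \<mu>) c"
    by (intro reg_correlation_unique) auto
next
  fix lam :: real and L :: nat
  assume "lam \<in> {0<..<1}"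
  then show "\<exists>c. ((\<lambda>\<epsilon>. reg_correlation \<epsilon> lam L k \<alpha> x b \<mu>) \<longlongrightarrow> c) (at_right 0)"
    using reg_correlation_tendsto[of lam L] by auto
next
  fix lam :: real
  assume "lam \<in> {0<..<1}"
  then show "convergent (\<lambda>L. correlation_lam_L lam L k \<alpha> x b \<mu>)"
    using correlation_lam_L_tendsto[of lam] by (auto simp: convergent_def)
next
  show "\<exists>c. ((\<lambda>lam. correlation_lam lam k \<alpha> x b \<mu>) \<longlongrightarrow> c) (at_left 1)"
    using correlation_lam_tendsto[OF k] by blast
qed

end

lemma correlation_sphere_cong:
  assumes "\<And>j. j \<in> {1..k} \<Longrightarrow> x j = x' j"
  shows "correlation_sphere k \<alpha> x b \<mu> = correlation_sphere k \<alpha> x' b \<mu>"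
proof -
  have "reg_integrand \<epsilon> lam L k \<alpha> x b \<mu> = reg_integrand \<epsilon> lam L k \<alpha> x' b \<mu>" for \<epsilon> lam L
    unfolding reg_integrand_def using assms by (intro ext arg_cong2[where f = "(*)"] prod.cong refl) simp
  then show ?thesis
    unfolding correlation_sphere_def correlation_lam_def correlation_lam_L_def reg_correlation_def by simp
qed

theorem theorem1p3p1:
  fixes b \<mu> :: real and k w :: nat
    and \<alpha> z :: "nat \<Rightarrow> complex" and x :: "nat \<Rightarrow> real^3"
  assumes "b > 0" and "\<mu> > 0" and "k \<ge> 3"
    and "\<And>j. j \<in> {1..k} \<Longrightarrow> Re (\<alpha> j) > - 1 / (2 * b)"
    and "w > 0" and "w_param k \<alpha> b = of_nat w"
    and "\<And>j. j \<in> {1..k} \<Longrightarrow> x j \<in> sphere 0 1 - {north_pole}"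
    and "inj_on x {1..k}"
    and "\<And>j. j \<in> {1..k} \<Longrightarrow> z j = stereo (x j)"
  shows "correlation_well_defined k \<alpha> x b \<mu> \<and>
    integrable (PiM {1..w} (\<lambda>_. lborel)) (coulomb_integrand w k \<alpha> z b) \<and>
    correlation_plane k \<alpha> z b \<mu> = correlation_sphere k \<alpha> x b \<mu> \<and>
    correlation_sphere k \<alpha> x b \<mu> =
      exp (- \<i> * complex_of_real pi * of_nat w) * complex_of_real (\<mu> ^ w) / fact w
      * complex_of_real ((4 / exp 1) powr (1 - 1 / b^2))
      * (\<Prod>j=1..k. \<Prod>j'\<in>{j<..k}.
           complex_of_real (cmod (z j - z j')) powr (4 * \<alpha> j * \<alpha> j'))
      * (LINT t|PiM {1..w} (\<lambda>_. lborel). coulomb_integrand w k \<alpha> z b t)"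
proof -
  interpret correlation_setting b \<mu> k w \<alpha> x
    by unfold_locales (use assms in auto)
  have k: "k \<ge> 1" using \<open>k \<ge> 3\<close> by simp
  have z: "z j = z_pt j" if "j \<in> {1..k}" for j using assms(9)[OF that] by (simp add: z_pt_def)
  have integrand: "coulomb_integrand w k \<alpha> z b = coulomb_integrand w k \<alpha> z_pt b"
    unfolding coulomb_integrand_def using z by (intro ext arg_cong2[where f = "(*)"] prod.cong refl) simp_all
  have "(\<Prod>j=1..k. \<Prod>j'\<in>{j<..k}. complex_of_real (cmod (z j - z j')) powr (4 * \<alpha> j * \<alpha> j'))
      = (\<Prod>j=1..k. \<Prod>j'\<in>{j<..k}. complex_of_real (cmod (z_pt j - z_pt j')) powr (4 * \<alpha> j * \<alpha> j'))"
    using z by (intro prod.cong refl) simp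
  then have const: "complex_of_real ((4 / exp 1) powr (1 - 1 / b^2))
      * (\<Prod>j=1..k. \<Prod>j'\<in>{j<..k}. complex_of_real (cmod (z j - z j')) powr (4 * \<alpha> j * \<alpha> j')) = plane_const"
    unfolding plane_const_def by simp
  have sign: "exp (- \<i> * complex_of_real pi * of_nat w) * complex_of_real (\<mu> ^ w) = (- complex_of_real \<mu>) ^ w"
  proof -
    have "exp (- \<i> * complex_of_real pi * of_nat w) = exp (- (\<i> * complex_of_real pi)) ^ w"
      by (simp add: exp_of_nat_mult[symmetric] mult_ac)
    also have "exp (- (\<i> * complex_of_real pi)) = - 1" by (simp add: exp_minus exp_pi_i)
    finally show ?thesis by (simp add: power_mult_distrib[symmetric])
  qed
  have "correlation_sphere k \<alpha> x b \<mu>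
      = (- complex_of_real \<mu>) ^ w / fact w * (plane_const * (LINT t|PiM {1..w} (\<lambda>_. lborel). coulomb_integrand w k \<alpha> z b t))"
    unfolding correlation_sphere_eq[OF k] coulomb_integral_log_kernel(2)[OF k] integrand ..
  then have "correlation_sphere k \<alpha> x b \<mu> =
      exp (- \<i> * complex_of_real pi * of_nat w) * complex_of_real (\<mu> ^ w) / fact w
      * complex_of_real ((4 / exp 1) powr (1 - 1 / b^2))
      * (\<Prod>j=1..k. \<Prod>j'\<in>{j<..k}.
           complex_of_real (cmod (z j - z j')) powr (4 * \<alpha> j * \<alpha> j'))
      * (LINT t|PiM {1..w} (\<lambda>_. lborel). coulomb_integrand w k \<alpha> z b t)"
    unfolding const[symmetric] sign by (simp only: mult.assoc)
  moreover have "correlation_plane k \<alpha> z b \<mu> = correlation_sphere k \<alpha> x b \<mu>"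
    unfolding correlation_plane_def
  proof (rule correlation_sphere_cong)
    fix j assume "j \<in> {1..k}"
    then show "inv_into (sphere 0 1 - {north_pole}) stereo (z j) = x j"
      using assms(7,9) inv_into_f_f[OF inj_on_stereo] by simp
  qed
  ultimately show ?thesis
    using correlation_well_defined[OF k] coulomb_integral_log_kernel(1)[OF k] integrand by simp
qed

end
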